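(* Let $(\overline{M}^{2m+1}(c),\varphi,\xi,\eta,\overline{g})$ be a Sasakian space form of constant $\varphi$-sectional curvature $c$, whose Ricci tensor $\mathsf{Ric}$ is regarded as a second metric. Let $M^{2m}$ be a Ricci-biharmonic pseudo-Hopf hypersurface in $\overline{M}^{2m+1}(c)$, with $\xi$ tangent to $M^{2m}$, such that $\mathrm{grad}|H|=\alpha\xi$, where $H$ is the mean curvature vector field and $\alpha$ is a function on $M^{2m}$. Then $M^{2m}$ is a minimal hypersurface.
   Context: All objects are smooth. A Sasakian manifold $(\overline M^{2m+1},\varphi,\xi,\eta,\overline g)$ with Levi-Civita connection $\overline\nabla$ satisfies $\varphi^2X=-X+\eta(X)\xi$, $\eta(\xi)=1$, $\varphi\xi=0$, $\eta(X)=\overline g(\xi,X)$, $\overline g(\varphi X,\varphi Y)=\overline g(X,Y)-\eta(X)\eta(Y)$, $d\eta(X,Y)=\overline g(X,\varphi Y)$, $(\overline\nabla_X\varphi)Y=\overline g(X,Y)\xi-\eta(Y)X$ and $\overline\nabla_X\xi=-\varphi X$. It is a Sasakian space form $\overline M^{2m+1}(c)$ if its curvature, with sign convention $\overline R(X,Y)=[\overline\nabla_X,\overline\nabla_Y]-\overline\nabla_{[X,Y]}$, is $$\overline R(X,Y)Z=-\tfrac{c-1}{4}\{\eta(Z)[\eta(Y)X-\eta(X)Y]+[\overline g(Y,Z)\eta(X)-\overline g(X,Z)\eta(Y)]\xi+\overline g(\varphi X,Z)\varphi Y+2\overline g(\varphi X,Y)\varphi Z-\overline g(\varphi Y,Z)\varphi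 X\}+\tfrac{c+3}{4}\{\overline g(Y,Z)X-\overline g(X,Z)Y\}.$$ Its Ricci tensor is $\mathsf{Ric}(X,Y)=k_2\,\overline g(X,Y)+k_1\,\eta(X)\eta(Y)$ with $k_1=\frac{(m+1)(1-c)}{2}$, $k_2=\frac{(m+1)c+3m-1}{2}$ (so $k_1+k_2=2m$). $\mathsf{Ric}$ is regarded as a metric (so $k_2\neq0$); $\nabla^{*}$ is its Levi-Civita connection, explicitly $\nabla^{*}_XY=\overline\nabla_XY-\frac{k_1}{k_2}(\eta(X)\varphi Y+\eta(Y)\varphi X)$, and $R^{*}(X,Y)=[\nabla^*_X,\nabla^*_Y]-\nabla^*_{[X,Y]}$. Hypersurface: for an isometric immersion $\psi:M^{2m}\to\overline M^{2m+1}(c)$ put $g=\psi^*\overline g$, $\nabla$ its Levi-Civita connection, $N$ a local unit normal (with respect to $\overline g$), $V=-\varphi N$ (tangent to $M$), $A$ the shape (Weingarten) operator ($AX=-\overline\nabla_XN$), $B$ the second fundamental form, $H=\frac1{2m}\mathrm{trace}_gB=|H|N$ the mean curvature vector field; norms and gradients are with respect to $\overline g$, $g$. $M$ is minimal if $H=0$. The field $\xi$ is assumed tangent to $M$. Ricci-biharmonic: $M^{2m}$ is called Ricci-biharmonic if $\tau_2^*(\psi)=-\Delta^*H-\mathrm{trace}\,R^*(d\psi(\cdot),H)d\psi(\cdot)=0$. Here $\Delta^*X=-\sum_{\alpha=1}^{2m}(\nabla^*_{e_\alpha}\nabla^*_{e_\alpha}X-\nabla^*_{\nabla_{e_\alpha}e_\alpha}X)$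 for a $g$-orthonormal frame $\{e_\alpha\}$ of $M$ and sections $X$ of $\psi^{-1}(T\overline M)$, and the trace of $R^*$ is taken along $TM$ with respect to $\mathsf{Ric}$, i.e. it equals $\frac1{k_2}\sum_{i=1}^{2m-1}R^*(e_i,H)e_i+\frac1{k_1+k_2}R^*(\xi,H)\xi$ for a $g$-orthonormal frame $\{\xi,e_1,\dots,e_{2m-1}\}$ of $TM$. Pseudo-Hopf: write $TM=D\oplus D^\perp$ with $D^\perp=\mathrm{Span}\{\xi,V\}$ and $D$ the maximal $\varphi$-invariant distribution. $M$ is pseudo-Hopf if $A$ leaves $\mathrm{Span}\{\xi,V\}$ invariant: $AD^\perp\subseteq D^\perp$ (and hence $AD\subseteq D$).
   Formalization: The dimension is restricted to m ≥ 2, so that D is nonzero; for m = 1 the claim fails: with c = 3, a Hopf cylinder over a circle of geodesic curvature 1/√2 is Ricci-biharmonic and pseudo-Hopf with constant |H|, but not minimal. *)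

theory Defs
  imports "HOL-Analysis.Analysis" "HOL-Library.Function_Algebras"
begin

text \<open>Tangent vectors are functionals on functions. The pointwise vector space structure makes
  sums and \<^const>\<open>span\<close> available for them.\<close>

instantiation "fun" :: (type, real_vector) real_vector
begin

definition scaleR_fun :: "real \<Rightarrow> ('a \<Rightarrow> 'b) \<Rightarrow> 'a \<Rightarrow> 'b" where
  "scaleR_fun c f = (\<lambda>x. c *\<^sub>R f x)"

instance
  by standard (auto simp: scaleR_fun_def plus_fun_def fun_eq_iff scaleR_add_left scaleR_add_right)

end


section \<open>Smooth manifolds\<close>

text \<open>For open \<open>S\<close> in a Euclidean space, \<open>Ck_on n S f\<close> says that \<open>f\<close> is of class $C^n$ on \<open>S\<close>
  (all directional derivatives of order at most \<open>n\<close> exist and are continuous).\<close>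

primrec Ck_on :: "nat \<Rightarrow> 'a::euclidean_space set \<Rightarrow> ('a \<Rightarrow> 'b::real_normed_vector) \<Rightarrow> bool" where
  "Ck_on 0 S f \<longleftrightarrow> continuous_on S f"
| "Ck_on (Suc n) S f \<longleftrightarrow>
     (\<exists>f'. (\<forall>x\<in>S. (f has_derivative f' x) (at x)) \<and> (\<forall>v. Ck_on n S (\<lambda>x. f' x v)))"

definition smooth_on :: "'a::euclidean_space set \<Rightarrow> ('a \<Rightarrow> 'b::real_normed_vector) \<Rightarrow> bool" where
  "smooth_on S f \<longleftrightarrow> (\<forall>n. Ck_on n S f)"

text \<open>A manifold is a whole type with a smooth atlas; a chart \<open>(U, x)\<close> has domain \<open>U\<close>. The dimension
  is the dimension of the model space \<open>'e\<close>. Hausdorff and second countable are class constraints.\<close>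

type_synonym ('a, 'e) atlas = "('a set \<times> ('a \<Rightarrow> 'e)) set"

definition smooth_atlas ::
  "('a::{t2_space, second_countable_topology}, 'e::euclidean_space) atlas \<Rightarrow> bool" where
  "smooth_atlas \<A> \<longleftrightarrow>
     (\<Union>(U, x)\<in>\<A>. U) = UNIV \<and>
     (\<forall>(U, x)\<in>\<A>. open U \<and> open (x ` U) \<and> homeomorphism U (x ` U) x (inv_into U x)) \<and>
     (\<forall>(U, x)\<in>\<A>. \<forall>(W, y)\<in>\<A>. smooth_on (x ` (U \<inter> W)) (y \<circ> inv_into U x))"

text \<open>\<open>S\<close> is meant to be open here and in all notions below that take a domain \<open>S\<close>; the functions
  and fields are total, with irrelevant values off \<open>S\<close>.\<close>

definition smooth_fun_on ::
  "('a, 'e::euclidean_space) atlas \<Rightarrow> 'a set \<Rightarrow> ('a \<Rightarrow> 'c::real_normed_vector) \<Rightarrow> bool" where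
  "smooth_fun_on \<A> S f \<longleftrightarrow> (\<forall>(U, x)\<in>\<A>. smooth_on (x ` (U \<inter> S)) (f \<circ> inv_into U x))"

definition smooth_near ::
  "('a::topological_space, 'e::euclidean_space) atlas \<Rightarrow> 'a \<Rightarrow> ('a \<Rightarrow> 'c::real_normed_vector) \<Rightarrow> bool" where
  "smooth_near \<A> p f \<longleftrightarrow> (\<exists>S. open S \<and> p \<in> S \<and> smooth_fun_on \<A> S f)"

definition smooth_map :: "('a::topological_space, 'd::euclidean_space) atlas \<Rightarrow>
    ('b::topological_space, 'e::euclidean_space) atlas \<Rightarrow> ('a \<Rightarrow> 'b) \<Rightarrow> bool" where
  "smooth_map \<A> \<B> \<psi> \<longleftrightarrow>
     continuous_on UNIV \<psi> \<and> (\<forall>(W, y)\<in>\<B>. smooth_fun_on \<A> (\<psi> -` W) (y \<circ> \<psi>))"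


section \<open>Tangent vectors and vector fields\<close>

text \<open>Tangent vectors at \<open>p\<close> are the derivations at \<open>p\<close> of the functions that are smooth near \<open>p\<close>,
  made total by the value 0 on all other functions. Such a derivation depends only on the germ at
  \<open>p\<close>: the indicator function of a neighbourhood of \<open>p\<close> is smooth near \<open>p\<close>.\<close>

type_synonym 'a tvec = "('a \<Rightarrow> real) \<Rightarrow> real"

definition tangent_space ::
  "('a::topological_space, 'e::euclidean_space) atlas \<Rightarrow> 'a \<Rightarrow> 'a tvec set" where
  "tangent_space \<A> p = {v.
     (\<forall>f. \<not> smooth_near \<A> p f \<longrightarrow> v f = 0) \<and>
     (\<forall>f h. smooth_near \<A> p f \<longrightarrow> smooth_near \<A> p h \<longrightarrow> v (\<lambda>q. f q + h q) = v f + v h) \<and>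
     (\<forall>c f. smooth_near \<A> p f \<longrightarrow> v (\<lambda>q. c * f q) = c * v f) \<and>
     (\<forall>f h. smooth_near \<A> p f \<longrightarrow> smooth_near \<A> p h \<longrightarrow> v (\<lambda>q. f q * h q) = v f * h p + f p * v h)}"

definition differential :: "('a::topological_space, 'd::euclidean_space) atlas \<Rightarrow>
    ('b::topological_space, 'e::euclidean_space) atlas \<Rightarrow> ('a \<Rightarrow> 'b) \<Rightarrow> 'a \<Rightarrow> 'a tvec \<Rightarrow> 'b tvec" where
  "differential \<A> \<B> \<psi> p v = (\<lambda>f. if smooth_near \<B> (\<psi> p) f then v (f \<circ> \<psi>) else 0)"

definition immersion :: "('a::topological_space, 'd::euclidean_space) atlas \<Rightarrow>
    ('b::topological_space, 'e::euclidean_space) atlas \<Rightarrow> ('a \<Rightarrow> 'b) \<Rightarrow> bool" where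
  "immersion \<A> \<B> \<psi> \<longleftrightarrow>
     smooth_map \<A> \<B> \<psi> \<and> (\<forall>p. inj_on (differential \<A> \<B> \<psi> p) (tangent_space \<A> p))"

text \<open>Smooth sections over \<open>S\<close> of the pull-back bundle \<open>\<psi>\<inverse>(TB)\<close>, i.e. vector fields along \<open>\<psi>\<close>.\<close>

definition section_on :: "('a::topological_space, 'd::euclidean_space) atlas \<Rightarrow>
    ('b::topological_space, 'e::euclidean_space) atlas \<Rightarrow> ('a \<Rightarrow> 'b) \<Rightarrow> 'a set \<Rightarrow> ('a \<Rightarrow> 'b tvec) \<Rightarrow> bool" where
  "section_on \<A> \<B> \<psi> S X \<longleftrightarrow>
     (\<forall>p\<in>S. X p \<in> tangent_space \<B> (\<psi> p)) \<and>
     (\<forall>W f. open W \<longrightarrow> smooth_fun_on \<B> W f \<longrightarrow> smooth_fun_on \<A> (S \<inter> \<psi> -` W) (\<lambda>p. X p f))"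

definition vector_field_on ::
  "('a::topological_space, 'e::euclidean_space) atlas \<Rightarrow> 'a set \<Rightarrow> ('a \<Rightarrow> 'a tvec) \<Rightarrow> bool" where
  "vector_field_on \<A> S X \<longleftrightarrow> section_on \<A> \<A> (\<lambda>p. p) S X"

definition lie_bracket :: "('a::topological_space, 'e::euclidean_space) atlas \<Rightarrow>
    ('a \<Rightarrow> 'a tvec) \<Rightarrow> ('a \<Rightarrow> 'a tvec) \<Rightarrow> 'a \<Rightarrow> 'a tvec" where
  "lie_bracket \<A> X Y p =
     (\<lambda>f. if smooth_near \<A> p f then X p (\<lambda>q. Y q f) - Y p (\<lambda>q. X q f) else 0)"


section \<open>Metrics and connections\<close>

definition symmetric_tensor :: "('a::topological_space, 'e::euclidean_space) atlas \<Rightarrow>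
    ('a \<Rightarrow> 'a tvec \<Rightarrow> 'a tvec \<Rightarrow> real) \<Rightarrow> bool" where
  "symmetric_tensor \<A> g \<longleftrightarrow>
     (\<forall>p. \<forall>u\<in>tangent_space \<A> p. \<forall>v\<in>tangent_space \<A> p. \<forall>w\<in>tangent_space \<A> p. \<forall>c.
        g p u v = g p v u \<and> g p (u + v) w = g p u w + g p v w \<and> g p (c *\<^sub>R u) v = c * g p u v) \<and>
     (\<forall>S X Y. open S \<longrightarrow> vector_field_on \<A> S X \<longrightarrow> vector_field_on \<A> S Y \<longrightarrow>
        smooth_fun_on \<A> S (\<lambda>p. g p (X p) (Y p)))"

definition pseudo_riemannian_metric :: "('a::topological_space, 'e::euclidean_space) atlas \<Rightarrow>
    ('a \<Rightarrow> 'a tvec \<Rightarrow> 'a tvec \<Rightarrow> real) \<Rightarrow> bool" where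
  "pseudo_riemannian_metric \<A> g \<longleftrightarrow> symmetric_tensor \<A> g \<and>
     (\<forall>p. \<forall>v\<in>tangent_space \<A> p. (\<forall>w\<in>tangent_space \<A> p. g p v w = 0) \<longrightarrow> v = 0)"

definition riemannian_metric :: "('a::topological_space, 'e::euclidean_space) atlas \<Rightarrow>
    ('a \<Rightarrow> 'a tvec \<Rightarrow> 'a tvec \<Rightarrow> real) \<Rightarrow> bool" where
  "riemannian_metric \<A> g \<longleftrightarrow> symmetric_tensor \<A> g \<and>
     (\<forall>p. \<forall>v\<in>tangent_space \<A> p. v \<noteq> 0 \<longrightarrow> g p v v > 0)"

definition pullback_metric :: "('a::topological_space, 'd::euclidean_space) atlas \<Rightarrow>
    ('b::topological_space, 'e::euclidean_space) atlas \<Rightarrow> ('a \<Rightarrow> 'b) \<Rightarrow>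
    ('b \<Rightarrow> 'b tvec \<Rightarrow> 'b tvec \<Rightarrow> real) \<Rightarrow> 'a \<Rightarrow> 'a tvec \<Rightarrow> 'a tvec \<Rightarrow> real" where
  "pullback_metric \<A> \<B> \<psi> g p v w =
     g (\<psi> p) (differential \<A> \<B> \<psi> p v) (differential \<A> \<B> \<psi> p w)"

definition has_gradient :: "('a::topological_space, 'e::euclidean_space) atlas \<Rightarrow>
    ('a \<Rightarrow> 'a tvec \<Rightarrow> 'a tvec \<Rightarrow> real) \<Rightarrow> ('a \<Rightarrow> real) \<Rightarrow> 'a \<Rightarrow> 'a tvec \<Rightarrow> bool" where
  "has_gradient \<A> g f p w \<longleftrightarrow>
     w \<in> tangent_space \<A> p \<and> (\<forall>v\<in>tangent_space \<A> p. g p w v = v f)"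

text \<open>\<open>D p v Y\<close> is the covariant derivative at \<open>p\<close>, in direction \<open>v\<close>, of the section \<open>Y\<close> along \<open>\<psi>\<close>,
  which need only be smooth near \<open>p\<close>.\<close>

type_synonym ('a, 'b) conn = "'a \<Rightarrow> 'a tvec \<Rightarrow> ('a \<Rightarrow> 'b tvec) \<Rightarrow> 'b tvec"

definition connection_along :: "('a::topological_space, 'd::euclidean_space) atlas \<Rightarrow>
    ('b::topological_space, 'e::euclidean_space) atlas \<Rightarrow> ('a \<Rightarrow> 'b) \<Rightarrow> ('a, 'b) conn \<Rightarrow> bool" where
  "connection_along \<A> \<B> \<psi> D \<longleftrightarrow>
     (\<forall>S X Y. open S \<longrightarrow> vector_field_on \<A> S X \<longrightarrow> section_on \<A> \<B> \<psi> S Y \<longrightarrow>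
        section_on \<A> \<B> \<psi> S (\<lambda>p. D p (X p) Y)) \<and>
     (\<forall>S p Y. open S \<longrightarrow> p \<in> S \<longrightarrow> section_on \<A> \<B> \<psi> S Y \<longrightarrow>
        (\<forall>v\<in>tangent_space \<A> p. \<forall>w\<in>tangent_space \<A> p. \<forall>c.
           D p (v + w) Y = D p v Y + D p w Y \<and> D p (c *\<^sub>R v) Y = c *\<^sub>R D p v Y) \<and>
        (\<forall>v\<in>tangent_space \<A> p. \<forall>Z. section_on \<A> \<B> \<psi> S Z \<longrightarrow>
           D p v (\<lambda>q. Y q + Z q) = D p v Y + D p v Z) \<and>
        (\<forall>v\<in>tangent_space \<A> p. \<forall>f::'a \<Rightarrow> real. smooth_fun_on \<A> S f \<longrightarrow>
           D p v (\<lambda>q. f q *\<^sub>R Y q) = v f *\<^sub>R Y p + f p *\<^sub>R D p v Y))"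

definition levi_civita :: "('a::topological_space, 'e::euclidean_space) atlas \<Rightarrow>
    ('a \<Rightarrow> 'a tvec \<Rightarrow> 'a tvec \<Rightarrow> real) \<Rightarrow> ('a, 'a) conn \<Rightarrow> bool" where
  "levi_civita \<A> g nab \<longleftrightarrow> connection_along \<A> \<A> (\<lambda>p. p) nab \<and>
     (\<forall>S X Y. open S \<longrightarrow> vector_field_on \<A> S X \<longrightarrow> vector_field_on \<A> S Y \<longrightarrow>
        (\<forall>p\<in>S. nab p (X p) Y - nab p (Y p) X = lie_bracket \<A> X Y p)) \<and>
     (\<forall>S Y Z. open S \<longrightarrow> vector_field_on \<A> S Y \<longrightarrow> vector_field_on \<A> S Z \<longrightarrow>
        (\<forall>p\<in>S. \<forall>v\<in>tangent_space \<A> p.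
           v (\<lambda>q. g q (Y q) (Z q)) = g p (nab p v Y) (Z p) + g p (Y p) (nab p v Z)))"

text \<open>The connection induced by \<open>nab\<close> on \<open>\<psi>\<inverse>(TB)\<close>; it is determined by this property.\<close>

definition pullback_connection :: "('a::topological_space, 'd::euclidean_space) atlas \<Rightarrow>
    ('b::topological_space, 'e::euclidean_space) atlas \<Rightarrow> ('a \<Rightarrow> 'b) \<Rightarrow> ('b, 'b) conn \<Rightarrow>
    ('a, 'b) conn \<Rightarrow> bool" where
  "pullback_connection \<A> \<B> \<psi> nab D \<longleftrightarrow> connection_along \<A> \<B> \<psi> D \<and>
     (\<forall>W Z p. open W \<longrightarrow> vector_field_on \<B> W Z \<longrightarrow> \<psi> p \<in> W \<longrightarrow> (\<forall>v\<in>tangent_space \<A> p.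
        D p v (\<lambda>q. Z (\<psi> q)) = nab (\<psi> p) (differential \<A> \<B> \<psi> p v) Z))"

definition curvature :: "('a::topological_space, 'e::euclidean_space) atlas \<Rightarrow> ('a, 'a) conn \<Rightarrow>
    ('a \<Rightarrow> 'a tvec) \<Rightarrow> ('a \<Rightarrow> 'a tvec) \<Rightarrow> ('a \<Rightarrow> 'a tvec) \<Rightarrow> 'a \<Rightarrow> 'a tvec" where
  "curvature \<A> nab X Y Z p =
     nab p (X p) (\<lambda>q. nab q (Y q) Z) - nab p (Y p) (\<lambda>q. nab q (X q) Z) - nab p (lie_bracket \<A> X Y p) Z"

text \<open>The value on tangent vectors, by tensoriality the common value for all extensions.\<close>

definition curvature_at :: "('a::topological_space, 'e::euclidean_space) atlas \<Rightarrow> ('a, 'a) conn \<Rightarrow>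
    'a \<Rightarrow> 'a tvec \<Rightarrow> 'a tvec \<Rightarrow> 'a tvec \<Rightarrow> 'a tvec" where
  "curvature_at \<A> nab p u v w =
     (THE r. \<forall>S X Y Z. open S \<longrightarrow> p \<in> S \<longrightarrow>
        vector_field_on \<A> S X \<longrightarrow> vector_field_on \<A> S Y \<longrightarrow> vector_field_on \<A> S Z \<longrightarrow>
        X p = u \<longrightarrow> Y p = v \<longrightarrow> Z p = w \<longrightarrow> r = curvature \<A> nab X Y Z p)"

definition orthonormal_basis_at :: "('a::topological_space, 'e::euclidean_space) atlas \<Rightarrow>
    ('a \<Rightarrow> 'a tvec \<Rightarrow> 'a tvec \<Rightarrow> real) \<Rightarrow> 'a \<Rightarrow> (nat \<Rightarrow> 'a tvec) \<Rightarrow> bool" where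
  "orthonormal_basis_at \<A> g p b \<longleftrightarrow>
     (\<forall>i<DIM('e). b i \<in> tangent_space \<A> p) \<and>
     (\<forall>i<DIM('e). \<forall>j<DIM('e). g p (b i) (b j) = (if i = j then 1 else 0))"

definition orthonormal_frame_on :: "('a::topological_space, 'e::euclidean_space) atlas \<Rightarrow>
    ('a \<Rightarrow> 'a tvec \<Rightarrow> 'a tvec \<Rightarrow> real) \<Rightarrow> 'a set \<Rightarrow> (nat \<Rightarrow> 'a \<Rightarrow> 'a tvec) \<Rightarrow> bool" where
  "orthonormal_frame_on \<A> g S e \<longleftrightarrow>
     (\<forall>i<DIM('e). vector_field_on \<A> S (e i)) \<and>
     (\<forall>p\<in>S. orthonormal_basis_at \<A> g p (\<lambda>i. e i p))"

text \<open>\<open>Ric(v, w)\<close> is the trace of \<open>u \<mapsto> R(u, v)w\<close>. Here and below, traces are computed in some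
  orthonormal basis or local orthonormal frame; they do not depend on its choice.\<close>

definition ricci_tensor :: "('a::topological_space, 'e::euclidean_space) atlas \<Rightarrow>
    ('a \<Rightarrow> 'a tvec \<Rightarrow> 'a tvec \<Rightarrow> real) \<Rightarrow> ('a, 'a) conn \<Rightarrow>
    ('a \<Rightarrow> 'a tvec \<Rightarrow> 'a tvec \<Rightarrow> real) \<Rightarrow> bool" where
  "ricci_tensor \<A> g nab Ric \<longleftrightarrow>
     (\<forall>p. \<exists>b. orthonormal_basis_at \<A> g p b \<and>
        (\<forall>v\<in>tangent_space \<A> p. \<forall>w\<in>tangent_space \<A> p.
           Ric p v w = (\<Sum>i<DIM('e). g p (curvature_at \<A> nab p (b i) v w) (b i))))"


section \<open>Sasakian space forms\<close>

text \<open>The factor 1/2 is the convention for \<open>d\<eta>\<close> under which \<open>d\<eta>(X, Y) = g(X, \<phi> Y)\<close> agrees with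
  \<open>\<nabla>\<^sub>X \<xi> = - \<phi> X\<close>.\<close>

definition ext_deriv :: "('a::topological_space, 'e::euclidean_space) atlas \<Rightarrow>
    ('a \<Rightarrow> 'a tvec \<Rightarrow> real) \<Rightarrow> ('a \<Rightarrow> 'a tvec) \<Rightarrow> ('a \<Rightarrow> 'a tvec) \<Rightarrow> 'a \<Rightarrow> real" where
  "ext_deriv \<A> \<eta> X Y p =
     (X p (\<lambda>q. \<eta> q (Y q)) - Y p (\<lambda>q. \<eta> q (X q)) - \<eta> p (lie_bracket \<A> X Y p)) / 2"

definition sasakian :: "('a::{t2_space, second_countable_topology}, 'e::euclidean_space) atlas \<Rightarrow>
    ('a \<Rightarrow> 'a tvec \<Rightarrow> 'a tvec) \<Rightarrow> ('a \<Rightarrow> 'a tvec) \<Rightarrow> ('a \<Rightarrow> 'a tvec \<Rightarrow> real) \<Rightarrow>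
    ('a \<Rightarrow> 'a tvec \<Rightarrow> 'a tvec \<Rightarrow> real) \<Rightarrow> ('a, 'a) conn \<Rightarrow> bool" where
  "sasakian \<A> \<phi> \<xi> \<eta> g nab \<longleftrightarrow>
     smooth_atlas \<A> \<and> odd DIM('e) \<and> riemannian_metric \<A> g \<and> levi_civita \<A> g nab \<and>
     vector_field_on \<A> UNIV \<xi> \<and>
     (\<forall>S X. open S \<longrightarrow> vector_field_on \<A> S X \<longrightarrow> vector_field_on \<A> S (\<lambda>p. \<phi> p (X p))) \<and>
     (\<forall>p. \<forall>v\<in>tangent_space \<A> p. \<forall>w\<in>tangent_space \<A> p. \<forall>c.
        \<phi> p v \<in> tangent_space \<A> p \<and> \<phi> p (v + w) = \<phi> p v + \<phi> p w \<and> \<phi> p (c *\<^sub>R v) = c *\<^sub>R \<phi> p v \<and>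
        \<phi> p (\<phi> p v) = - v + \<eta> p v *\<^sub>R \<xi> p \<and>
        \<eta> p v = g p (\<xi> p) v \<and>
        g p (\<phi> p v) (\<phi> p w) = g p v w - \<eta> p v * \<eta> p w) \<and>
     (\<forall>p. \<eta> p (\<xi> p) = 1 \<and> \<phi> p (\<xi> p) = 0) \<and>
     (\<forall>S X Y. open S \<longrightarrow> vector_field_on \<A> S X \<longrightarrow> vector_field_on \<A> S Y \<longrightarrow>
        (\<forall>p\<in>S.
           ext_deriv \<A> \<eta> X Y p = g p (X p) (\<phi> p (Y p)) \<and>
           nab p (X p) (\<lambda>q. \<phi> q (Y q)) - \<phi> p (nab p (X p) Y)
             = g p (X p) (Y p) *\<^sub>R \<xi> p - \<eta> p (Y p) *\<^sub>R X p \<and>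
           nab p (X p) \<xi> = - \<phi> p (X p)))"

definition sasakian_space_form ::
  "('a::{t2_space, second_countable_topology}, 'e::euclidean_space) atlas \<Rightarrow>
    ('a \<Rightarrow> 'a tvec \<Rightarrow> 'a tvec) \<Rightarrow> ('a \<Rightarrow> 'a tvec) \<Rightarrow> ('a \<Rightarrow> 'a tvec \<Rightarrow> real) \<Rightarrow>
    ('a \<Rightarrow> 'a tvec \<Rightarrow> 'a tvec \<Rightarrow> real) \<Rightarrow> ('a, 'a) conn \<Rightarrow> real \<Rightarrow> bool" where
  "sasakian_space_form \<A> \<phi> \<xi> \<eta> g nab c \<longleftrightarrow> sasakian \<A> \<phi> \<xi> \<eta> g nab \<and>
     (\<forall>S X Y Z. open S \<longrightarrow>
        vector_field_on \<A> S X \<longrightarrow> vector_field_on \<A> S Y \<longrightarrow> vector_field_on \<A> S Z \<longrightarrow>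
        (\<forall>p\<in>S. curvature \<A> nab X Y Z p =
           - ((c - 1) / 4) *\<^sub>R
             (\<eta> p (Z p) *\<^sub>R (\<eta> p (Y p) *\<^sub>R X p - \<eta> p (X p) *\<^sub>R Y p)
              + (g p (Y p) (Z p) * \<eta> p (X p) - g p (X p) (Z p) * \<eta> p (Y p)) *\<^sub>R \<xi> p
              + g p (\<phi> p (X p)) (Z p) *\<^sub>R \<phi> p (Y p)
              + (2 * g p (\<phi> p (X p)) (Y p)) *\<^sub>R \<phi> p (Z p)
              - g p (\<phi> p (Y p)) (Z p) *\<^sub>R \<phi> p (X p))
           + ((c + 3) / 4) *\<^sub>R (g p (Y p) (Z p) *\<^sub>R X p - g p (X p) (Z p) *\<^sub>R Y p)))"

text \<open>In a Sasakian space form of dimension \<open>2m + 1\<close>, \<open>Ric = k2 g + k1 \<eta> \<otimes> \<eta>\<close>.\<close>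

definition k1 :: "nat \<Rightarrow> real \<Rightarrow> real" where
  "k1 m c = (real m + 1) * (1 - c) / 2"

definition k2 :: "nat \<Rightarrow> real \<Rightarrow> real" where
  "k2 m c = ((real m + 1) * c + 3 * real m - 1) / 2"


section \<open>Hypersurfaces\<close>

definition second_fundamental_form :: "('a::topological_space, 'd::euclidean_space) atlas \<Rightarrow>
    ('b::topological_space, 'e::euclidean_space) atlas \<Rightarrow> ('a \<Rightarrow> 'b) \<Rightarrow> ('a, 'a) conn \<Rightarrow>
    ('a, 'b) conn \<Rightarrow> ('a \<Rightarrow> 'a tvec) \<Rightarrow> ('a \<Rightarrow> 'a tvec) \<Rightarrow> 'a \<Rightarrow> 'b tvec" where
  "second_fundamental_form \<A> \<B> \<psi> nab D X Y p =
     D p (X p) (\<lambda>q. differential \<A> \<B> \<psi> q (Y q)) - differential \<A> \<B> \<psi> p (nab p (X p) Y)"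

definition mean_curvature_field :: "('a::topological_space, 'd::euclidean_space) atlas \<Rightarrow>
    ('b::topological_space, 'e::euclidean_space) atlas \<Rightarrow> ('a \<Rightarrow> 'b) \<Rightarrow>
    ('b \<Rightarrow> 'b tvec \<Rightarrow> 'b tvec \<Rightarrow> real) \<Rightarrow> ('a, 'a) conn \<Rightarrow> ('a, 'b) conn \<Rightarrow> ('a \<Rightarrow> 'b tvec) \<Rightarrow> bool" where
  "mean_curvature_field \<A> \<B> \<psi> g nab D H \<longleftrightarrow>
     (\<forall>p. \<exists>S e. open S \<and> p \<in> S \<and> orthonormal_frame_on \<A> (pullback_metric \<A> \<B> \<psi> g) S e \<and>
        (\<forall>q\<in>S. H q = (1 / real DIM('d)) *\<^sub>R
           (\<Sum>i<DIM('d). second_fundamental_form \<A> \<B> \<psi> nab D (e i) (e i) q)))"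

definition unit_normal_on :: "('a::topological_space, 'd::euclidean_space) atlas \<Rightarrow>
    ('b::topological_space, 'e::euclidean_space) atlas \<Rightarrow> ('a \<Rightarrow> 'b) \<Rightarrow>
    ('b \<Rightarrow> 'b tvec \<Rightarrow> 'b tvec \<Rightarrow> real) \<Rightarrow> 'a set \<Rightarrow> ('a \<Rightarrow> 'b tvec) \<Rightarrow> bool" where
  "unit_normal_on \<A> \<B> \<psi> g S N \<longleftrightarrow> section_on \<A> \<B> \<psi> S N \<and>
     (\<forall>p\<in>S. g (\<psi> p) (N p) (N p) = 1 \<and>
        (\<forall>v\<in>tangent_space \<A> p. g (\<psi> p) (N p) (differential \<A> \<B> \<psi> p v) = 0))"

text \<open>The vector of \<open>TM\<close> that an immersion identifies with a vector \<open>w\<close> tangent to the immersed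
  manifold.\<close>

definition tangent_lift :: "('a::topological_space, 'd::euclidean_space) atlas \<Rightarrow>
    ('b::topological_space, 'e::euclidean_space) atlas \<Rightarrow> ('a \<Rightarrow> 'b) \<Rightarrow> 'a \<Rightarrow> 'b tvec \<Rightarrow> 'a tvec" where
  "tangent_lift \<A> \<B> \<psi> p w = (THE v. v \<in> tangent_space \<A> p \<and> differential \<A> \<B> \<psi> p v = w)"

definition shape_operator :: "('a::topological_space, 'd::euclidean_space) atlas \<Rightarrow>
    ('b::topological_space, 'e::euclidean_space) atlas \<Rightarrow> ('a \<Rightarrow> 'b) \<Rightarrow> ('a, 'b) conn \<Rightarrow>
    ('a \<Rightarrow> 'b tvec) \<Rightarrow> 'a \<Rightarrow> 'a tvec \<Rightarrow> 'a tvec" where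
  "shape_operator \<A> \<B> \<psi> D N p v = tangent_lift \<A> \<B> \<psi> p (- D p v N)"

definition pseudo_hopf :: "('a::topological_space, 'd::euclidean_space) atlas \<Rightarrow>
    ('b::topological_space, 'e::euclidean_space) atlas \<Rightarrow> ('a \<Rightarrow> 'b) \<Rightarrow>
    ('b \<Rightarrow> 'b tvec \<Rightarrow> 'b tvec) \<Rightarrow> ('b \<Rightarrow> 'b tvec) \<Rightarrow> ('b \<Rightarrow> 'b tvec \<Rightarrow> 'b tvec \<Rightarrow> real) \<Rightarrow>
    ('a, 'b) conn \<Rightarrow> bool" where
  "pseudo_hopf \<A> \<B> \<psi> \<phi> \<xi> g D \<longleftrightarrow>
     (\<forall>S N. open S \<longrightarrow> unit_normal_on \<A> \<B> \<psi> g S N \<longrightarrow>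
        (\<forall>p\<in>S. let D_perp = span {tangent_lift \<A> \<B> \<psi> p (\<xi> (\<psi> p)),
                                  tangent_lift \<A> \<B> \<psi> p (- \<phi> (\<psi> p) (N p))}
               in shape_operator \<A> \<B> \<psi> D N p ` D_perp \<subseteq> D_perp))"

definition rough_laplacian ::
  "nat \<Rightarrow> ('a, 'b) conn \<Rightarrow> ('a, 'a) conn \<Rightarrow> (nat \<Rightarrow> 'a \<Rightarrow> 'a tvec) \<Rightarrow> ('a \<Rightarrow> 'b tvec) \<Rightarrow> 'a \<Rightarrow> 'b tvec" where
  "rough_laplacian n D nab e X p =
     - (\<Sum>i<n. D p (e i p) (\<lambda>q. D q (e i q) X) - D p (nab p (e i p) (e i)) X)"

text \<open>The trace over \<open>TM\<close> of \<open>R\<^sup>*(d\<psi>(\<sqdot>), H)d\<psi>(\<sqdot>)\<close> with respect to \<open>Ric\<close>, for an orthonormal basis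
  \<open>b 0, \<dots>, b (2m - 1)\<close> of a tangent space of \<open>M\<close> with \<open>b 0 = \<xi>\<close>. This basis is \<open>Ric\<close>-orthogonal with
  \<open>Ric(b i, b i) = k2\<close> for \<open>i > 0\<close> and \<open>Ric(b 0, b 0) = k1 + k2\<close>.\<close>

definition ricci_trace :: "('a::topological_space, 'd::euclidean_space) atlas \<Rightarrow>
    ('b::topological_space, 'e::euclidean_space) atlas \<Rightarrow> ('a \<Rightarrow> 'b) \<Rightarrow> ('b, 'b) conn \<Rightarrow>
    nat \<Rightarrow> real \<Rightarrow> (nat \<Rightarrow> 'a tvec) \<Rightarrow> ('a \<Rightarrow> 'b tvec) \<Rightarrow> 'a \<Rightarrow> 'b tvec" where
  "ricci_trace \<A> \<B> \<psi> nabs m c b H p =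
     (let R = (\<lambda>i. curvature_at \<B> nabs (\<psi> p)
                     (differential \<A> \<B> \<psi> p (b i)) (H p) (differential \<A> \<B> \<psi> p (b i)))
      in (1 / k2 m c) *\<^sub>R (\<Sum>i=1..<2*m. R i) + (1 / (k1 m c + k2 m c)) *\<^sub>R R 0)"

text \<open>\<open>nabs\<close> is the Levi-Civita connection of \<open>Ric\<close>, \<open>Ds\<close> its pull-back, and \<open>nab\<close> the Levi-Civita
  connection of the metric on \<open>M\<close> induced by \<open>g\<close>.\<close>

definition ricci_biharmonic :: "('a::topological_space, 'd::euclidean_space) atlas \<Rightarrow>
    ('b::topological_space, 'e::euclidean_space) atlas \<Rightarrow> ('a \<Rightarrow> 'b) \<Rightarrow>
    ('b \<Rightarrow> 'b tvec) \<Rightarrow> ('b \<Rightarrow> 'b tvec \<Rightarrow> 'b tvec \<Rightarrow> real) \<Rightarrow> ('a, 'a) conn \<Rightarrow> ('b, 'b) conn \<Rightarrow>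
    ('a, 'b) conn \<Rightarrow> nat \<Rightarrow> real \<Rightarrow> ('a \<Rightarrow> 'b tvec) \<Rightarrow> bool" where
  "ricci_biharmonic \<A> \<B> \<psi> \<xi> g nab nabs Ds m c H \<longleftrightarrow>
     (\<forall>p. \<exists>S e b. open S \<and> p \<in> S \<and>
        orthonormal_frame_on \<A> (pullback_metric \<A> \<B> \<psi> g) S e \<and>
        orthonormal_basis_at \<A> (pullback_metric \<A> \<B> \<psi> g) p b \<and>
        differential \<A> \<B> \<psi> p (b 0) = \<xi> (\<psi> p) \<and>
        - rough_laplacian (2 * m) Ds nab e H p - ricci_trace \<A> \<B> \<psi> nabs m c b H p = 0)"

end

theory Submission
  imports Defs
begin

text \<open>On the open set where \<open>H \<noteq> 0\<close> put \<open>f = |H|\<close> and \<open>N = H / f\<close>. For \<open>X\<close> in \<open>D\<close> the bracket of \<open>X\<close> and \<open>\<phi> X\<close>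
  has a nonzero \<open>\<xi>\<close>-component, so \<open>grad f = \<alpha> \<xi>\<close> forces \<open>\<alpha> = 0\<close>. Hence \<open>f\<close> is locally constant, and
  the normal component of the Ricci-biharmonic equation becomes
  \<open>|A|\<^sup>2 = 3 - s - s\<^sup>2 - (s\<^sup>2 - s) / m\<close> with \<open>s = 2 m / k2\<close>. On the other hand \<open>A \<xi> = - V\<close>, and for a
  pseudo-Hopf hypersurface the \<open>V\<close>-component of the Codazzi equation for the pair \<open>X\<close>, \<open>\<phi> X\<close> expresses
  \<open>(c + 3) / 4\<close> through the remaining entries of \<open>A\<close>. This bounds \<open>|A|\<^sup>2 - 2\<close> from below by both
  \<open>(c + 3) / 4\<close> and \<open>- (c + 3) / 2\<close>, which is incompatible with the formula for \<open>|A|\<^sup>2\<close>.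

  Identities for sections along \<open>\<psi>\<close> are transported from the ambient manifold as follows: an
  expression that is linear over smooth functions in a section depends only on the value of that
  section at the point, so the section may be replaced by the restriction of an ambient field.\<close>

section \<open>Differentiable functions on Euclidean spaces\<close>

text \<open>The immediate bound |A|^2 >= 2, from A \<xi> = -V and the \<xi>-component of A V, does
  not contradict the formula for |A|^2: its right-hand side tends to 3 as s tends to 0. Moreover
  \<open>Ric\<close> may be indefinite, so k2 and s can have either sign. Since k1 + k2 = 2 m, the
  definition of k2 turns into (m + 1) K = m / s + 1 with K = (c + 3) / 4. Hence K is unbounded near
  s = 0, with the sign of s, and this is what closes the gap: the bound |A|^2 - 2 >= K serves for s
  > 0, the bound |A|^2 - 2 >= -2 K for s < 0. Codazzi supplies both, because it writes K as an inner
  product plus a mixed product of entries of A, and squares control such terms from either side. The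
  rank 2 m - 2 of D is positive for m >= 2, so a unit field X in D exists.\<close>

lemma Ck_on_subset: "Ck_on n S f \<Longrightarrow> T \<subseteq> S \<Longrightarrow> Ck_on n T f"
proof (induction n arbitrary: f)
  case 0
  then show ?case by (auto intro: continuous_on_subset)
next
  case (Suc n)
  then show ?case by (simp; meson subsetD)
qed

text \<open>\<open>Ck_on\<close> differentiates in the full space, so agreement on S transfers
  derivatives only because S is a neighbourhood of each of its points.\<close>

lemma Ck_on_cong:
  assumes "open S" "\<And>x. x \<in> S \<Longrightarrow> f x = g x" "Ck_on n S f"
  shows "Ck_on n S g"
proof (cases n)
  case 0
  then show ?thesis using assms by (simp cong: continuous_on_cong)
next
  case (Suc k)
  then obtain f' where f': "\<forall>x\<in>S. (f has_derivative f' x) (at x)" "\<forall>v. Ck_on k S (\<lambda>x. f' x v)"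
    using assms(3) by auto
  have "\<forall>x\<in>S. (g has_derivative f' x) (at x)"
    using f'(1) assms(1,2) has_derivative_transform_within_open by blast
  then show ?thesis using f'(2) Suc by auto
qed

lemma Ck_on_Suc_D: "Ck_on (Suc n) S f \<Longrightarrow> Ck_on n S f"
proof (induction n arbitrary: f)
  case 0
  then show ?case
    by (auto intro!: continuous_at_imp_continuous_on intro: has_derivative_continuous)
next
  case (Suc n)
  then obtain f' where f': "\<forall>x\<in>S. (f has_derivative f' x) (at x)" "\<forall>v. Ck_on (Suc n) S (\<lambda>x. f' x v)"
    using Ck_on.simps(2) by blast
  then show ?case using Suc.IH by auto
qed

lemma Ck_on_imp_continuous_on: "Ck_on n S f \<Longrightarrow> continuous_on S f"
  by (induction n) (auto dest: Ck_on_Suc_D simp del: Ck_on.simps(2))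

text \<open>The derivative witnesses on different neighbourhoods are unrelated as functions;
  uniqueness of the Frechet derivative lets \<open>frechet_derivative\<close> glue them into one
  witness on S.\<close>

lemma Ck_on_local:
  assumes "\<And>x. x \<in> S \<Longrightarrow> \<exists>T. open T \<and> x \<in> T \<and> Ck_on n T f"
  shows "Ck_on n S f"
  using assms
proof (induction n arbitrary: f)
  case 0
  show ?case unfolding Ck_on.simps
  proof (rule continuous_at_imp_continuous_on, intro ballI)
    fix x assume "x \<in> S"
    then obtain T where "open T" "x \<in> T" "continuous_on T f" using 0 by force
    then show "isCont f x" using continuous_on_eq_continuous_at by blast
  qed
next
  case (Suc k)
  have *: "\<exists>T f'. open T \<and> x \<in> T \<and> (\<forall>y\<in>T. (f has_derivative f' y) (at y)) \<and> (\<forall>v. Ck_on k T (\<lambda>y. f' y v))"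
    if "x \<in> S" for x using Suc.prems[OF that] by (metis Ck_on.simps(2))
  define f' where "f' x = frechet_derivative f (at x)" for x
  have D: "(f has_derivative f' x) (at x)" if "x \<in> S" for x
    using *[OF that] unfolding f'_def by (meson differentiableI frechet_derivative_works)
  have "Ck_on k S (\<lambda>x. f' x v)" for v
  proof (rule Suc.IH)
    fix x assume "x \<in> S"
    then obtain T g where T: "open T" "x \<in> T" "\<And>y. y \<in> T \<Longrightarrow> (f has_derivative g y) (at y)"
      "\<And>v. Ck_on k T (\<lambda>y. g y v)" using *[OF \<open>x \<in> S\<close>] by metis
    have "f' y = g y" if "y \<in> T" for y
      unfolding f'_def using T(3)[OF that] by (metis frechet_derivative_at)
    then have "Ck_on k T (\<lambda>y. f' y v)" using Ck_on_cong[OF T(1) _ T(4)[of v]] by metis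
    then show "\<exists>T. open T \<and> x \<in> T \<and> Ck_on k T (\<lambda>y. f' y v)" using T by blast
  qed
  then show ?case using D by auto
qed

lemma Ck_on_const: "Ck_on n S (\<lambda>x. c)"
proof (induction n arbitrary: c)
  case (Suc n)
  have "Ck_on n S (\<lambda>x. (\<lambda>v. 0 :: 'b) v)" for v :: 'a using Suc by blast
  then show ?case by (auto intro!: exI[of _ "\<lambda>_ _. 0"])
qed auto

lemma Ck_on_bounded_linear: "bounded_linear L \<Longrightarrow> Ck_on n S f \<Longrightarrow> Ck_on n S (\<lambda>x. L (f x))"
proof (induction n arbitrary: f)
  case 0
  then show ?case by (auto intro: bounded_linear.continuous_on)
next
  case (Suc n)
  then obtain f' where f': "\<forall>x\<in>S. (f has_derivative f' x) (at x)" "\<forall>v. Ck_on n S (\<lambda>x. f' x v)"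
    by auto
  then have "\<forall>x\<in>S. ((\<lambda>x. L (f x)) has_derivative (\<lambda>v. L (f' x v))) (at x)"
    using bounded_linear.has_derivative[OF Suc.prems(1)] by blast
  moreover have "\<forall>v. Ck_on n S (\<lambda>x. L (f' x v))" using Suc f' by auto
  ultimately show ?case by (auto intro!: exI[of _ "\<lambda>x v. L (f' x v)"])
qed

lemma Ck_on_add: "Ck_on n S f \<Longrightarrow> Ck_on n S g \<Longrightarrow> Ck_on n S (\<lambda>x. f x + g x)"
proof (induction n arbitrary: f g)
  case 0
  then show ?case by (auto intro: continuous_on_add)
next
  case (Suc n)
  then obtain f' g' where f': "\<forall>x\<in>S. (f has_derivative f' x) (at x)" "\<forall>v. Ck_on n S (\<lambda>x. f' x v)"
    and g': "\<forall>x\<in>S. (g has_derivative g' x) (at x)" "\<forall>v. Ck_on n S (\<lambda>x. g' x v)"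
    by auto
  then have "\<forall>x\<in>S. ((\<lambda>x. f x + g x) has_derivative (\<lambda>v. f' x v + g' x v)) (at x)"
    by (auto intro: has_derivative_add)
  moreover have "\<forall>v. Ck_on n S (\<lambda>x. f' x v + g' x v)" using Suc f' g' by auto
  ultimately show ?case by (auto intro!: exI[of _ "\<lambda>x v. f' x v + g' x v"])
qed

lemma Ck_on_sum: "(\<And>i. i \<in> I \<Longrightarrow> Ck_on n S (f i)) \<Longrightarrow> Ck_on n S (\<lambda>x. \<Sum>i\<in>I. f i x)"
  by (induction I rule: infinite_finite_induct) (auto intro: Ck_on_const Ck_on_add)

lemma Ck_on_bilinear:
  assumes "bounded_bilinear pr"
  shows "Ck_on n S f \<Longrightarrow> Ck_on n S g \<Longrightarrow> Ck_on n S (\<lambda>x. pr (f x) (g x))"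
proof (induction n arbitrary: f g)
  case 0
  then show ?case using assms by (auto intro: bounded_bilinear.continuous_on)
next
  case (Suc n)
  then obtain f' g' where f': "\<forall>x\<in>S. (f has_derivative f' x) (at x)" "\<forall>v. Ck_on n S (\<lambda>x. f' x v)"
    and g': "\<forall>x\<in>S. (g has_derivative g' x) (at x)" "\<forall>v. Ck_on n S (\<lambda>x. g' x v)"
    by auto
  then have "\<forall>x\<in>S. ((\<lambda>x. pr (f x) (g x)) has_derivative (\<lambda>v. pr (f x) (g' x v) + pr (f' x v) (g x))) (at x)"
    using bounded_bilinear.FDERIV[OF assms] by blast
  moreover have "\<forall>v. Ck_on n S (\<lambda>x. pr (f x) (g' x v) + pr (f' x v) (g x))"
    using Suc.IH f' g' Ck_on_Suc_D[OF Suc.prems(1)] Ck_on_Suc_D[OF Suc.prems(2)]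
    by (auto intro!: Ck_on_add)
  ultimately show ?case
    by (auto intro!: exI[of _ "\<lambda>x v. pr (f x) (g' x v) + pr (f' x v) (g x)"])
qed

text \<open>The chain rule differentiates f in the moving direction g' x v, whereas
  \<open>Ck_on\<close> controls fixed directions only. Expanding g' x v in \<open>Basis\<close>
  reduces the former to the latter.\<close>

lemma Ck_on_compose:
  fixes g :: "'a::euclidean_space \<Rightarrow> 'b::euclidean_space"
  shows "Ck_on n T f \<Longrightarrow> Ck_on n S g \<Longrightarrow> g ` S \<subseteq> T \<Longrightarrow> Ck_on n S (\<lambda>x. f (g x))"
proof (induction n arbitrary: f)
  case 0
  then show ?case by (auto intro: continuous_on_compose2)
next
  case (Suc n)
  then obtain f' g' where f': "\<forall>x\<in>T. (f has_derivative f' x) (at x)" "\<forall>v. Ck_on n T (\<lambda>x. f' x v)"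
    and g': "\<forall>x\<in>S. (g has_derivative g' x) (at x)" "\<forall>v. Ck_on n S (\<lambda>x. g' x v)"
    by auto
  have chain: "((\<lambda>x. f (g x)) has_derivative (\<lambda>v. f' (g x) (g' x v))) (at x)" if "x \<in> S" for x
    using has_derivative_compose[of g "g' x" x UNIV f "f' (g x)"] f' g' Suc.prems(3) that by auto
  have "Ck_on n S (\<lambda>x. \<Sum>b\<in>Basis. (g' x v \<bullet> b) *\<^sub>R f' (g x) b)" for v
    using g'(2) f'(2) Ck_on_Suc_D[OF Suc.prems(2)] Suc.prems(3)
    by (intro Ck_on_sum Ck_on_bilinear[OF bounded_bilinear_scaleR] Suc.IH
        Ck_on_bounded_linear[OF bounded_linear_inner_left]) auto
  moreover have "f' (g x) (g' x v) = (\<Sum>b\<in>Basis. (g' x v \<bullet> b) *\<^sub>R f' (g x) b)" if "x \<in> S" for x v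
  proof -
    have "linear (f' (g x))" using f'(1) Suc.prems(3) that has_derivative_linear by blast
    then have "(\<Sum>b\<in>Basis. (g' x v \<bullet> b) *\<^sub>R f' (g x) b) = f' (g x) (\<Sum>b\<in>Basis. (g' x v \<bullet> b) *\<^sub>R b)"
      by (simp add: linear_sum linear_scale)
    then show ?thesis by (simp add: euclidean_representation)
  qed
  moreover have "((\<lambda>x. f (g x)) has_derivative (\<lambda>v. \<Sum>b\<in>Basis. (g' x v \<bullet> b) *\<^sub>R f' (g x) b)) (at x)"
    if "x \<in> S" for x using chain[OF that] calculation(2)[OF that] by simp
  ultimately show ?case
    by (auto intro!: exI[of _ "\<lambda>x v. \<Sum>b\<in>Basis. (g' x v \<bullet> b) *\<^sub>R f' (g x) b"])
qed

text \<open>A general exponent closes the induction, as differentiation lowers r by one. The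
  exponents 1/2 and -1/2 later give smoothness of |H| and 1 / |H| where H does not vanish.\<close>

lemma Ck_on_powr: "Ck_on n {0<..} (\<lambda>x::real. x powr r)"
proof (induction n arbitrary: r)
  case 0
  then show ?case by (auto intro!: continuous_intros)
next
  case (Suc n)
  have "((\<lambda>x. x powr r) has_derivative (\<lambda>v. v * (r * x powr (r - 1)))) (at x)" if "x > 0" for x :: real
    by (rule has_derivative_eq_rhs[OF has_real_derivative_powr[OF that, of r, unfolded has_field_derivative_def]])
      (simp add: fun_eq_iff)
  moreover have "Ck_on n {0<..} (\<lambda>x::real. v * (r * x powr (r - 1)))" for v
    using Ck_on_bounded_linear[OF bounded_linear_mult_right Ck_on_bounded_linear[OF bounded_linear_mult_right Suc[of "r - 1"]]] .
  ultimately show ?case by (auto intro!: exI[of _ "\<lambda>x v. v * (r * x powr (r - 1))"])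
qed

text \<open>The parameter integrals of the Hadamard lemma; the weights \<open>t ^ k\<close> make the induction work.\<close>

lemma Ck_on_integral:
  fixes G :: "'a::euclidean_space \<Rightarrow> real"
  assumes "convex B" "open B" "p \<in> B"
  shows "Ck_on n B G \<Longrightarrow> Ck_on n B (\<lambda>y. integral {0..1} (\<lambda>t. t ^ k * G (p + t *\<^sub>R (y - p))))"
proof (induction n arbitrary: G k)
  case 0
  have inB: "p + t *\<^sub>R (y - p) \<in> B" if "y \<in> B" "t \<in> {0..1}" for y t
    using convexD[OF assms(1) assms(3) that(1), of "1 - t" t] that(2) by (simp add: algebra_simps)
  have "continuous_on (B \<times> cbox 0 1) (\<lambda>(y, t). t ^ k * G (p + t *\<^sub>R (y - p)))"
    unfolding split_def
    by (rule continuous_intros continuous_on_compose2[OF 0[simplified]])+ (auto intro: inB)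
  from integral_continuous_on_param[OF this] show ?case by simp
next
  case (Suc n)
  have inB: "p + t *\<^sub>R (y - p) \<in> B" if "y \<in> B" "t \<in> {0..1}" for y t
    using convexD[OF assms(1) assms(3) that(1), of "1 - t" t] that(2) by (simp add: algebra_simps)
  obtain G' where G': "\<forall>x\<in>B. (G has_derivative G' x) (at x)" "\<forall>v. Ck_on n B (\<lambda>x. G' x v)"
    using Suc.prems by auto
  have contG': "continuous_on B (\<lambda>x. G' x v)" for v
    using G'(2) Ck_on_imp_continuous_on by blast
  let ?F = "\<lambda>y t. t ^ k * G (p + t *\<^sub>R (y - p))"
  let ?F' = "\<lambda>y t v. t ^ Suc k * G' (p + t *\<^sub>R (y - p)) v"
  have D: "((\<lambda>y. ?F y t) has_derivative ?F' y t) (at y)" if "y \<in> B" "t \<in> {0..1}" for y t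
  proof -
    have lin: "linear (G' (p + t *\<^sub>R (y - p)))" using G'(1) inB[OF that] has_derivative_linear by blast
    have "((\<lambda>y. p + t *\<^sub>R (y - p)) has_derivative (\<lambda>v. t *\<^sub>R v)) (at y)"
      by (auto intro!: derivative_eq_intros)
    from has_derivative_compose[OF this, of G "G' (p + t *\<^sub>R (y - p))"]
    have "((\<lambda>y. G (p + t *\<^sub>R (y - p))) has_derivative (\<lambda>v. G' (p + t *\<^sub>R (y - p)) (t *\<^sub>R v))) (at y)"
      using G'(1) inB[OF that] by auto
    then show ?thesis
      by (auto intro!: derivative_eq_intros simp: linear_scale[OF lin])
  qed
  \<comment> \<open>\<open>leibniz_rule\<close> wants the derivative as a bounded linear function
    depending continuously on the parameter, so the functional is rebuilt from its finitely many
    values on \<open>Basis\<close>.\<close>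
  let ?B = "\<lambda>y t. \<Sum>b\<in>Basis. (t ^ Suc k * G' (p + t *\<^sub>R (y - p)) b) *\<^sub>R blinfun_inner_right b"
  have B: "blinfun_apply (?B y t) = ?F' y t" if "y \<in> B" "t \<in> {0..1}" for y t
  proof
    fix v
    have lin: "linear (G' (p + t *\<^sub>R (y - p)))" using G'(1) inB[OF that] has_derivative_linear by blast
    have "G' (p + t *\<^sub>R (y - p)) v = G' (p + t *\<^sub>R (y - p)) (\<Sum>b\<in>Basis. (v \<bullet> b) *\<^sub>R b)"
      by (simp add: euclidean_representation)
    also have "\<dots> = (\<Sum>b\<in>Basis. (v \<bullet> b) * G' (p + t *\<^sub>R (y - p)) b)"
      by (simp add: linear_sum[OF lin] linear_scale[OF lin])
    finally show "blinfun_apply (?B y t) v = ?F' y t v"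
      by (simp add: blinfun.bilinear_simps sum_distrib_left inner_commute ac_simps blinfun.sum_left)
  qed
  have contB: "continuous_on (B \<times> cbox 0 1) (\<lambda>(y, t). ?B y t)"
    unfolding split_def
    by (rule continuous_intros continuous_on_compose2[OF contG'])+ (auto intro: inB)
  have cont1: "continuous_on (cbox 0 1) (?B y)" if "y \<in> B" for y
  proof -
    have "continuous_on (cbox 0 1) (\<lambda>t. case (y, t) of (y, t) \<Rightarrow> ?B y t)"
      by (rule continuous_on_compose2[OF contB]) (use that in \<open>auto intro!: continuous_on_Pair continuous_on_const continuous_on_id\<close>)
    then show ?thesis by simp
  qed
  have contF: "continuous_on (cbox 0 1) (?F y)" if "y \<in> B" for y
    by (rule continuous_intros continuous_on_compose2[OF Ck_on_imp_continuous_on[OF Suc.prems]])+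
      (use that in \<open>auto intro: inB\<close>)
  have deriv: "((\<lambda>y. integral {0..1} (?F y)) has_derivative (\<lambda>v. integral {0..1} (\<lambda>t. ?F' y t v))) (at y)"
    if y: "y \<in> B" for y
  proof -
    have "((\<lambda>y. integral (cbox 0 1) (?F y)) has_derivative integral (cbox 0 1) (?B y)) (at y within B)"
    proof (rule leibniz_rule)
      show "((\<lambda>y. ?F y t) has_derivative blinfun_apply (?B y t)) (at y within B)"
        if "y \<in> B" "t \<in> cbox 0 1" for y t
        using D[OF that(1), of t] B[OF that(1), of t] that(2) by (auto intro: has_derivative_at_withinI)
      show "?F y integrable_on cbox 0 1" if "y \<in> B" for y
        using integrable_continuous[OF contF[OF that]] .
    qed (use contB y assms(1) in auto)
    moreover have "blinfun_apply (integral (cbox 0 1) (?B y)) v = integral {0..1} (\<lambda>t. ?F' y t v)" for v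
    proof -
      have "blinfun_apply (integral (cbox 0 1) (?B y)) v = integral (cbox 0 1) ((\<lambda>L. blinfun_apply L v) \<circ> ?B y)"
        by (rule integral_linear[OF integrable_continuous[OF cont1[OF y]] blinfun.bounded_linear_left, symmetric])
      also have "\<dots> = integral {0..1} (\<lambda>t. ?F' y t v)"
        using B[OF y] by (auto intro!: integral_cong simp: o_def)
      finally show ?thesis .
    qed
    then have "blinfun_apply (integral (cbox 0 1) (?B y)) = (\<lambda>v. integral {0..1} (\<lambda>t. ?F' y t v))"
      by (rule ext)
    ultimately show ?thesis
      using at_within_open[OF y assms(2)] by (simp only: cbox_interval)
  qed
  have "Ck_on n B (\<lambda>y. integral {0..1} (\<lambda>t. ?F' y t v))" for v
    using Suc.IH[OF G'(2)[rule_format, of v], of "Suc k"] by simp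
  with deriv show ?case by (auto intro!: exI[of _ "\<lambda>y v. integral {0..1} (\<lambda>t. ?F' y t v)"])
qed

lemma smooth_on_has_derivative:
  assumes "smooth_on S f" "x \<in> S"
  shows "(f has_derivative frechet_derivative f (at x)) (at x)"
proof -
  have "Ck_on (Suc 0) S f" using assms(1) smooth_on_def by blast
  then show ?thesis using assms(2) frechet_derivative_works differentiableI by (metis Ck_on.simps(2))
qed

lemma smooth_on_frechet_derivative:
  assumes "open S" "smooth_on S f"
  shows "smooth_on S (\<lambda>x. frechet_derivative f (at x) v)"
  unfolding smooth_on_def
proof
  fix n
  have "Ck_on (Suc n) S f" using assms(2) smooth_on_def by blast
  then obtain G where G: "\<forall>x\<in>S. (f has_derivative G x) (at x)" "\<forall>v. Ck_on n S (\<lambda>x. G x v)" by auto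
  have "G x = frechet_derivative f (at x)" if "x \<in> S" for x
    using G(1) that frechet_derivative_at by blast
  then show "Ck_on n S (\<lambda>x. frechet_derivative f (at x) v)"
    by (intro Ck_on_cong[OF assms(1) _ G(2)[rule_format, of v]]) simp
qed

text \<open>The fundamental theorem of calculus along the segment from p to y, which stays in the
  convex set B. The factors y - p are what lets a derivation at p see only first derivatives of
  F.\<close>

lemma Hadamard:
  fixes F :: "'a::euclidean_space \<Rightarrow> real"
  assumes "convex B" "open B" "p \<in> B" "smooth_on B F"
  obtains g where "\<And>b. b \<in> Basis \<Longrightarrow> smooth_on B (g b)"
    "\<And>y. y \<in> B \<Longrightarrow> F y = F p + (\<Sum>b\<in>Basis. ((y - p) \<bullet> b) * g b y)"
    "\<And>b. b \<in> Basis \<Longrightarrow> g b p = frechet_derivative F (at p) b"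
proof -
  define F' where "F' x = frechet_derivative F (at x)" for x
  have F': "(F has_derivative F' x) (at x)" if "x \<in> B" for x
    using smooth_on_has_derivative[OF assms(4) that] unfolding F'_def .
  have smF': "smooth_on B (\<lambda>x. F' x v)" for v
    using smooth_on_frechet_derivative[OF assms(2,4)] unfolding F'_def .
  \<comment> \<open>The coefficients are averages of partial derivatives over the segment; the
    factor t ^ 0 matches the weights of \<open>Ck_on_integral\<close>.\<close>
  let ?g = "\<lambda>b y. integral {0..1} (\<lambda>t. t ^ 0 * F' (p + t *\<^sub>R (y - p)) b)"
  have inB: "p + t *\<^sub>R (y - p) \<in> B" if "y \<in> B" "t \<in> {0..1}" for y t
    using convexD[OF assms(1) assms(3) that(1), of "1 - t" t] that(2) by (simp add: algebra_simps)
  show thesis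
  proof (rule that[of ?g])
    show "smooth_on B (?g b)" for b
      using smF' Ck_on_integral[OF assms(1-3)] unfolding smooth_on_def by blast
    show "?g b p = frechet_derivative F (at p) b" for b
      by (simp add: F'_def)
    show "F y = F p + (\<Sum>b\<in>Basis. ((y - p) \<bullet> b) * ?g b y)" if y: "y \<in> B" for y
    proof -
      let ?h = "\<lambda>t. F (p + t *\<^sub>R (y - p))"
      have "(?h has_vector_derivative F' (p + t *\<^sub>R (y - p)) (y - p)) (at t within {0..1})"
        if t: "t \<in> {0..1}" for t
      proof -
        have "((\<lambda>t. p + t *\<^sub>R (y - p)) has_derivative (\<lambda>s. s *\<^sub>R (y - p))) (at t)"
          by (auto intro!: derivative_eq_intros)
        from has_derivative_compose[OF this, of F "F' (p + t *\<^sub>R (y - p))"] F' inB[OF y t]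
        have "(?h has_derivative (\<lambda>s. F' (p + t *\<^sub>R (y - p)) (s *\<^sub>R (y - p)))) (at t)" by auto
        moreover have "linear (F' (p + t *\<^sub>R (y - p)))"
          using F' inB[OF y t] has_derivative_linear by blast
        ultimately show ?thesis
          by (auto simp: has_vector_derivative_def linear_scale intro: has_derivative_at_withinI)
      qed
      then have "((\<lambda>t. F' (p + t *\<^sub>R (y - p)) (y - p)) has_integral (?h 1 - ?h 0)) {0..1}"
        by (intro fundamental_theorem_of_calculus) auto
      then have "F y - F p = integral {0..1} (\<lambda>t. F' (p + t *\<^sub>R (y - p)) (y - p))"
        by (simp add: integral_unique)
      also have "\<dots> = integral {0..1} (\<lambda>t. \<Sum>b\<in>Basis. ((y - p) \<bullet> b) * F' (p + t *\<^sub>R (y - p)) b)"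
      proof (rule integral_cong)
        fix t :: real assume t: "t \<in> {0..1}"
        have lin: "linear (F' (p + t *\<^sub>R (y - p)))"
          using F' inB[OF y t] has_derivative_linear by blast
        have "F' (p + t *\<^sub>R (y - p)) (y - p) = F' (p + t *\<^sub>R (y - p)) (\<Sum>b\<in>Basis. ((y - p) \<bullet> b) *\<^sub>R b)"
          by (simp only: euclidean_representation)
        also have "\<dots> = (\<Sum>b\<in>Basis. ((y - p) \<bullet> b) * F' (p + t *\<^sub>R (y - p)) b)"
          by (simp only: linear_sum[OF lin] linear_scale[OF lin] real_scaleR_def o_def)
        finally show "F' (p + t *\<^sub>R (y - p)) (y - p) = (\<Sum>b\<in>Basis. ((y - p) \<bullet> b) * F' (p + t *\<^sub>R (y - p)) b)" .
      qed
      also have "\<dots> = (\<Sum>b\<in>Basis. integral {0..1} (\<lambda>t. ((y - p) \<bullet> b) * F' (p + t *\<^sub>R (y - p)) b))"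
      proof (rule integral_sum)
        fix b :: 'a
        have "continuous_on B (\<lambda>x. F' x b)" using smF'[of b] unfolding smooth_on_def
          by (metis Ck_on.simps(1))
        then have "continuous_on {0..1} (\<lambda>t. F' (p + t *\<^sub>R (y - p)) b)"
          by (rule continuous_on_compose2) (use inB y in \<open>auto intro!: continuous_intros\<close>)
        then show "(\<lambda>t. ((y - p) \<bullet> b) * F' (p + t *\<^sub>R (y - p)) b) integrable_on {0..1}"
          by (intro integrable_continuous_real continuous_intros)
      qed auto
      also have "\<dots> = (\<Sum>b\<in>Basis. ((y - p) \<bullet> b) * ?g b y)"
        by simp
      finally show ?thesis by simp
    qed
  qed
qed

lemma smooth_on_subset: "smooth_on S f \<Longrightarrow> T \<subseteq> S \<Longrightarrow> smooth_on T f"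
  unfolding smooth_on_def using Ck_on_subset by blast

lemma smooth_on_cong: "open S \<Longrightarrow> (\<And>x. x \<in> S \<Longrightarrow> f x = g x) \<Longrightarrow> smooth_on S f \<Longrightarrow> smooth_on S g"
  unfolding smooth_on_def using Ck_on_cong by blast

lemma smooth_on_local: "(\<And>x. x \<in> S \<Longrightarrow> \<exists>T. open T \<and> x \<in> T \<and> smooth_on T f) \<Longrightarrow> smooth_on S f"
  unfolding smooth_on_def by (intro allI Ck_on_local) blast

lemma smooth_on_compose:
  fixes g :: "'a::euclidean_space \<Rightarrow> 'b::euclidean_space"
  shows "smooth_on T f \<Longrightarrow> smooth_on S g \<Longrightarrow> g ` S \<subseteq> T \<Longrightarrow> smooth_on S (\<lambda>x. f (g x))"
  unfolding smooth_on_def using Ck_on_compose by blast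

lemma smooth_on_powr: "smooth_on {0<..} (\<lambda>x::real. x powr r)"
  unfolding smooth_on_def using Ck_on_powr by blast


section \<open>Smooth functions and tangent vectors\<close>

lemma smooth_fun_on_iff:
  "smooth_fun_on \<A> S f \<longleftrightarrow> (\<forall>U x n. (U, x) \<in> \<A> \<longrightarrow> Ck_on n (x ` (U \<inter> S)) (\<lambda>y. f (inv_into U x y)))"
  unfolding smooth_fun_on_def smooth_on_def by (auto simp: o_def)

lemma smooth_fun_on_subset:
  assumes "smooth_fun_on \<A> S f" "T \<subseteq> S"
  shows "smooth_fun_on \<A> T f"
  unfolding smooth_fun_on_iff
proof (intro allI impI)
  fix U x n assume "(U, x) \<in> \<A>"
  then have "Ck_on n (x ` (U \<inter> S)) (\<lambda>y. f (inv_into U x y))"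
    using assms(1) unfolding smooth_fun_on_iff by simp
  then show "Ck_on n (x ` (U \<inter> T)) (\<lambda>y. f (inv_into U x y))"
    by (rule Ck_on_subset) (rule image_mono[OF Int_mono[OF subset_refl assms(2)]])
qed

lemma smooth_fun_on_const: "smooth_fun_on \<A> S (\<lambda>q. c)"
  unfolding smooth_fun_on_def smooth_on_def by (auto simp: o_def Ck_on_const)

lemma smooth_fun_on_add:
  "smooth_fun_on \<A> S f \<Longrightarrow> smooth_fun_on \<A> S h \<Longrightarrow> smooth_fun_on \<A> S (\<lambda>q. f q + h q)"
  by (simp add: smooth_fun_on_iff Ck_on_add)

lemma smooth_fun_on_bounded_linear:
  "bounded_linear L \<Longrightarrow> smooth_fun_on \<A> S f \<Longrightarrow> smooth_fun_on \<A> S (\<lambda>q. L (f q))"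
  by (simp add: smooth_fun_on_iff Ck_on_bounded_linear[of L])

lemma smooth_fun_on_mult:
  fixes f h :: "'a \<Rightarrow> real"
  shows "smooth_fun_on \<A> S f \<Longrightarrow> smooth_fun_on \<A> S h \<Longrightarrow> smooth_fun_on \<A> S (\<lambda>q. f q * h q)"
  by (simp add: smooth_fun_on_iff Ck_on_bilinear[OF bounded_bilinear_mult])

lemma smooth_fun_on_cmult:
  fixes f :: "'a \<Rightarrow> real"
  shows "smooth_fun_on \<A> S f \<Longrightarrow> smooth_fun_on \<A> S (\<lambda>q. c * f q)"
  by (intro smooth_fun_on_mult smooth_fun_on_const)

lemma smooth_nearI: "open S \<Longrightarrow> p \<in> S \<Longrightarrow> smooth_fun_on \<A> S f \<Longrightarrow> smooth_near \<A> p f"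
  unfolding smooth_near_def by blast

lemma smooth_near_common:
  assumes "smooth_near \<A> p f" "smooth_near \<A> p h"
  obtains S where "open S" "p \<in> S" "smooth_fun_on \<A> S f" "smooth_fun_on \<A> S h"
proof -
  obtain S T where "open S" "p \<in> S" "smooth_fun_on \<A> S f" "open T" "p \<in> T" "smooth_fun_on \<A> T h"
    using assms unfolding smooth_near_def by blast
  then show thesis
    using that[of "S \<inter> T"] smooth_fun_on_subset[of \<A> S f "S \<inter> T"] smooth_fun_on_subset[of \<A> T h "S \<inter> T"] by auto
qed

lemma smooth_near_const: "smooth_near \<A> p (\<lambda>q. c)"
  unfolding smooth_near_def using smooth_fun_on_const open_UNIV UNIV_I by blast

lemma smooth_near_add: "smooth_near \<A> p f \<Longrightarrow> smooth_near \<A> p h \<Longrightarrow> smooth_near \<A> p (\<lambda>q. f q + h q)"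
  by (erule (1) smooth_near_common) (blast intro: smooth_nearI smooth_fun_on_add)

lemma smooth_near_mult:
  fixes f h :: "'a::topological_space \<Rightarrow> real"
  shows "smooth_near \<A> p f \<Longrightarrow> smooth_near \<A> p h \<Longrightarrow> smooth_near \<A> p (\<lambda>q. f q * h q)"
  by (erule (1) smooth_near_common) (blast intro: smooth_nearI smooth_fun_on_mult)

lemma smooth_near_sum:
  "(\<And>i. i \<in> I \<Longrightarrow> smooth_near \<A> p (f i)) \<Longrightarrow> smooth_near \<A> p (\<lambda>q. \<Sum>i\<in>I. f i q)"
  by (induction I rule: infinite_finite_induct) (auto intro: smooth_near_const smooth_near_add)

context
  fixes \<A> :: "('a::topological_space, 'e::euclidean_space) atlas" and p v
  assumes v: "v \<in> tangent_space \<A> p"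
begin

lemma tangent_vector_nonsmooth: "\<not> smooth_near \<A> p f \<Longrightarrow> v f = 0"
  using v unfolding tangent_space_def by auto

lemma tangent_vector_add:
  "smooth_near \<A> p f \<Longrightarrow> smooth_near \<A> p h \<Longrightarrow> v (\<lambda>q. f q + h q) = v f + v h"
  using v unfolding tangent_space_def by auto

lemma tangent_vector_cmult: "smooth_near \<A> p f \<Longrightarrow> v (\<lambda>q. c * f q) = c * v f"
  using v unfolding tangent_space_def by auto

lemma tangent_vector_mult:
  "smooth_near \<A> p f \<Longrightarrow> smooth_near \<A> p h \<Longrightarrow> v (\<lambda>q. f q * h q) = v f * h p + f p * v h"
  using v unfolding tangent_space_def by auto

lemma tangent_vector_const: "v (\<lambda>q. c) = 0"
proof -
  have "v (\<lambda>q. 1 * 1) = v (\<lambda>q. 1) * 1 + 1 * v (\<lambda>q. 1)"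
    by (rule tangent_vector_mult) (rule smooth_near_const)+
  then have "v (\<lambda>q. 1) = 0" by simp
  then show ?thesis using tangent_vector_cmult[OF smooth_near_const, of c 1] by simp
qed

lemma tangent_vector_sum:
  "(\<And>i. i \<in> I \<Longrightarrow> smooth_near \<A> p (f i)) \<Longrightarrow> v (\<lambda>q. \<Sum>i\<in>I. f i q) = (\<Sum>i\<in>I. v (f i))"
  by (induction I rule: infinite_finite_induct)
    (auto simp: tangent_vector_const tangent_vector_add smooth_near_sum)

end

lemma sum_scaleR_apply:
  fixes X :: "'i \<Rightarrow> 'a \<Rightarrow> real"
  shows "(\<Sum>i\<in>I. c i *\<^sub>R X i) f = (\<Sum>i\<in>I. c i * X i f)"
  by (induction I rule: infinite_finite_induct) (simp_all add: scaleR_fun_def)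

lemma subspace_tangent_space: "subspace (tangent_space \<A> p)"
  unfolding subspace_def
  by (auto simp: tangent_space_def scaleR_fun_def algebra_simps)

section \<open>Charts of a smooth manifold and locality of tangent vectors\<close>

locale smooth_manifold =
  fixes \<A> :: "('a::{t2_space, second_countable_topology}, 'e::euclidean_space) atlas"
  assumes atlas: "smooth_atlas \<A>"
begin

lemma chart_exists: obtains U x where "(U, x) \<in> \<A>" "p \<in> U"
proof -
  have "p \<in> (\<Union>(U, x)\<in>\<A>. U)" using atlas unfolding smooth_atlas_def by simp
  then show thesis using that by auto
qed

context
  fixes U x assumes chart: "(U, x) \<in> \<A>"
begin

lemma open_chart_domain: "open U"
  using atlas chart unfolding smooth_atlas_def by fast

lemma chart_homeomorphism: "homeomorphism U (x ` U) x (inv_into U x)"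
  using atlas chart unfolding smooth_atlas_def by blast

lemma chart_inv [simp]: "q \<in> U \<Longrightarrow> inv_into U x (x q) = q"
  using chart_homeomorphism unfolding homeomorphism_def by blast

lemma chart_image_open: "open S \<Longrightarrow> open (x ` (U \<inter> S))"
proof -
  assume S: "open S"
  have o: "open (x ` U)" using atlas chart unfolding smooth_atlas_def by blast
  have "openin (top_of_set U) (U \<inter> S)" using S by (simp add: openin_open_Int)
  then have "openin (top_of_set (x ` U)) (x ` (U \<inter> S))"
    using homeomorphism_imp_open_map[OF chart_homeomorphism] by blast
  then show ?thesis using o openin_open_eq by blast
qed

lemma chart_continuous: "continuous_on U x"
  using chart_homeomorphism unfolding homeomorphism_def by blast

lemma chart_vimage_open: "open B \<Longrightarrow> open (U \<inter> x -` B)"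
  using chart_continuous open_chart_domain by (metis Int_commute continuous_on_open_vimage)

end

lemma smooth_fun_on_cong:
  assumes "open S" "\<And>q. q \<in> S \<Longrightarrow> f q = h q" "smooth_fun_on \<A> S f"
  shows "smooth_fun_on \<A> S h"
  unfolding smooth_fun_on_def
proof clarify
  fix U x assume c: "(U, x) \<in> \<A>"
  then have "smooth_on (x ` (U \<inter> S)) (f \<circ> inv_into U x)" using assms(3) unfolding smooth_fun_on_def by blast
  then show "smooth_on (x ` (U \<inter> S)) (h \<circ> inv_into U x)"
    by (rule smooth_on_cong[OF chart_image_open[OF c assms(1)], rotated]) (use c assms in auto)
qed

lemma smooth_fun_on_local:
  assumes "\<And>q. q \<in> S \<Longrightarrow> \<exists>T. open T \<and> q \<in> T \<and> smooth_fun_on \<A> T f"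
  shows "smooth_fun_on \<A> S f"
  unfolding smooth_fun_on_def
proof clarify
  fix U x assume c: "(U, x) \<in> \<A>"
  show "smooth_on (x ` (U \<inter> S)) (f \<circ> inv_into U x)"
  proof (rule smooth_on_local, clarify)
    fix q assume q: "q \<in> U" "q \<in> S"
    then obtain T where T: "open T" "q \<in> T" "smooth_fun_on \<A> T f" using assms by blast
    then have "smooth_on (x ` (U \<inter> T)) (f \<circ> inv_into U x)" using c unfolding smooth_fun_on_def by blast
    then show "\<exists>T. open T \<and> x q \<in> T \<and> smooth_on T (f \<circ> inv_into U x)"
      using chart_image_open[OF c T(1)] q T by blast
  qed
qed

lemma smooth_fun_on_compose:
  fixes f :: "'a \<Rightarrow> 'b::euclidean_space"
  assumes "smooth_on T h" "smooth_fun_on \<A> S f" "f ` S \<subseteq> T"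
  shows "smooth_fun_on \<A> S (\<lambda>q. h (f q))"
  unfolding smooth_fun_on_def
proof clarify
  fix U x assume c: "(U, x) \<in> \<A>"
  then have "smooth_on (x ` (U \<inter> S)) (f \<circ> inv_into U x)" using assms(2) unfolding smooth_fun_on_def by blast
  moreover have "(f \<circ> inv_into U x) ` x ` (U \<inter> S) \<subseteq> T" using assms(3) c by auto
  ultimately show "smooth_on (x ` (U \<inter> S)) ((\<lambda>q. h (f q)) \<circ> inv_into U x)"
    using smooth_on_compose[OF assms(1)] unfolding o_def by fastforce
qed

lemma smooth_fun_on_chart: "(U, x) \<in> \<A> \<Longrightarrow> smooth_fun_on \<A> U x"
  using atlas unfolding smooth_fun_on_def smooth_atlas_def by (auto simp: Int_commute)

text \<open>Smoothness in one chart suffices: f is a smooth Euclidean map after x, and x is smooth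
  in every other chart because transition maps are.\<close>

lemma smooth_fun_on_chartI:
  assumes c: "(U, x) \<in> \<A>" and S: "open S" "S \<subseteq> U" and f: "smooth_on (x ` S) (f \<circ> inv_into U x)"
  shows "smooth_fun_on \<A> S f"
proof (rule smooth_fun_on_cong[OF S(1)])
  show "smooth_fun_on \<A> S (\<lambda>q. (f \<circ> inv_into U x) (x q))"
    by (rule smooth_fun_on_compose[OF f smooth_fun_on_subset[OF smooth_fun_on_chart[OF c] S(2)]]) simp
qed (use c S in auto)

lemma smooth_fun_on_continuous:
  assumes "smooth_fun_on \<A> S f" "open S"
  shows "continuous_on S f"
proof (rule continuous_at_imp_continuous_on, intro ballI)
  fix q assume q: "q \<in> S"
  obtain U x where c: "(U, x) \<in> \<A>" "q \<in> U" by (rule chart_exists)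
  have "smooth_on (x ` (U \<inter> S)) (f \<circ> inv_into U x)" using c assms(1) unfolding smooth_fun_on_def by blast
  then have "continuous_on (x ` (U \<inter> S)) (f \<circ> inv_into U x)"
    unfolding smooth_on_def using Ck_on_imp_continuous_on by blast
  then have "continuous_on (U \<inter> S) (\<lambda>q. (f \<circ> inv_into U x) (x q))"
    by (rule continuous_on_compose2) (use continuous_on_subset[OF chart_continuous[OF c(1)]] in auto)
  then have "continuous_on (U \<inter> S) f" by (rule continuous_on_eq) (use c in auto)
  then show "isCont f q"
    using q c(2) open_Int[OF open_chart_domain[OF c(1)] assms(2)] continuous_on_eq_continuous_at by blast
qed

lemma smooth_near_cong:
  assumes "open T" "p \<in> T" "\<And>q. q \<in> T \<Longrightarrow> f q = h q" "smooth_near \<A> p f"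
  shows "smooth_near \<A> p h"
proof -
  obtain S where S: "open S" "p \<in> S" "smooth_fun_on \<A> S f" using assms(4) unfolding smooth_near_def by blast
  have "smooth_fun_on \<A> (S \<inter> T) h"
    by (rule smooth_fun_on_cong[OF _ _ smooth_fun_on_subset[OF S(3), of "S \<inter> T"]]) (use S assms in auto)
  then show ?thesis using S assms by (intro smooth_nearI[of "S \<inter> T"]) auto
qed

text \<open>The indicator \<open>i\<close> of T is idempotent with value 1 at p, so the Leibniz rule
  gives v i = 2 v i and hence v i = 0. Multiplying by \<open>i\<close> therefore changes neither v f
  nor v h, and it makes the two total functions equal.\<close>

lemma tangent_vector_cong:
  assumes v: "v \<in> tangent_space \<A> p" and T: "open T" "p \<in> T" "\<And>q. q \<in> T \<Longrightarrow> f q = h q"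
  shows "v f = v h"
proof (cases "smooth_near \<A> p f")
  case True
  have h: "smooth_near \<A> p h" by (rule smooth_near_cong[OF T True])
  define i :: "'a \<Rightarrow> real" where "i q = (if q \<in> T then 1 else 0)" for q
  have i: "smooth_near \<A> p i"
    by (rule smooth_near_cong[OF T(1,2) _ smooth_near_const[of _ _ 1]]) (simp add: i_def)
  have "(\<lambda>q. i q * i q) = i" by (auto simp: i_def)
  then have vi: "v i = 0" using tangent_vector_mult[OF v i i] T(2) by (simp add: i_def)
  have "v (\<lambda>q. f q * i q) = v f" using tangent_vector_mult[OF v True i] vi T(2) by (simp add: i_def)
  moreover have "v (\<lambda>q. h q * i q) = v h" using tangent_vector_mult[OF v h i] vi T(2) by (simp add: i_def)
  moreover have "(\<lambda>q. f q * i q) = (\<lambda>q. h q * i q)" using T(3) by (auto simp: i_def)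
  ultimately show ?thesis by simp
next
  case False
  moreover have "\<not> smooth_near \<A> p h"
    by (rule contrapos_nn[OF False]) (rule smooth_near_cong[OF T(1,2) T(3)[symmetric]])
  ultimately show ?thesis using tangent_vector_nonsmooth[OF v] by simp
qed

section \<open>Coordinate vector fields and the expansion of tangent vectors\<close>

definition coord_vector :: "'a set \<Rightarrow> ('a \<Rightarrow> 'e) \<Rightarrow> 'e \<Rightarrow> 'a \<Rightarrow> 'a tvec" where
  "coord_vector U x w p f =
     (if smooth_near \<A> p f then frechet_derivative (f \<circ> inv_into U x) (at (x p)) w else 0)"

context
  fixes U x assumes c: "(U, x) \<in> \<A>"
begin

lemma smooth_near_has_derivative:
  assumes "smooth_near \<A> p f" "p \<in> U"
  shows "(f \<circ> inv_into U x has_derivative frechet_derivative (f \<circ> inv_into U x) (at (x p))) (at (x p))"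
proof -
  obtain S where S: "open S" "p \<in> S" "smooth_fun_on \<A> S f" using assms(1) unfolding smooth_near_def by blast
  then have "smooth_on (x ` (U \<inter> S)) (f \<circ> inv_into U x)" using c unfolding smooth_fun_on_def by blast
  then show ?thesis using smooth_on_has_derivative S(2) assms(2) by blast
qed

lemma coord_vector_tangent: assumes p: "p \<in> U" shows "coord_vector U x w p \<in> tangent_space \<A> p"
proof -
  let ?D = "\<lambda>f. frechet_derivative (f \<circ> inv_into U x) (at (x p))"
  have "?D (\<lambda>q. f q + h q) w = ?D f w + ?D h w" if "smooth_near \<A> p f" "smooth_near \<A> p h" for f h :: "'a \<Rightarrow> real"
    using has_derivative_add[OF smooth_near_has_derivative[OF that(1) p] smooth_near_has_derivative[OF that(2) p]]
    by (subst frechet_derivative_at[symmetric, of _ "\<lambda>w. ?D f w + ?D h w"]) (auto simp: o_def)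
  moreover have "?D (\<lambda>q. k * f q) w = k * ?D f w" if "smooth_near \<A> p f" for f and k :: real
    using has_derivative_mult_right[OF smooth_near_has_derivative[OF that(1) p], of k]
    by (subst frechet_derivative_at[symmetric, of _ "\<lambda>w. k * ?D f w"]) (auto simp: o_def)
  moreover have "?D (\<lambda>q. f q * h q) w = ?D f w * h p + f p * ?D h w"
    if "smooth_near \<A> p f" "smooth_near \<A> p h" for f h :: "'a \<Rightarrow> real"
    using has_derivative_mult[OF smooth_near_has_derivative[OF that(1) p] smooth_near_has_derivative[OF that(2) p]]
    by (subst frechet_derivative_at[symmetric, of _ "\<lambda>w. f p * ?D h w + ?D f w * h p"]) (use p c in \<open>auto simp: o_def\<close>)
  ultimately show ?thesis
    unfolding tangent_space_def coord_vector_def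
    by (simp add: smooth_near_add smooth_near_mult smooth_near_const)
qed

lemma coord_vector_field: "vector_field_on \<A> U (coord_vector U x w)"
  unfolding vector_field_on_def section_on_def
proof (intro conjI ballI allI impI)
  fix W and f :: "'a \<Rightarrow> real" assume W: "open W" "smooth_fun_on \<A> W f"
  have UW: "open (U \<inter> W)" using W(1) open_chart_domain[OF c] by blast
  have "smooth_on (x ` (U \<inter> W)) (f \<circ> inv_into U x)" using W c unfolding smooth_fun_on_def by blast
  then have "smooth_on (x ` (U \<inter> W)) (\<lambda>y. frechet_derivative (f \<circ> inv_into U x) (at y) w)"
    by (rule smooth_on_frechet_derivative[OF chart_image_open[OF c W(1)]])
  then have "smooth_on (x ` (U \<inter> W)) ((\<lambda>p. coord_vector U x w p f) \<circ> inv_into U x)"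
    by (rule smooth_on_cong[OF chart_image_open[OF c W(1)], rotated])
      (use c W in \<open>auto simp: coord_vector_def intro: smooth_nearI\<close>)
  then show "smooth_fun_on \<A> (U \<inter> (\<lambda>p. p) -` W) (\<lambda>p. coord_vector U x w p f)"
    using smooth_fun_on_chartI[OF c UW] by (simp add: vimage_def)
qed (rule coord_vector_tangent)

lemma smooth_fun_on_coord: "smooth_fun_on \<A> U (\<lambda>q. x q \<bullet> b)"
  by (rule smooth_fun_on_bounded_linear[OF bounded_linear_inner_left smooth_fun_on_chart[OF c]])

text \<open>Hadamard in the chart writes f near p as f p plus products of x_b - x_b(p) with smooth
  functions. A derivation kills the constant, and in each product only the term with the first
  factor differentiated survives, since that factor vanishes at p.\<close>

lemma tangent_vector_expansion:
  assumes p: "p \<in> U" and v: "v \<in> tangent_space \<A> p"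
  shows "v = (\<Sum>b\<in>Basis. v (\<lambda>q. x q \<bullet> b) *\<^sub>R coord_vector U x b p)"
proof
  fix f
  have eval: "(\<Sum>b\<in>Basis. v (\<lambda>q. x q \<bullet> b) *\<^sub>R coord_vector U x b p) f
    = (\<Sum>b\<in>Basis. v (\<lambda>q. x q \<bullet> b) * coord_vector U x b p f)"
    by (rule sum_scaleR_apply)
  show "v f = (\<Sum>b\<in>Basis. v (\<lambda>q. x q \<bullet> b) *\<^sub>R coord_vector U x b p) f"
  proof (cases "smooth_near \<A> p f")
    case False
    then show ?thesis unfolding eval by (simp add: coord_vector_def tangent_vector_nonsmooth[OF v])
  next
    case True
    then obtain S where S: "open S" "p \<in> S" "smooth_fun_on \<A> S f" unfolding smooth_near_def by blast
    let ?F = "f \<circ> inv_into U x"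
    obtain r where r: "r > 0" "ball (x p) r \<subseteq> x ` (U \<inter> S)"
      by (rule openE[OF chart_image_open[OF c S(1)] imageI[OF IntI[OF p S(2)]]])
    let ?B = "ball (x p) r"
    have "smooth_on ?B ?F" using S(3) c r(2) smooth_on_subset unfolding smooth_fun_on_def by blast
    then obtain g where g: "\<And>b. b \<in> Basis \<Longrightarrow> smooth_on ?B (g b)"
      "\<And>y. y \<in> ?B \<Longrightarrow> ?F y = ?F (x p) + (\<Sum>b\<in>Basis. ((y - x p) \<bullet> b) * g b y)"
      "\<And>b. b \<in> Basis \<Longrightarrow> g b (x p) = frechet_derivative ?F (at (x p)) b"
      using Hadamard[of ?B "x p" ?F] r(1) by auto
    define T where "T = U \<inter> x -` ?B"
    have T: "open T" "p \<in> T" "T \<subseteq> U" using chart_vimage_open[OF c] p r(1) unfolding T_def by auto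
    have gx: "smooth_near \<A> p (\<lambda>q. g b (x q))" if "b \<in> Basis" for b
      by (rule smooth_nearI[OF T(1,2) smooth_fun_on_compose[OF g(1)[OF that]
              smooth_fun_on_subset[OF smooth_fun_on_chart[OF c] T(3)]]]) (auto simp: T_def)
    have xb: "smooth_near \<A> p (\<lambda>q. x q \<bullet> b)" for b
      by (rule smooth_nearI[OF open_chart_domain[OF c] p smooth_fun_on_coord])
    have xb': "smooth_near \<A> p (\<lambda>q. x q \<bullet> b + - (x p \<bullet> b))" for b
      by (rule smooth_near_add[OF xb smooth_near_const])
    have sm: "smooth_near \<A> p (\<lambda>q. (x q \<bullet> b + - (x p \<bullet> b)) * g b (x q))" if "b \<in> Basis" for b
      by (rule smooth_near_mult[OF xb' gx[OF that]])
    have "v f = v (\<lambda>q. f p + (\<Sum>b\<in>Basis. (x q \<bullet> b + - (x p \<bullet> b)) * g b (x q)))"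
    proof (rule tangent_vector_cong[OF v T(1,2)])
      fix q assume "q \<in> T"
      then show "f q = f p + (\<Sum>b\<in>Basis. (x q \<bullet> b + - (x p \<bullet> b)) * g b (x q))"
        using g(2)[of "x q"] c p by (simp add: T_def inner_diff_left)
    qed
    also have "\<dots> = (\<Sum>b\<in>Basis. v (\<lambda>q. (x q \<bullet> b + - (x p \<bullet> b)) * g b (x q)))"
      by (simp only: tangent_vector_add[OF v smooth_near_const smooth_near_sum[OF sm]]
          tangent_vector_const[OF v] add_0 tangent_vector_sum[OF v sm])
    also have "\<dots> = (\<Sum>b\<in>Basis. v (\<lambda>q. x q \<bullet> b) * g b (x p))"
    proof (rule sum.cong)
      fix b :: 'e assume b: "b \<in> Basis"
      show "v (\<lambda>q. (x q \<bullet> b + - (x p \<bullet> b)) * g b (x q)) = v (\<lambda>q. x q \<bullet> b) * g b (x p)"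
        by (simp only: tangent_vector_mult[OF v xb' gx[OF b]] tangent_vector_add[OF v xb smooth_near_const]
            tangent_vector_const[OF v]) simp
    qed simp
    also have "\<dots> = (\<Sum>b\<in>Basis. v (\<lambda>q. x q \<bullet> b) * coord_vector U x b p f)"
      by (rule sum.cong) (auto simp: g(3) coord_vector_def True)
    finally show ?thesis unfolding eval .
  qed
qed

end

end

section \<open>Sections along a map\<close>

lemma section_on_tangent: "section_on \<A> \<B> \<psi> S X \<Longrightarrow> p \<in> S \<Longrightarrow> X p \<in> tangent_space \<B> (\<psi> p)"
  unfolding section_on_def by blast

lemma section_on_smooth:
  "section_on \<A> \<B> \<psi> S X \<Longrightarrow> open W \<Longrightarrow> smooth_fun_on \<B> W f \<Longrightarrow> smooth_fun_on \<A> (S \<inter> \<psi> -` W) (\<lambda>p. X p f)"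
  unfolding section_on_def by blast

lemma section_on_subset: "section_on \<A> \<B> \<psi> S X \<Longrightarrow> T \<subseteq> S \<Longrightarrow> section_on \<A> \<B> \<psi> T X"
  unfolding section_on_def by (meson Int_mono smooth_fun_on_subset subset_iff subset_refl)

lemma section_on_add:
  "section_on \<A> \<B> \<psi> S X \<Longrightarrow> section_on \<A> \<B> \<psi> S Y \<Longrightarrow> section_on \<A> \<B> \<psi> S (\<lambda>p. X p + Y p)"
  unfolding section_on_def
  by (auto intro: subspace_add[OF subspace_tangent_space] smooth_fun_on_add)

lemma section_on_scale:
  "smooth_fun_on \<A> S h \<Longrightarrow> section_on \<A> \<B> \<psi> S X \<Longrightarrow> section_on \<A> \<B> \<psi> S (\<lambda>p. h p *\<^sub>R X p)"
  unfolding section_on_def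
  by (auto simp: scaleR_fun_def intro!: subspace_scale[OF subspace_tangent_space, unfolded scaleR_fun_def real_scaleR_def]
      smooth_fun_on_mult elim: smooth_fun_on_subset)

lemma section_on_cscale: "section_on \<A> \<B> \<psi> S X \<Longrightarrow> section_on \<A> \<B> \<psi> S (\<lambda>p. c *\<^sub>R X p)"
  by (rule section_on_scale[OF smooth_fun_on_const])

lemma section_on_minus: "section_on \<A> \<B> \<psi> S X \<Longrightarrow> section_on \<A> \<B> \<psi> S (\<lambda>p. - X p)"
  using section_on_cscale[of \<A> \<B> \<psi> S X "-1"] by simp

lemma section_on_diff:
  "section_on \<A> \<B> \<psi> S X \<Longrightarrow> section_on \<A> \<B> \<psi> S Y \<Longrightarrow> section_on \<A> \<B> \<psi> S (\<lambda>p. X p - Y p)"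
  using section_on_add[OF _ section_on_minus, of \<A> \<B> \<psi> S X Y] by simp

lemma section_on_zero: "section_on \<A> \<B> \<psi> S (\<lambda>p. 0)"
  unfolding section_on_def
  by (auto simp: zero_fun_def intro: subspace_0[OF subspace_tangent_space, unfolded zero_fun_def] smooth_fun_on_const)

lemma section_on_sum:
  "(\<And>i. i \<in> I \<Longrightarrow> section_on \<A> \<B> \<psi> S (X i)) \<Longrightarrow> section_on \<A> \<B> \<psi> S (\<lambda>p. \<Sum>i\<in>I. X i p)"
  by (induction I rule: infinite_finite_induct) (auto intro: section_on_zero section_on_add)

lemma vector_field_on_add:
  "vector_field_on \<A> S X \<Longrightarrow> vector_field_on \<A> S Y \<Longrightarrow> vector_field_on \<A> S (\<lambda>p. X p + Y p)"
  unfolding vector_field_on_def by (rule section_on_add)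

lemma vector_field_on_diff:
  "vector_field_on \<A> S X \<Longrightarrow> vector_field_on \<A> S Y \<Longrightarrow> vector_field_on \<A> S (\<lambda>p. X p - Y p)"
  unfolding vector_field_on_def by (rule section_on_diff)

lemma vector_field_on_scale:
  "smooth_fun_on \<A> S h \<Longrightarrow> vector_field_on \<A> S X \<Longrightarrow> vector_field_on \<A> S (\<lambda>p. h p *\<^sub>R X p)"
  unfolding vector_field_on_def by (rule section_on_scale)

lemma vector_field_on_cscale:
  "vector_field_on \<A> S X \<Longrightarrow> vector_field_on \<A> S (\<lambda>p. c *\<^sub>R X p)"
  unfolding vector_field_on_def by (rule section_on_cscale)

lemma vector_field_on_sum:
  "(\<And>i. i \<in> I \<Longrightarrow> vector_field_on \<A> S (X i)) \<Longrightarrow> vector_field_on \<A> S (\<lambda>p. \<Sum>i\<in>I. X i p)"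
  unfolding vector_field_on_def by (rule section_on_sum)

lemma vector_field_on_subset:
  "vector_field_on \<A> S X \<Longrightarrow> T \<subseteq> S \<Longrightarrow> vector_field_on \<A> T X"
  unfolding vector_field_on_def by (rule section_on_subset)

lemma vector_field_on_tangent:
  "vector_field_on \<A> S X \<Longrightarrow> p \<in> S \<Longrightarrow> X p \<in> tangent_space \<A> p"
  unfolding vector_field_on_def by (rule section_on_tangent)

lemma vector_field_on_smooth:
  "vector_field_on \<A> S X \<Longrightarrow> open W \<Longrightarrow> smooth_fun_on \<A> W f \<Longrightarrow> smooth_fun_on \<A> (S \<inter> W) (\<lambda>p. X p f)"
  using section_on_smooth[of \<A> \<A> "\<lambda>p. p" S X W f] by (simp add: vector_field_on_def vimage_def)

text \<open>Constant coefficients against the coordinate fields. The extension lives on a chart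
  domain only, so later arguments carry domains and intersect them.\<close>

lemma (in smooth_manifold) tangent_vector_extension:
  assumes v: "v \<in> tangent_space \<A> p"
  obtains S X where "open S" "p \<in> S" "vector_field_on \<A> S X" "X p = v"
proof -
  obtain U x where c: "(U, x) \<in> \<A>" "p \<in> U" by (rule chart_exists)
  show thesis
  proof (rule that[of U "\<lambda>q. \<Sum>b\<in>Basis. v (\<lambda>q. x q \<bullet> b) *\<^sub>R coord_vector U x b q"])
    show "vector_field_on \<A> U (\<lambda>q. \<Sum>b\<in>Basis. v (\<lambda>q. x q \<bullet> b) *\<^sub>R coord_vector U x b q)"
      by (intro vector_field_on_sum vector_field_on_cscale coord_vector_field[OF c(1)])
    show "(\<Sum>b\<in>Basis. v (\<lambda>q. x q \<bullet> b) *\<^sub>R coord_vector U x b p) = v"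
      using tangent_vector_expansion[OF c v] by simp
  qed (use c open_chart_domain in auto)
qed

text \<open>Tangent vectors sit inside a large space of functionals; this injection moves dimension
  counts to the Euclidean model space.\<close>

lemma (in smooth_manifold) coordinate_embedding:
  obtains \<kappa> :: "'a tvec \<Rightarrow> 'e" where "linear \<kappa>" "inj_on \<kappa> (tangent_space \<A> p)"
proof -
  obtain U x where c: "(U, x) \<in> \<A>" "p \<in> U" by (rule chart_exists)
  let ?k = "\<lambda>v. \<Sum>b\<in>Basis. v (\<lambda>q. x q \<bullet> b) *\<^sub>R b"
  show thesis
  proof (rule that[of ?k])
    show "linear ?k"
      by (auto intro!: linearI simp: scaleR_fun_def scaleR_add_left sum.distrib scaleR_sum_right)
    show "inj_on ?k (tangent_space \<A> p)"
    proof (rule inj_onI)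
      fix v w assume vw: "v \<in> tangent_space \<A> p" "w \<in> tangent_space \<A> p" "?k v = ?k w"
      have "v (\<lambda>q. x q \<bullet> b) = w (\<lambda>q. x q \<bullet> b)" if "b \<in> Basis" for b
        using arg_cong[OF vw(3), of "\<lambda>u. u \<bullet> b"] that
        by (simp add: inner_sum_left inner_Basis if_distrib cong: if_cong)
      then show "v = w"
        using tangent_vector_expansion[OF c vw(1)] tangent_vector_expansion[OF c vw(2)] by simp
    qed
  qed
qed

locale smooth_mapping = A: smooth_manifold \<A> + B: smooth_manifold \<B>
  for \<A> :: "('a::{t2_space, second_countable_topology}, 'd::euclidean_space) atlas"
    and \<B> :: "('b::{t2_space, second_countable_topology}, 'e::euclidean_space) atlas" +
  fixes \<psi> :: "'a \<Rightarrow> 'b"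
  assumes smooth: "smooth_map \<A> \<B> \<psi>"
begin

abbreviation "T\<^sub>A \<equiv> tangent_space \<A>"
abbreviation "T\<^sub>B p \<equiv> tangent_space \<B> (\<psi> p)"
abbreviation "sect \<equiv> section_on \<A> \<B> \<psi>"
abbreviation "d\<psi> \<equiv> differential \<A> \<B> \<psi>"

lemma vimage_open: "open W \<Longrightarrow> open (\<psi> -` W)"
  using smooth unfolding smooth_map_def by (simp add: open_vimage)

lemma smooth_fun_on_pullback:
  assumes W: "open W" and h: "smooth_fun_on \<B> W h"
  shows "smooth_fun_on \<A> (\<psi> -` W) (\<lambda>q. h (\<psi> q))"
proof (rule A.smooth_fun_on_local)
  fix q assume q: "q \<in> \<psi> -` W"
  obtain U y where c: "(U, y) \<in> \<B>" "\<psi> q \<in> U" by (rule B.chart_exists)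
  let ?T = "\<psi> -` (U \<inter> W)"
  have T: "open ?T" using vimage_open W B.open_chart_domain[OF c(1)] by blast
  have y: "smooth_fun_on \<A> ?T (\<lambda>q. y (\<psi> q))"
    using smooth c(1) unfolding smooth_map_def o_def by (fast intro: smooth_fun_on_subset)
  have "smooth_on (y ` (U \<inter> W)) (h \<circ> inv_into U y)" using h c(1) unfolding smooth_fun_on_def by blast
  from A.smooth_fun_on_compose[OF this y]
  have "smooth_fun_on \<A> ?T (\<lambda>q. (h \<circ> inv_into U y) (y (\<psi> q)))" by blast
  then have "smooth_fun_on \<A> ?T (\<lambda>q. h (\<psi> q))"
    by (rule A.smooth_fun_on_cong[OF T, rotated]) (use c in auto)
  then show "\<exists>T. open T \<and> q \<in> T \<and> smooth_fun_on \<A> T (\<lambda>q. h (\<psi> q))" using T q c(2) by blast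
qed

lemma smooth_near_pullback: "smooth_near \<B> (\<psi> p) h \<Longrightarrow> smooth_near \<A> p (\<lambda>q. h (\<psi> q))"
  unfolding smooth_near_def using smooth_fun_on_pullback vimage_open by (metis vimageI2)

lemma differential_apply: "smooth_near \<B> (\<psi> p) f \<Longrightarrow> d\<psi> p v f = v (\<lambda>q. f (\<psi> q))"
  by (simp add: differential_def o_def)

lemma differential_tangent: assumes v: "v \<in> T\<^sub>A p" shows "d\<psi> p v \<in> T\<^sub>B p"
  unfolding tangent_space_def
  by (auto simp: differential_def o_def smooth_near_add smooth_near_mult smooth_near_const smooth_near_pullback
      tangent_vector_add[OF v] tangent_vector_mult[OF v] tangent_vector_cmult[OF v] tangent_vector_const[OF v])

lemma differential_add: "d\<psi> p (v + w) = d\<psi> p v + d\<psi> p w"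
  by (auto simp: differential_def fun_eq_iff)

lemma differential_scale: "d\<psi> p (c *\<^sub>R v) = c *\<^sub>R d\<psi> p v"
  by (auto simp: differential_def scaleR_fun_def)

lemma linear_differential: "linear (d\<psi> p)"
  by (intro linearI differential_add differential_scale)

lemma differential_section: assumes S: "open S" and X: "vector_field_on \<A> S X"
  shows "sect S (\<lambda>q. d\<psi> q (X q))"
  unfolding section_on_def
proof (intro conjI ballI allI impI)
  fix W and f :: "'b \<Rightarrow> real" assume W: "open W" "smooth_fun_on \<B> W f"
  have *: "smooth_near \<B> (\<psi> q) f" if "q \<in> S \<inter> \<psi> -` W" for q using W that by (auto intro: smooth_nearI)
  have "smooth_fun_on \<A> (S \<inter> \<psi> -` W) (\<lambda>q. X q (\<lambda>r. f (\<psi> r)))"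
    using vector_field_on_smooth[OF X vimage_open[OF W(1)] smooth_fun_on_pullback[OF W]] .
  then show "smooth_fun_on \<A> (S \<inter> \<psi> -` W) (\<lambda>q. d\<psi> q (X q) f)"
    by (rule A.smooth_fun_on_cong[rotated 2])
      (use * S vimage_open[OF W(1)] in \<open>auto simp: differential_apply\<close>)
qed (use X in \<open>auto intro: differential_tangent vector_field_on_tangent\<close>)

lemma pullback_section:
  assumes "open W" "vector_field_on \<B> W E" shows "sect (\<psi> -` W) (\<lambda>q. E (\<psi> q))"
  unfolding section_on_def
proof (intro conjI ballI allI impI)
  fix W' and f :: "'b \<Rightarrow> real" assume W: "open W'" "smooth_fun_on \<B> W' f"
  have "smooth_fun_on \<A> (\<psi> -` (W \<inter> W')) (\<lambda>q. E (\<psi> q) f)"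
    using smooth_fun_on_pullback[OF _ vector_field_on_smooth[OF assms(2) W]] assms(1) W(1) by blast
  then show "smooth_fun_on \<A> (\<psi> -` W \<inter> \<psi> -` W') (\<lambda>q. E (\<psi> q) f)" by simp
qed (use assms in \<open>auto intro: vector_field_on_tangent\<close>)

lemma section_cong:
  assumes "open S" "\<And>q. q \<in> S \<Longrightarrow> X q = Y q" "sect S X"
  shows "sect S Y"
  unfolding section_on_def
proof (intro conjI ballI allI impI)
  fix W and f :: "'b \<Rightarrow> real" assume W: "open W" "smooth_fun_on \<B> W f"
  show "smooth_fun_on \<A> (S \<inter> \<psi> -` W) (\<lambda>p. Y p f)"
    by (rule A.smooth_fun_on_cong[OF _ _ section_on_smooth[OF assms(3) W]])
      (use assms vimage_open[OF W(1)] in auto)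
qed (use assms in \<open>auto dest: section_on_tangent\<close>)

lemma section_local:
  assumes "\<And>q. q \<in> S \<Longrightarrow> \<exists>T. open T \<and> q \<in> T \<and> sect T X"
  shows "sect S X"
  unfolding section_on_def
proof (intro conjI ballI allI impI)
  show "X p \<in> T\<^sub>B p" if "p \<in> S" for p using assms[OF that] section_on_tangent by blast
  fix W and f :: "'b \<Rightarrow> real" assume W: "open W" "smooth_fun_on \<B> W f"
  show "smooth_fun_on \<A> (S \<inter> \<psi> -` W) (\<lambda>p. X p f)"
  proof (rule A.smooth_fun_on_local)
    fix q assume q: "q \<in> S \<inter> \<psi> -` W"
    then obtain T where T: "open T" "q \<in> T" "sect T X" using assms by blast
    then show "\<exists>T. open T \<and> q \<in> T \<and> smooth_fun_on \<A> T (\<lambda>p. X p f)"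
      using section_on_smooth[OF T(3) W] vimage_open[OF W(1)] q by (intro exI[of _ "T \<inter> \<psi> -` W"]) auto
  qed
qed

text \<open>The coordinate frame of an ambient chart around \<psi> p, pulled back, frames the
  bundle. The coefficients are Z applied to coordinate functions, and these are smooth by the
  definition of a section.\<close>

lemma section_expansion:
  assumes Z: "sect S Z" and S: "open S" "p \<in> S"
  obtains T W E z where "open T" "p \<in> T" "T \<subseteq> S" "open W" "\<psi> ` T \<subseteq> W"
    "\<And>b. vector_field_on \<B> W (E b)" "\<And>b. smooth_fun_on \<A> T (z b)"
    "\<And>q. q \<in> T \<Longrightarrow> Z q = (\<Sum>b\<in>(Basis::'e set). z b q *\<^sub>R E b (\<psi> q))"
proof -
  obtain U y where c: "(U, y) \<in> \<B>" "\<psi> p \<in> U" by (rule B.chart_exists)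
  have U: "open U" using B.open_chart_domain[OF c(1)] .
  show thesis
  proof (rule that[of "S \<inter> \<psi> -` U" U "B.coord_vector U y" "\<lambda>b q. Z q (\<lambda>r. y r \<bullet> b)"])
    show "smooth_fun_on \<A> (S \<inter> \<psi> -` U) (\<lambda>q. Z q (\<lambda>r. y r \<bullet> b))" for b
      using section_on_smooth[OF Z U B.smooth_fun_on_coord[OF c(1)]] .
    show "Z q = (\<Sum>b\<in>Basis. Z q (\<lambda>r. y r \<bullet> b) *\<^sub>R B.coord_vector U y b (\<psi> q))"
      if "q \<in> S \<inter> \<psi> -` U" for q
      by (intro B.tangent_vector_expansion[OF c(1)] section_on_tangent[OF Z]) (use that in auto)
  qed (use U S c vimage_open[OF U] B.coord_vector_field[OF c(1)] in auto)
qed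

text \<open>Pulled-back ambient fields generate all sections locally over the smooth functions, by
  \<open>section_expansion\<close>. Smoothness claims about arbitrary sections thus need checking on
  generators only; \<open>cong\<close> absorbs the irrelevant values off T.\<close>

lemma section_induct [consumes 3, case_names pullback add scale cong]:
  assumes S: "open S" "p \<in> S" and Z: "sect S Z"
    and pullback: "\<And>W E. open W \<Longrightarrow> \<psi> p \<in> W \<Longrightarrow> vector_field_on \<B> W E \<Longrightarrow> P (\<lambda>q. E (\<psi> q))"
    and add: "\<And>T Y Z. open T \<Longrightarrow> p \<in> T \<Longrightarrow> sect T Y \<Longrightarrow> sect T Z \<Longrightarrow> P Y \<Longrightarrow> P Z \<Longrightarrow> P (\<lambda>q. Y q + Z q)"
    and scale: "\<And>T f Y. open T \<Longrightarrow> p \<in> T \<Longrightarrow> smooth_fun_on \<A> T f \<Longrightarrow> sect T Y \<Longrightarrow> P Y \<Longrightarrow> P (\<lambda>q. f q *\<^sub>R Y q)"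
    and cong: "\<And>T Y Z. open T \<Longrightarrow> p \<in> T \<Longrightarrow> sect T Y \<Longrightarrow> sect T Z \<Longrightarrow> (\<And>q. q \<in> T \<Longrightarrow> Y q = Z q) \<Longrightarrow> P Y \<Longrightarrow> P Z"
  shows "P Z"
proof (rule section_expansion[OF Z S])
  fix T W E z
  assume T: "open T" "p \<in> T" "T \<subseteq> S" "open W" "\<psi> ` T \<subseteq> W"
    "\<And>b. vector_field_on \<B> W (E b)" "\<And>b. smooth_fun_on \<A> T (z b)"
    "\<And>q. q \<in> T \<Longrightarrow> Z q = (\<Sum>b\<in>(Basis::'e set). z b q *\<^sub>R E b (\<psi> q))"
  have E: "sect T (\<lambda>q. E b (\<psi> q))" for b
    by (rule section_on_subset[OF pullback_section[OF T(4,6)]]) (use T(5) in auto)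
  have PE: "P (\<lambda>q. z b q *\<^sub>R E b (\<psi> q))" for b
    by (rule scale[OF T(1,2,7) E pullback[OF T(4) _ T(6)]]) (use T(2,5) in auto)
  have zE: "sect T (\<lambda>q. z b q *\<^sub>R E b (\<psi> q))" for b using section_on_scale[OF T(7) E] .
  \<comment> \<open>Nonempty index sets avoid a base case for the zero section; \<open>Basis\<close>
    itself is nonempty.\<close>
  have "P (\<lambda>q. \<Sum>b\<in>I. z b q *\<^sub>R E b (\<psi> q))" if "finite I" "I \<noteq> {}" for I
    using that
  proof (induction rule: finite_ne_induct)
    case (singleton b)
    then show ?case using PE[of b] by simp
  next
    case (insert b I)
    have "P (\<lambda>q. z b q *\<^sub>R E b (\<psi> q) + (\<Sum>b\<in>I. z b q *\<^sub>R E b (\<psi> q)))"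
      by (rule add[OF T(1,2) zE section_on_sum[OF zE] PE insert.IH])
    then show ?case by (simp only: sum.insert[OF insert.hyps(1,3)])
  qed
  then have *: "P (\<lambda>q. \<Sum>b\<in>(Basis::'e set). z b q *\<^sub>R E b (\<psi> q))" by simp
  show "P Z"
    by (rule cong[OF T(1,2) section_on_sum[OF zE] section_on_subset[OF Z T(3)] _ *]) (simp add: T(8))
qed

end

text \<open>Vector fields are sections along the identity, so the theory of connections along a map
  also covers connections on a manifold.\<close>

lemma (in smooth_manifold) smooth_mapping_id: "smooth_mapping \<A> \<A> (\<lambda>p. p)"
proof
  show "smooth_map \<A> \<A> (\<lambda>p. p)"
    unfolding smooth_map_def using smooth_fun_on_chart by (auto simp: o_def vimage_def)
qed


section \<open>Connections along a map\<close>

locale connection = smooth_mapping \<A> \<B> \<psi>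
  for \<A> :: "('a::{t2_space, second_countable_topology}, 'd::euclidean_space) atlas"
    and \<B> :: "('b::{t2_space, second_countable_topology}, 'e::euclidean_space) atlas"
    and \<psi> :: "'a \<Rightarrow> 'b" +
  fixes D :: "('a, 'b) conn"
  assumes connection: "connection_along \<A> \<B> \<psi> D"
begin

lemma D_section: "open S \<Longrightarrow> vector_field_on \<A> S X \<Longrightarrow> sect S Y \<Longrightarrow> sect S (\<lambda>p. D p (X p) Y)"
  by (rule connection[unfolded connection_along_def, THEN conjunct1, rule_format])

context
  fixes S p Y assumes S: "open S" "p \<in> S" "sect S Y"
begin

lemmas connection_rules = connection[unfolded connection_along_def, THEN conjunct2, rule_format, OF S]

lemma D_add_dir: "v \<in> T\<^sub>A p \<Longrightarrow> w \<in> T\<^sub>A p \<Longrightarrow> D p (v + w) Y = D p v Y + D p w Y"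
  by (rule connection_rules[THEN conjunct1, rule_format, THEN conjunct1])

lemma D_scale_dir: "v \<in> T\<^sub>A p \<Longrightarrow> D p (c *\<^sub>R v) Y = c *\<^sub>R D p v Y"
  by (rule connection_rules[THEN conjunct1, rule_format, THEN conjunct2, of v v])

lemma D_add: "v \<in> T\<^sub>A p \<Longrightarrow> sect S Z \<Longrightarrow> D p v (\<lambda>q. Y q + Z q) = D p v Y + D p v Z"
  by (rule connection_rules[THEN conjunct2, THEN conjunct1, rule_format])

lemma D_scale: "v \<in> T\<^sub>A p \<Longrightarrow> smooth_fun_on \<A> S f \<Longrightarrow> D p v (\<lambda>q. f q *\<^sub>R Y q) = v f *\<^sub>R Y p + f p *\<^sub>R D p v Y"
  by (rule connection_rules[THEN conjunct2, THEN conjunct2, rule_format])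

lemma D_cscale: "v \<in> T\<^sub>A p \<Longrightarrow> D p v (\<lambda>q. c *\<^sub>R Y q) = c *\<^sub>R D p v Y"
  using D_scale[OF _ smooth_fun_on_const] tangent_vector_const[of v \<A> p] by simp

text \<open>The axioms speak of values of D along smooth fields, so the single vector v is first
  extended to a field.\<close>

lemma D_tangent: assumes v: "v \<in> T\<^sub>A p" shows "D p v Y \<in> T\<^sub>B p"
proof -
  obtain T X where T: "open T" "p \<in> T" "vector_field_on \<A> T X" "X p = v"
    using A.tangent_vector_extension[OF v] .
  have "sect (S \<inter> T) (\<lambda>q. D q (X q) Y)"
    by (rule D_section[OF _ vector_field_on_subset[OF T(3)] section_on_subset[OF S(3)]]) (use S T in auto)
  then show ?thesis using section_on_tangent[of \<A> \<B> \<psi> "S \<inter> T" "\<lambda>q. D q (X q) Y" p] S(2) T by auto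
qed

end

text \<open>Locality follows from the Leibniz rule for the indicator function of the neighbourhood, which
  is smooth on that neighbourhood.\<close>

lemma D_cong:
  assumes T: "open T" "p \<in> T" "sect T Y" and YZ: "\<And>q. q \<in> T \<Longrightarrow> Y q = Z q" and v: "v \<in> T\<^sub>A p"
  shows "D p v Y = D p v Z"
proof -
  define i :: "'a \<Rightarrow> real" where "i q = (if q \<in> T then 1 else 0)" for q
  have i: "smooth_fun_on \<A> T i"
    by (rule A.smooth_fun_on_cong[OF T(1) _ smooth_fun_on_const[of _ _ 1]]) (simp add: i_def)
  have vi: "v i = 0"
    using A.tangent_vector_cong[OF v T(1,2), of i "\<lambda>q. 1"] tangent_vector_const[OF v] by (simp add: i_def)
  have Z: "sect T Z" by (rule section_cong[OF T(1) YZ T(3)])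
  have "(\<lambda>q. i q *\<^sub>R Y q) = (\<lambda>q. i q *\<^sub>R Z q)" using YZ by (auto simp: i_def)
  then show ?thesis
    using D_scale[OF T v i] D_scale[OF T(1,2) Z v i] vi T(2) by (simp add: i_def)
qed

lemma D_diff:
  assumes "open S" "p \<in> S" "sect S Y" "v \<in> T\<^sub>A p" "sect S Z"
  shows "D p v (\<lambda>q. Y q - Z q) = D p v Y - D p v Z"
  using D_add[OF assms(1-4) section_on_cscale[OF assms(5), of "-1"]] D_cscale[OF assms(1,2,5,4), of "-1"] by simp

lemma D_sum_dir:
  assumes S: "open S" "p \<in> S" "sect S Y" and v: "\<And>i. i \<in> I \<Longrightarrow> v i \<in> T\<^sub>A p"
  shows "D p (\<Sum>i\<in>I. c i *\<^sub>R v i) Y = (\<Sum>i\<in>I. c i *\<^sub>R D p (v i) Y)"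
proof -
  have "D p (0 *\<^sub>R 0) Y = 0 *\<^sub>R D p 0 Y"
    by (rule D_scale_dir[OF S subspace_0[OF subspace_tangent_space]])
  then have zero_dir: "D p 0 Y = 0" by (simp only: scaleR_zero_left)
  show ?thesis
    using v
  proof (induction I rule: infinite_finite_induct)
    case (infinite I)
    show ?case by (simp only: sum.infinite[OF infinite(1)] zero_dir)
  next
    case empty
    show ?case by (simp only: sum.empty zero_dir)
  next
    case (insert i I)
    have "c i *\<^sub>R v i \<in> T\<^sub>A p" "(\<Sum>i\<in>I. c i *\<^sub>R v i) \<in> T\<^sub>A p"
      using insert by (auto intro!: subspace_scale subspace_sum subspace_tangent_space)
    then show ?case using insert
      by (simp only: sum.insert[OF insert.hyps] D_add_dir[OF S] D_scale_dir[OF S] insertI1 insertI2)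
  qed
qed

end

text \<open>Tangent vectors are functions, and the pointwise rules would take vector identities apart.\<close>

declare plus_fun_apply [simp del] zero_fun_apply [simp del] minus_apply [simp del] uminus_apply [simp del]

lemmas tangent_add = subspace_add[OF subspace_tangent_space]
lemmas tangent_scale = subspace_scale[OF subspace_tangent_space]
lemmas tangent_minus = subspace_neg[OF subspace_tangent_space]
lemmas tangent_diff = subspace_diff[OF subspace_tangent_space]
lemmas tangent_zero = subspace_0[OF subspace_tangent_space]
lemmas tangent_sum = subspace_sum[OF subspace_tangent_space]
lemmas tangent_closure = tangent_add tangent_scale tangent_minus tangent_diff tangent_zero tangent_sum

section \<open>Symmetric tensors, frames and tensorial expressions\<close>

locale tensor_field = smooth_manifold \<A>
  for \<A> :: "('a::{t2_space, second_countable_topology}, 'e::euclidean_space) atlas" +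
  fixes g :: "'a \<Rightarrow> 'a tvec \<Rightarrow> 'a tvec \<Rightarrow> real"
  assumes tensor: "symmetric_tensor \<A> g"
begin

lemma tensor_smooth:
  "open S \<Longrightarrow> vector_field_on \<A> S X \<Longrightarrow> vector_field_on \<A> S Y \<Longrightarrow> smooth_fun_on \<A> S (\<lambda>p. g p (X p) (Y p))"
  by (rule tensor[unfolded symmetric_tensor_def, THEN conjunct2, rule_format])

context
  fixes p :: 'a
begin

lemmas tensor_rules = tensor[unfolded symmetric_tensor_def, THEN conjunct1, rule_format]

lemma tensor_sym: "u \<in> tangent_space \<A> p \<Longrightarrow> v \<in> tangent_space \<A> p \<Longrightarrow> g p u v = g p v u"
  using tensor_rules[of u p v u 0] by blast

lemma tensor_add_left: "u \<in> tangent_space \<A> p \<Longrightarrow> v \<in> tangent_space \<A> p \<Longrightarrow> w \<in> tangent_space \<A> p \<Longrightarrow> g p (u + v) w = g p u w + g p v w"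
  using tensor_rules[of u p v w 0] by blast

lemma tensor_scale_left: "u \<in> tangent_space \<A> p \<Longrightarrow> w \<in> tangent_space \<A> p \<Longrightarrow> g p (c *\<^sub>R u) w = c * g p u w"
  using tensor_rules[of u p w w c] by blast

lemma tensor_add_right: "u \<in> tangent_space \<A> p \<Longrightarrow> v \<in> tangent_space \<A> p \<Longrightarrow> w \<in> tangent_space \<A> p \<Longrightarrow> g p w (u + v) = g p w u + g p w v"
  by (simp only: tensor_sym[of w] tensor_add_left tangent_add)

lemma tensor_scale_right: "u \<in> tangent_space \<A> p \<Longrightarrow> w \<in> tangent_space \<A> p \<Longrightarrow> g p w (c *\<^sub>R u) = c * g p w u"
  by (simp only: tensor_sym[of w] tensor_scale_left tangent_scale)

lemma tensor_minus_left: "u \<in> tangent_space \<A> p \<Longrightarrow> w \<in> tangent_space \<A> p \<Longrightarrow> g p (- u) w = - g p u w"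
  using tensor_scale_left[of u w "-1"] by simp

lemma tensor_minus_right: "u \<in> tangent_space \<A> p \<Longrightarrow> w \<in> tangent_space \<A> p \<Longrightarrow> g p w (- u) = - g p w u"
  using tensor_scale_right[of u w "-1"] by simp

lemma tensor_diff_left: "u \<in> tangent_space \<A> p \<Longrightarrow> v \<in> tangent_space \<A> p \<Longrightarrow> w \<in> tangent_space \<A> p \<Longrightarrow> g p (u - v) w = g p u w - g p v w"
  using tensor_add_left[OF _ tangent_minus, of u v w] tensor_minus_left[of v w] by simp

lemma tensor_diff_right: "u \<in> tangent_space \<A> p \<Longrightarrow> v \<in> tangent_space \<A> p \<Longrightarrow> w \<in> tangent_space \<A> p \<Longrightarrow> g p w (u - v) = g p w u - g p w v"
  using tensor_add_right[OF _ tangent_minus, of u v w] tensor_minus_right[of v w] by simp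

lemma tensor_zero_left: "w \<in> tangent_space \<A> p \<Longrightarrow> g p 0 w = 0"
  using tensor_scale_left[OF tangent_zero, of w 0] by simp

lemma tensor_zero_right: "w \<in> tangent_space \<A> p \<Longrightarrow> g p w 0 = 0"
  using tensor_scale_right[OF tangent_zero, of w 0] by simp

lemma tensor_sum_left: "(\<And>i. i \<in> I \<Longrightarrow> v i \<in> tangent_space \<A> p) \<Longrightarrow> w \<in> tangent_space \<A> p \<Longrightarrow> g p (\<Sum>i\<in>I. v i) w = (\<Sum>i\<in>I. g p (v i) w)"
proof (induction I rule: infinite_finite_induct)
  case (insert i I)
  then have "g p (v i + (\<Sum>i\<in>I. v i)) w = g p (v i) w + g p (\<Sum>i\<in>I. v i) w"
    by (intro tensor_add_left tangent_sum) auto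
  with insert show ?case by (simp only: sum.insert[OF insert.hyps] insertI1 insertI2)
qed (simp_all only: sum.infinite sum.empty tensor_zero_left simp_thms)

lemma tensor_sum_right: "(\<And>i. i \<in> I \<Longrightarrow> v i \<in> tangent_space \<A> p) \<Longrightarrow> w \<in> tangent_space \<A> p \<Longrightarrow> g p w (\<Sum>i\<in>I. v i) = (\<Sum>i\<in>I. g p w (v i))"
  using tensor_sum_left[of I v w] tensor_sym[of w] tangent_sum[of I v \<A> p] by (simp cong: sum.cong)

end

lemmas tensor_left = tensor_add_left tensor_scale_left tensor_minus_left tensor_diff_left tensor_zero_left
lemmas tensor_right = tensor_add_right tensor_scale_right tensor_minus_right tensor_diff_right tensor_zero_right
lemmas tensor_simps = tensor_left tensor_right

end

lemma (in smooth_manifold) local_frame: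
  obtains W E h where "open W" "p \<in> W" "\<And>b. vector_field_on \<A> W (E b)" "\<And>b. smooth_fun_on \<A> W (h b)"
    "\<And>q w. q \<in> W \<Longrightarrow> w \<in> tangent_space \<A> q \<Longrightarrow> w = (\<Sum>b\<in>(Basis::'e set). w (h b) *\<^sub>R E b q)"
proof -
  obtain U x where c: "(U, x) \<in> \<A>" "p \<in> U" by (rule chart_exists)
  show thesis
    by (rule that[OF open_chart_domain[OF c(1)] c(2) coord_vector_field[OF c(1)]
          smooth_fun_on_coord[OF c(1)] tangent_vector_expansion[OF c(1)]])
qed

context smooth_mapping
begin

text \<open>In a frame around \<psi> p the two linearity rules turn K Y into a combination of the
  K-values of the frame with coefficients \<open>Y p (h b)\<close>, which involve Y p alone. As K
  acts on total functions, its locality has to be assumed separately as \<open>cong\<close>.\<close>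

lemma section_tensorial:
  fixes K :: "('a \<Rightarrow> 'b tvec) \<Rightarrow> 'c::real_vector"
  assumes Y: "open S" "p \<in> S" "sect S Y" and Z: "open S'" "p \<in> S'" "sect S' Z" and YZ: "Y p = Z p"
    and add: "\<And>T Y Z. open T \<Longrightarrow> p \<in> T \<Longrightarrow> sect T Y \<Longrightarrow> sect T Z \<Longrightarrow> K (\<lambda>q. Y q + Z q) = K Y + K Z"
    and scale: "\<And>T f Y. open T \<Longrightarrow> p \<in> T \<Longrightarrow> smooth_fun_on \<A> T f \<Longrightarrow> sect T Y \<Longrightarrow> K (\<lambda>q. f q *\<^sub>R Y q) = f p *\<^sub>R K Y"
    and cong: "\<And>T Y Z. open T \<Longrightarrow> p \<in> T \<Longrightarrow> sect T Y \<Longrightarrow> (\<And>q. q \<in> T \<Longrightarrow> Y q = Z q) \<Longrightarrow> K Y = K Z"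
  shows "K Y = K Z"
proof (rule B.local_frame[of "\<psi> p"])
  fix W E h
  assume W: "open W" "\<psi> p \<in> W" "\<And>b. vector_field_on \<B> W (E b)" "\<And>b. smooth_fun_on \<B> W (h b)"
    and expand: "\<And>q w. q \<in> W \<Longrightarrow> w \<in> tangent_space \<B> q \<Longrightarrow> w = (\<Sum>b\<in>(Basis::'e set). w (h b) *\<^sub>R E b q)"
  have *: "K Y = (\<Sum>b\<in>(Basis::'e set). Y p (h b) *\<^sub>R K (\<lambda>q. E b (\<psi> q)))"
    if Y: "open S" "p \<in> S" "sect S Y" for S Y
  proof -
    define T where "T = S \<inter> \<psi> -` W"
    have T: "open T" "p \<in> T" using Y(1,2) W(2) vimage_open[OF W(1)] unfolding T_def by auto
    have E: "sect T (\<lambda>q. E b (\<psi> q))" for b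
      by (rule section_on_subset[OF pullback_section[OF W(1,3)]]) (simp add: T_def)
    have y: "smooth_fun_on \<A> T (\<lambda>q. Y q (h b))" for b
      using section_on_smooth[OF Y(3) W(1,4)] unfolding T_def .
    have yE: "sect T (\<lambda>q. Y q (h b) *\<^sub>R E b (\<psi> q))" for b by (rule section_on_scale[OF y E])
    have "K (\<lambda>q. \<Sum>b\<in>I. Y q (h b) *\<^sub>R E b (\<psi> q)) = (\<Sum>b\<in>I. Y p (h b) *\<^sub>R K (\<lambda>q. E b (\<psi> q)))"
      if "finite I" "I \<noteq> {}" for I
      using that
    proof (induction rule: finite_ne_induct)
      case (singleton b)
      show ?case by (simp add: scale[OF T y E])
    next
      case (insert b I)
      show ?case
        by (simp only: sum.insert[OF insert.hyps(1,3)] add[OF T yE section_on_sum[OF yE]] scale[OF T y E] insert.IH)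
    qed
    then have "K (\<lambda>q. \<Sum>b\<in>(Basis::'e set). Y q (h b) *\<^sub>R E b (\<psi> q)) = (\<Sum>b\<in>(Basis::'e set). Y p (h b) *\<^sub>R K (\<lambda>q. E b (\<psi> q)))"
      by simp
    moreover have "K Y = K (\<lambda>q. \<Sum>b\<in>(Basis::'e set). Y q (h b) *\<^sub>R E b (\<psi> q))"
    proof (rule cong[OF T section_on_subset[OF Y(3)]])
      fix q assume "q \<in> T"
      then show "Y q = (\<Sum>b\<in>(Basis::'e set). Y q (h b) *\<^sub>R E b (\<psi> q))"
        by (intro expand section_on_tangent[OF Y(3)]) (auto simp: T_def)
    qed (simp add: T_def)
    ultimately show ?thesis by simp
  qed
  show "K Y = K Z" unfolding *[OF Y] *[OF Z] YZ ..
qed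

lemma section_pullback_extension:
  assumes "u \<in> T\<^sub>B p"
  obtains W E where "open W" "\<psi> p \<in> W" "vector_field_on \<B> W E" "E (\<psi> p) = u"
    "open (\<psi> -` W)" "p \<in> \<psi> -` W" "sect (\<psi> -` W) (\<lambda>q. E (\<psi> q))"
proof -
  obtain W E where *: "open W" "\<psi> p \<in> W" "vector_field_on \<B> W E" "E (\<psi> p) = u"
    by (rule B.tangent_vector_extension[OF assms])
  show thesis using that[OF * vimage_open[OF *(1)] _ pullback_section[OF *(1,3)]] *(2) by simp
qed

end

locale mapping_tensor = smooth_mapping \<A> \<B> \<psi> + G: tensor_field \<B> g
  for \<A> :: "('a::{t2_space, second_countable_topology}, 'd::euclidean_space) atlas"
    and \<B> :: "('b::{t2_space, second_countable_topology}, 'e::euclidean_space) atlas"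
    and \<psi> :: "'a \<Rightarrow> 'b" and g
begin

text \<open>Induction in the first argument with the second held fixed.
  \<open>tensor_smooth_near\<close> runs it twice, exchanging the arguments by symmetry, until both
  are restrictions of ambient fields.\<close>

lemma tensor_smooth_step:
  assumes Z: "open S" "p \<in> S" "sect S Z"
    and base: "\<And>W E. open W \<Longrightarrow> \<psi> p \<in> W \<Longrightarrow> vector_field_on \<B> W E \<Longrightarrow> smooth_near \<A> p (\<lambda>q. g (\<psi> q) (E (\<psi> q)) (Z q))"
    and Y: "open S'" "p \<in> S'" "sect S' Y"
  shows "smooth_near \<A> p (\<lambda>q. g (\<psi> q) (Y q) (Z q))"
  using Y
proof (induction rule: section_induct)
  case (pullback W E)
  then show ?case by (rule base)
next
  case (add T Y Y')
  show ?case
    by (rule A.smooth_near_cong[OF _ _ _ smooth_near_add[OF add(5,6)], of "S \<inter> T"])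
      (use add(1,2) Z(1,2) in \<open>auto simp: G.tensor_add_left section_on_tangent[OF add(3)]
          section_on_tangent[OF add(4)] section_on_tangent[OF Z(3)]\<close>)
next
  case (scale T f Y)
  show ?case
    by (rule A.smooth_near_cong[OF _ _ _ smooth_near_mult[OF smooth_nearI[OF scale(1,2,3)] scale(5)], of "S \<inter> T"])
      (use scale(1,2) Z(1,2) in \<open>auto simp: G.tensor_scale_left section_on_tangent[OF scale(4)] section_on_tangent[OF Z(3)]\<close>)
next
  case (cong T Y Y')
  show ?case by (rule A.smooth_near_cong[OF cong(1,2) _ cong(6)]) (simp add: cong(5))
qed

lemma tensor_smooth_near:
  assumes Y: "open S" "p \<in> S" "sect S Y" and Z: "open S'" "p \<in> S'" "sect S' Z"
  shows "smooth_near \<A> p (\<lambda>q. g (\<psi> q) (Y q) (Z q))"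
proof (rule tensor_smooth_step[OF Z _ Y])
  fix W E assume E: "open W" "\<psi> p \<in> W" "vector_field_on \<B> W E"
  have sE: "open (\<psi> -` W)" "p \<in> \<psi> -` W" "sect (\<psi> -` W) (\<lambda>q. E (\<psi> q))"
    using E vimage_open pullback_section by auto
  have "smooth_near \<A> p (\<lambda>q. g (\<psi> q) (Z q) (E (\<psi> q)))"
  proof (rule tensor_smooth_step[OF sE _ Z])
    fix W' F assume F: "open W'" "\<psi> p \<in> W'" "vector_field_on \<B> W' F"
    have "smooth_fun_on \<B> (W \<inter> W') (\<lambda>r. g r (F r) (E r))"
      by (rule G.tensor_smooth) (use E F in \<open>auto intro: vector_field_on_subset\<close>)
    then show "smooth_near \<A> p (\<lambda>q. g (\<psi> q) (F (\<psi> q)) (E (\<psi> q)))"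
      using E F by (intro smooth_near_pullback[of p "\<lambda>r. g r (F r) (E r)"] smooth_nearI[of "W \<inter> W'"]) auto
  qed
  then show "smooth_near \<A> p (\<lambda>q. g (\<psi> q) (E (\<psi> q)) (Z q))"
    by (rule A.smooth_near_cong[rotated 3, of _ _ "S' \<inter> \<psi> -` W"])
      (use sE Z in \<open>auto intro!: G.tensor_sym dest: section_on_tangent\<close>)
qed

lemma tensor_smooth_section:
  assumes "open S" "sect S Y" "sect S Z"
  shows "smooth_fun_on \<A> S (\<lambda>q. g (\<psi> q) (Y q) (Z q))"
proof (rule A.smooth_fun_on_local)
  fix q assume "q \<in> S"
  then show "\<exists>T. open T \<and> q \<in> T \<and> smooth_fun_on \<A> T (\<lambda>q. g (\<psi> q) (Y q) (Z q))"
    using tensor_smooth_near[OF assms(1) _ assms(2,1) _ assms(3)] unfolding smooth_near_def by simp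
qed

end

lemma scaleR_fun_apply: "(c *\<^sub>R X) f = c *\<^sub>R X f"
  by (simp add: scaleR_fun_def)

lemma (in smooth_manifold) vector_field_smooth_near:
  assumes "open S" "p \<in> S" "vector_field_on \<A> S X" "smooth_near \<A> p f"
  shows "smooth_near \<A> p (\<lambda>q. X q f)"
proof -
  obtain W where W: "open W" "p \<in> W" "smooth_fun_on \<A> W f" using assms(4) unfolding smooth_near_def by blast
  show ?thesis
    by (rule smooth_nearI[OF _ _ vector_field_on_smooth[OF assms(3) W(1,3)]]) (use assms W in auto)
qed

text \<open>Iterated derivatives obey the Leibniz rule up to the mixed terms Y f * X h + X f * Y h.
  These are symmetric in X and Y, so they cancel in the commutator.\<close>

lemma (in smooth_manifold) lie_bracket_tangent:
  assumes S: "open S" "p \<in> S" and X: "vector_field_on \<A> S X" and Y: "vector_field_on \<A> S Y"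
  shows "lie_bracket \<A> X Y p \<in> tangent_space \<A> p"
proof -
  have second: "X p (\<lambda>q. Y q (\<lambda>r. f r + h r)) = X p (\<lambda>q. Y q f) + X p (\<lambda>q. Y q h)"
    "X p (\<lambda>q. Y q (\<lambda>r. c * f r)) = c * X p (\<lambda>q. Y q f)"
    "X p (\<lambda>q. Y q (\<lambda>r. f r * h r)) = X p (\<lambda>q. Y q f) * h p + Y p f * X p h + X p f * Y p h + f p * X p (\<lambda>q. Y q h)"
    if X: "vector_field_on \<A> S X" and Y: "vector_field_on \<A> S Y"
      and f: "smooth_near \<A> p f" and h: "smooth_near \<A> p h" for X Y f h c
  proof -
    obtain T where T: "open T" "p \<in> T" "smooth_fun_on \<A> T f" "smooth_fun_on \<A> T h"
      by (rule smooth_near_common[OF f h])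
    have Xp: "X p \<in> tangent_space \<A> p" by (rule vector_field_on_tangent[OF X S(2)])
    have Yq: "Y q \<in> tangent_space \<A> q" if "q \<in> S \<inter> T" for q using vector_field_on_tangent[OF Y] that by simp
    have near: "smooth_near \<A> q f" "smooth_near \<A> q h" if "q \<in> S \<inter> T" for q
      using T that by (auto intro: smooth_nearI)
    have U: "open (S \<inter> T)" "p \<in> S \<inter> T" using S T by auto
    note Yf = vector_field_smooth_near[OF S Y f] and Yh = vector_field_smooth_near[OF S Y h]
    show "X p (\<lambda>q. Y q (\<lambda>r. f r + h r)) = X p (\<lambda>q. Y q f) + X p (\<lambda>q. Y q h)"
      unfolding tangent_vector_add[OF Xp Yf Yh, symmetric]
      by (rule tangent_vector_cong[OF Xp U]) (rule tangent_vector_add[OF Yq near(1,2)])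
    show "X p (\<lambda>q. Y q (\<lambda>r. c * f r)) = c * X p (\<lambda>q. Y q f)"
      unfolding tangent_vector_cmult[OF Xp Yf, symmetric]
      by (rule tangent_vector_cong[OF Xp U]) (rule tangent_vector_cmult[OF Yq near(1)])
    have "X p (\<lambda>q. Y q (\<lambda>r. f r * h r)) = X p (\<lambda>q. Y q f * h q + f q * Y q h)"
      by (rule tangent_vector_cong[OF Xp U]) (rule tangent_vector_mult[OF Yq near(1,2)])
    also have "\<dots> = X p (\<lambda>q. Y q f * h q) + X p (\<lambda>q. f q * Y q h)"
      by (rule tangent_vector_add[OF Xp smooth_near_mult[OF Yf h] smooth_near_mult[OF f Yh]])
    finally show "X p (\<lambda>q. Y q (\<lambda>r. f r * h r)) = X p (\<lambda>q. Y q f) * h p + Y p f * X p h + X p f * Y p h + f p * X p (\<lambda>q. Y q h)"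
      by (simp add: tangent_vector_mult[OF Xp Yf h] tangent_vector_mult[OF Xp f Yh])
  qed
  show ?thesis
    unfolding tangent_space_def lie_bracket_def
    by (auto simp: smooth_near_add smooth_near_mult smooth_near_const second[OF X Y] second[OF Y X] algebra_simps)
qed

context smooth_mapping
begin

lemma section_smooth_near:
  assumes "open S" "p \<in> S" "sect S Y" "smooth_near \<B> (\<psi> p) f"
  shows "smooth_near \<A> p (\<lambda>q. Y q f)"
proof -
  obtain W where W: "open W" "\<psi> p \<in> W" "smooth_fun_on \<B> W f" using assms(4) unfolding smooth_near_def by blast
  show ?thesis
    by (rule smooth_nearI[OF _ _ section_on_smooth[OF assms(3) W(1,3)]]) (use assms W vimage_open in auto)
qed

end

section \<open>Metric, torsion and curvature identities for a pulled-back Levi-Civita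
  connection\<close>

locale pullback_levi_civita = connection \<A> \<B> \<psi> D + mapping_tensor \<A> \<B> \<psi> g
  for \<A> :: "('a::{t2_space, second_countable_topology}, 'd::euclidean_space) atlas"
    and \<B> :: "('b::{t2_space, second_countable_topology}, 'e::euclidean_space) atlas"
    and \<psi> :: "'a \<Rightarrow> 'b" and D g +
  fixes nab :: "('b, 'b) conn"
  assumes levi_civita: "levi_civita \<B> g nab"
    and pullback: "pullback_connection \<A> \<B> \<psi> nab D"
begin

sublocale N: connection \<B> \<B> "\<lambda>p. p" nab
proof -
  interpret I: smooth_mapping \<B> \<B> "\<lambda>p. p" by (rule B.smooth_mapping_id)
  show "connection \<B> \<B> (\<lambda>p. p) nab"
    by unfold_locales (use levi_civita levi_civita_def in blast)
qed

lemma nab_torsion: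
  "open S \<Longrightarrow> vector_field_on \<B> S X \<Longrightarrow> vector_field_on \<B> S Y \<Longrightarrow> p \<in> S \<Longrightarrow>
    nab p (X p) Y - nab p (Y p) X = lie_bracket \<B> X Y p"
  by (rule levi_civita[unfolded levi_civita_def, THEN conjunct2, THEN conjunct1, rule_format])

lemma nab_metric:
  "open S \<Longrightarrow> vector_field_on \<B> S Y \<Longrightarrow> vector_field_on \<B> S Z \<Longrightarrow> p \<in> S \<Longrightarrow> v \<in> tangent_space \<B> p \<Longrightarrow>
    v (\<lambda>q. g q (Y q) (Z q)) = g p (nab p v Y) (Z p) + g p (Y p) (nab p v Z)"
  by (rule levi_civita[unfolded levi_civita_def, THEN conjunct2, THEN conjunct2, rule_format])

lemma D_pullback:
  "open W \<Longrightarrow> vector_field_on \<B> W E \<Longrightarrow> \<psi> p \<in> W \<Longrightarrow> v \<in> T\<^sub>A p \<Longrightarrow>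
    D p v (\<lambda>q. E (\<psi> q)) = nab (\<psi> p) (d\<psi> p v) E"
  by (rule pullback[unfolded pullback_connection_def, THEN conjunct2, rule_format])

text \<open>The defect of the product rule is tensorial in both arguments, and vanishes for fields that
  extend to the ambient manifold.\<close>

lemma D_metric_tensorial:
  assumes Z: "open S" "p \<in> S" "sect S Z" and v: "v \<in> T\<^sub>A p"
    and Y: "open S1" "p \<in> S1" "sect S1 Y" and Y': "open S2" "p \<in> S2" "sect S2 Y'" and YY': "Y p = Y' p"
  shows "v (\<lambda>q. g (\<psi> q) (Y q) (Z q)) - g (\<psi> p) (D p v Y) (Z p) - g (\<psi> p) (Y p) (D p v Z) =
    v (\<lambda>q. g (\<psi> q) (Y' q) (Z q)) - g (\<psi> p) (D p v Y') (Z p) - g (\<psi> p) (Y' p) (D p v Z)"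
    (is "?K Y = ?K Y'")
proof (rule section_tensorial[OF Y Y' YY'])
  have Zp: "Z p \<in> T\<^sub>B p" "D p v Z \<in> T\<^sub>B p" using section_on_tangent[OF Z(3,2)] D_tangent[OF Z v] .
  fix T Y assume T: "open T" "p \<in> T" and Y: "sect T Y"
  have Yp: "Y p \<in> T\<^sub>B p" "D p v Y \<in> T\<^sub>B p" using section_on_tangent[OF Y T(2)] D_tangent[OF T Y v] .
  note YZ = tensor_smooth_near[OF T Y Z]
  { fix Y' assume Y': "sect T Y'"
    have Y'p: "Y' p \<in> T\<^sub>B p" "D p v Y' \<in> T\<^sub>B p" using section_on_tangent[OF Y' T(2)] D_tangent[OF T Y' v] .
    have "v (\<lambda>q. g (\<psi> q) (Y q + Y' q) (Z q)) = v (\<lambda>q. g (\<psi> q) (Y q) (Z q) + g (\<psi> q) (Y' q) (Z q))"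
      by (rule A.tangent_vector_cong[OF v, of "S \<inter> T"])
        (use T Z(1,2) in \<open>auto simp: G.tensor_add_left section_on_tangent[OF Y] section_on_tangent[OF Y'] section_on_tangent[OF Z(3)]\<close>)
    also have "\<dots> = v (\<lambda>q. g (\<psi> q) (Y q) (Z q)) + v (\<lambda>q. g (\<psi> q) (Y' q) (Z q))"
      by (rule tangent_vector_add[OF v YZ tensor_smooth_near[OF T Y' Z]])
    finally show "?K (\<lambda>q. Y q + Y' q) = ?K Y + ?K Y'"
      by (simp add: D_add[OF T Y v Y'] G.tensor_add_left Yp Y'p Zp) }
  { fix f :: "'a \<Rightarrow> real" assume f: "smooth_fun_on \<A> T f"
    have "v (\<lambda>q. g (\<psi> q) (f q *\<^sub>R Y q) (Z q)) = v (\<lambda>q. f q * g (\<psi> q) (Y q) (Z q))"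
      by (rule A.tangent_vector_cong[OF v, of "S \<inter> T"])
        (use T Z(1,2) in \<open>auto simp: G.tensor_scale_left section_on_tangent[OF Y] section_on_tangent[OF Z(3)]\<close>)
    also have "\<dots> = v f * g (\<psi> p) (Y p) (Z p) + f p * v (\<lambda>q. g (\<psi> q) (Y q) (Z q))"
      by (rule tangent_vector_mult[OF v smooth_nearI[OF T f] YZ])
    finally show "?K (\<lambda>q. f q *\<^sub>R Y q) = f p *\<^sub>R ?K Y"
      by (simp add: D_scale[OF T Y v f] G.tensor_add_left G.tensor_scale_left tangent_closure Yp Zp algebra_simps) }
  { fix Y' assume YY': "\<And>q. q \<in> T \<Longrightarrow> Y q = Y' q"
    have "v (\<lambda>q. g (\<psi> q) (Y q) (Z q)) = v (\<lambda>q. g (\<psi> q) (Y' q) (Z q))"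
      by (rule A.tangent_vector_cong[OF v T]) (simp add: YY')
    then show "?K Y = ?K Y'" using D_cong[OF T Y YY' v] YY'[OF T(2)] by simp }
qed

lemma D_metric:
  assumes Y: "open S" "p \<in> S" "sect S Y" and Z: "sect S Z" and v: "v \<in> T\<^sub>A p"
  shows "v (\<lambda>q. g (\<psi> q) (Y q) (Z q)) = g (\<psi> p) (D p v Y) (Z p) + g (\<psi> p) (Y p) (D p v Z)"
proof -
  let ?K = "\<lambda>Y Z. v (\<lambda>q. g (\<psi> q) (Y q) (Z q)) - g (\<psi> p) (D p v Y) (Z p) - g (\<psi> p) (Y p) (D p v Z)"
  \<comment> \<open>\<open>D_metric_tensorial\<close> replaces only the first argument by an ambient
    field; symmetry of the defect brings the second argument into first position.\<close>
  have sym: "?K Y Z = ?K Z Y" if "open S" "p \<in> S" "sect S Y" and "open S'" "p \<in> S'" "sect S' Z" for S S' Y Z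
  proof -
    have "v (\<lambda>q. g (\<psi> q) (Y q) (Z q)) = v (\<lambda>q. g (\<psi> q) (Z q) (Y q))"
      by (rule A.tangent_vector_cong[OF v, of "S \<inter> S'"])
        (use that in \<open>auto intro!: G.tensor_sym simp: section_on_tangent[OF that(3)] section_on_tangent[OF that(6)]\<close>)
    then show ?thesis
      using D_tangent[OF that(1-3) v] D_tangent[OF that(4-6) v] section_on_tangent[OF that(3,2)]
        section_on_tangent[OF that(6,5)] G.tensor_sym by simp
  qed
  obtain W E where E: "open W" "\<psi> p \<in> W" "vector_field_on \<B> W E" "E (\<psi> p) = Y p"
    and sE: "open (\<psi> -` W)" "p \<in> \<psi> -` W" "sect (\<psi> -` W) (\<lambda>q. E (\<psi> q))"
    using section_pullback_extension[OF section_on_tangent[OF Y(3,2)]] by metis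
  obtain W' F where F: "open W'" "\<psi> p \<in> W'" "vector_field_on \<B> W' F" "F (\<psi> p) = Z p"
    and sF: "open (\<psi> -` W')" "p \<in> \<psi> -` W'" "sect (\<psi> -` W') (\<lambda>q. F (\<psi> q))"
    using section_pullback_extension[OF section_on_tangent[OF Z Y(2)]] by metis
  have "?K Y Z = ?K (\<lambda>q. E (\<psi> q)) Z"
    by (rule D_metric_tensorial[OF Y(1,2) Z v Y sE]) (simp add: E)
  also have "\<dots> = ?K Z (\<lambda>q. E (\<psi> q))" by (rule sym[OF sE Y(1,2) Z])
  also have "\<dots> = ?K (\<lambda>q. F (\<psi> q)) (\<lambda>q. E (\<psi> q))"
    by (rule D_metric_tensorial[OF sE v Y(1,2) Z sF]) (simp add: F)
  also have "\<dots> = 0"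
  proof -
    have WW: "open (W \<inter> W')" "\<psi> p \<in> W \<inter> W'" "vector_field_on \<B> (W \<inter> W') E" "vector_field_on \<B> (W \<inter> W') F"
      using E F by (auto intro: vector_field_on_subset)
    have "v (\<lambda>q. g (\<psi> q) (F (\<psi> q)) (E (\<psi> q))) = d\<psi> p v (\<lambda>r. g r (F r) (E r))"
      by (rule differential_apply[symmetric, of p "\<lambda>r. g r (F r) (E r)"])
        (rule smooth_nearI[OF WW(1,2) G.tensor_smooth[OF WW(1,4,3)]])
    also have "\<dots> = g (\<psi> p) (nab (\<psi> p) (d\<psi> p v) F) (E (\<psi> p)) + g (\<psi> p) (F (\<psi> p)) (nab (\<psi> p) (d\<psi> p v) E)"
      by (rule nab_metric[OF WW(1,4,3,2) differential_tangent[OF v]])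
    finally show ?thesis
      by (simp add: D_pullback[OF E(1,3,2) v] D_pullback[OF F(1,3,2) v])
  qed
  finally show ?thesis by simp
qed

text \<open>The left-hand side is a Hessian of f in the directions v and Z. Derivatives of a
  coefficient of Z cancel in it, so it is tensorial in Z and may be computed with an ambient field
  that merely agrees with Z at p.\<close>

lemma D_hessian:
  assumes v: "v \<in> T\<^sub>A p" and f: "smooth_near \<B> (\<psi> p) f" and Z: "open S" "p \<in> S" "sect S Z"
    and E: "open W" "\<psi> p \<in> W" "vector_field_on \<B> W E" "E (\<psi> p) = Z p"
  shows "v (\<lambda>q. Z q f) - D p v Z f = d\<psi> p v (\<lambda>r. E r f) - nab (\<psi> p) (d\<psi> p v) E f"
proof -
  have sE: "open (\<psi> -` W)" "p \<in> \<psi> -` W" "sect (\<psi> -` W) (\<lambda>q. E (\<psi> q))"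
    using E vimage_open pullback_section by auto
  let ?K = "\<lambda>Z. v (\<lambda>q. Z q f) - D p v Z f"
  have "?K Z = ?K (\<lambda>q. E (\<psi> q))"
  proof (rule section_tensorial[OF Z sE E(4)[symmetric]])
    fix T Y assume T: "open T" "p \<in> T" and Y: "sect T Y"
    note Yf = section_smooth_near[OF T Y f]
    { fix Y' assume Y': "sect T Y'"
      show "?K (\<lambda>q. Y q + Y' q) = ?K Y + ?K Y'"
        by (simp add: D_add[OF T Y v Y'] plus_fun_apply tangent_vector_add[OF v Yf section_smooth_near[OF T Y' f]]) }
    { fix h :: "'a \<Rightarrow> real" assume h: "smooth_fun_on \<A> T h"
      show "?K (\<lambda>q. h q *\<^sub>R Y q) = h p *\<^sub>R ?K Y"
        by (simp add: D_scale[OF T Y v h] plus_fun_apply scaleR_fun_apply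
            tangent_vector_mult[OF v smooth_nearI[OF T h] Yf] algebra_simps) }
    { fix Y' assume YY': "\<And>q. q \<in> T \<Longrightarrow> Y q = Y' q"
      have "v (\<lambda>q. Y q f) = v (\<lambda>q. Y' q f)"
        by (rule A.tangent_vector_cong[OF v T]) (simp add: YY')
      then show "?K Y = ?K Y'" using D_cong[OF T Y YY' v] by simp }
  qed
  also have "\<dots> = d\<psi> p v (\<lambda>r. E r f) - nab (\<psi> p) (d\<psi> p v) E f"
    using differential_apply[OF B.vector_field_smooth_near[OF E(1-3) f], of v] D_pullback[OF E(1,3,2) v] by simp
  finally show ?thesis .
qed

text \<open>Evaluated on f, both sides differ by an antisymmetrised ambient Hessian, computed by
  \<open>D_hessian\<close> with ambient fields through d\<psi> p (X p) and d\<psi> p (Y p). That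
  vanishes because the ambient connection has no torsion, and the commutator of X and Y on f after
  \<psi> remains.\<close>

lemma D_torsion:
  assumes S: "open S" "p \<in> S" and X: "vector_field_on \<A> S X" and Y: "vector_field_on \<A> S Y"
  shows "D p (X p) (\<lambda>q. d\<psi> q (Y q)) - D p (Y p) (\<lambda>q. d\<psi> q (X q)) = d\<psi> p (lie_bracket \<A> X Y p)"
proof
  fix f
  have Xp: "X p \<in> T\<^sub>A p" and Yp: "Y p \<in> T\<^sub>A p" using vector_field_on_tangent X Y S(2) by blast+
  have dX: "sect S (\<lambda>q. d\<psi> q (X q))" and dY: "sect S (\<lambda>q. d\<psi> q (Y q))"
    using differential_section S(1) X Y by blast+
  note DY = D_tangent[OF S dY Xp] and DX = D_tangent[OF S dX Yp]
  show "(D p (X p) (\<lambda>q. d\<psi> q (Y q)) - D p (Y p) (\<lambda>q. d\<psi> q (X q))) f = d\<psi> p (lie_bracket \<A> X Y p) f"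
  proof (cases "smooth_near \<B> (\<psi> p) f")
    case False
    then show ?thesis
      using tangent_vector_nonsmooth[OF DY False] tangent_vector_nonsmooth[OF DX False]
      by (simp add: minus_apply differential_def)
  next
    case True
    obtain U where U: "open U" "\<psi> p \<in> U" "smooth_fun_on \<B> U f" using True unfolding smooth_near_def by blast
    obtain W F where F: "open W" "\<psi> p \<in> W" "vector_field_on \<B> W F" "F (\<psi> p) = d\<psi> p (X p)"
      using B.tangent_vector_extension[OF differential_tangent[OF Xp]] by metis
    obtain W' F' where F': "open W'" "\<psi> p \<in> W'" "vector_field_on \<B> W' F'" "F' (\<psi> p) = d\<psi> p (Y p)"
      using B.tangent_vector_extension[OF differential_tangent[OF Yp]] by metis
    have WW: "open (W \<inter> W')" "\<psi> p \<in> W \<inter> W'" "vector_field_on \<B> (W \<inter> W') F" "vector_field_on \<B> (W \<inter> W') F'"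
      using F F' by (auto intro: vector_field_on_subset)
    have near: "\<And>q. q \<in> S \<inter> \<psi> -` U \<Longrightarrow> smooth_near \<B> (\<psi> q) f" using U by (auto intro: smooth_nearI)
    have SU: "open (S \<inter> \<psi> -` U)" "p \<in> S \<inter> \<psi> -` U" using S U vimage_open by auto
    have 1: "X p (\<lambda>q. d\<psi> q (Y q) f) = X p (\<lambda>q. Y q (\<lambda>r. f (\<psi> r)))"
      by (rule A.tangent_vector_cong[OF Xp SU]) (simp add: differential_apply near)
    have 2: "Y p (\<lambda>q. d\<psi> q (X q) f) = Y p (\<lambda>q. X q (\<lambda>r. f (\<psi> r)))"
      by (rule A.tangent_vector_cong[OF Yp SU]) (simp add: differential_apply near)
    have "nab (\<psi> p) (F (\<psi> p)) F' f - nab (\<psi> p) (F' (\<psi> p)) F f = lie_bracket \<B> F F' (\<psi> p) f"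
      using nab_torsion[OF WW(1,3,4,2)] by (metis minus_apply)
    then have 3: "nab (\<psi> p) (F (\<psi> p)) F' f - nab (\<psi> p) (F' (\<psi> p)) F f =
        d\<psi> p (X p) (\<lambda>r. F' r f) - d\<psi> p (Y p) (\<lambda>r. F r f)"
      by (simp add: lie_bracket_def True F(4) F'(4))
    show ?thesis
      using D_hessian[OF Xp True S dY F'] D_hessian[OF Yp True S dX F] 1 2 3
      by (simp add: minus_apply differential_apply[OF True] lie_bracket_def smooth_near_pullback[OF True] F(4) F'(4))
  qed
qed

end

lemma diff_diff_cong:
  fixes a b c d :: "'a::ab_group_add"
  assumes "a - b = c - d" "a' - b' = c' - d'"
  shows "a - a' - (b - b') = (c - c') - (d - d')"
proof -
  have "a - a' - (b - b') = (a - b) - (a' - b')" by simp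
  also have "\<dots> = (c - d) - (c' - d')" unfolding assms ..
  finally show ?thesis by simp
qed

context pullback_levi_civita
begin

text \<open>Y need not extend to the ambient manifold, so smoothness is proved by
  \<open>section_induct\<close>. The induction predicate is existential in the neighbourhood because
  each step may shrink it.\<close>

lemma nab_section:
  assumes E: "open W" "vector_field_on \<B> W E" and Y: "sect S Y" and S: "open S" "\<psi> ` S \<subseteq> W"
  shows "sect S (\<lambda>q. nab (\<psi> q) (Y q) E)"
proof (rule section_local)
  fix p assume p: "p \<in> S"
  note in_W = subsetD[OF S(2) imageI]
  from S(1) p Y show "\<exists>T. open T \<and> p \<in> T \<and> sect T (\<lambda>q. nab (\<psi> q) (Y q) E)"
  proof (induction rule: section_induct)
    case (pullback W' F)
    have "vector_field_on \<B> (W \<inter> W') (\<lambda>r. nab r (F r) E)"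
      unfolding vector_field_on_def
      by (rule N.D_section[OF open_Int[OF E(1) pullback(1)]])
        (use E pullback in \<open>auto simp: vector_field_on_def[symmetric] intro: vector_field_on_subset\<close>)
    from pullback_section[OF open_Int[OF E(1) pullback(1)] this]
    show ?case using vimage_open[OF open_Int[OF E(1) pullback(1)]] in_W[OF p] pullback(2)
      by (intro exI[of _ "\<psi> -` (W \<inter> W')"]) auto
  next
    case (add T Y Y')
    then obtain T1 T2 where T: "open T1" "p \<in> T1" "sect T1 (\<lambda>q. nab (\<psi> q) (Y q) E)"
      "open T2" "p \<in> T2" "sect T2 (\<lambda>q. nab (\<psi> q) (Y' q) E)" by blast
    let ?U = "T \<inter> T1 \<inter> T2 \<inter> S"
    have "sect ?U (\<lambda>q. nab (\<psi> q) (Y q) E + nab (\<psi> q) (Y' q) E)"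
      by (rule section_on_add[OF section_on_subset[OF T(3)] section_on_subset[OF T(6)]]) auto
    then have "sect ?U (\<lambda>q. nab (\<psi> q) (Y q + Y' q) E)"
      by (rule section_cong[rotated 2])
        (use add T S E in_W in \<open>auto simp: N.D_add_dir[OF E(1) _ E(2)[unfolded vector_field_on_def]]
          section_on_tangent[OF add(3)] section_on_tangent[OF add(4)]\<close>)
    then show ?case using add T S p by (intro exI[of _ ?U]) auto
  next
    case (scale T f Y)
    then obtain T1 where T: "open T1" "p \<in> T1" "sect T1 (\<lambda>q. nab (\<psi> q) (Y q) E)" by blast
    let ?U = "T \<inter> T1 \<inter> S"
    have "sect ?U (\<lambda>q. f q *\<^sub>R nab (\<psi> q) (Y q) E)"
      by (rule section_on_scale[OF smooth_fun_on_subset[OF scale(3)] section_on_subset[OF T(3)]]) auto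
    then have "sect ?U (\<lambda>q. nab (\<psi> q) (f q *\<^sub>R Y q) E)"
      by (rule section_cong[rotated 2])
        (use scale T S E in_W in \<open>auto simp: N.D_scale_dir[OF E(1) _ E(2)[unfolded vector_field_on_def]]
          section_on_tangent[OF scale(4)]\<close>)
    then show ?case using scale T S p by (intro exI[of _ ?U]) auto
  next
    case (cong T Y Y')
    then obtain T1 where T: "open T1" "p \<in> T1" "sect T1 (\<lambda>q. nab (\<psi> q) (Y q) E)" by blast
    have "sect (T \<inter> T1) (\<lambda>q. nab (\<psi> q) (Y' q) E)"
      by (rule section_cong[OF _ _ section_on_subset[OF T(3)], of "T \<inter> T1"]) (use cong T in auto)
    then show ?case using cong T by (intro exI[of _ "T \<inter> T1"]) auto
  qed
qed

text \<open>Both sides are the second covariant derivative of the ambient field \<open>E\<close> in the directions \<open>v\<close> and \<open>Y\<close>.\<close>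

lemma D_nab:
  assumes E: "open W" "\<psi> p \<in> W" "vector_field_on \<B> W E" and v: "v \<in> T\<^sub>A p"
    and Y: "open S" "p \<in> S" "sect S Y" and F: "vector_field_on \<B> W F" "F (\<psi> p) = Y p"
  shows "D p v (\<lambda>q. nab (\<psi> q) (Y q) E) - nab (\<psi> p) (D p v Y) E =
    nab (\<psi> p) (d\<psi> p v) (\<lambda>r. nab r (F r) E) - nab (\<psi> p) (nab (\<psi> p) (d\<psi> p v) F) E"
proof -
  let ?S = "\<psi> -` W"
  have sF: "open ?S" "p \<in> ?S" "sect ?S (\<lambda>q. F (\<psi> q))"
    using E F vimage_open pullback_section by auto
  note add_dir = N.D_add_dir[OF E(1) _ E(3)[unfolded vector_field_on_def]]
  note scale_dir = N.D_scale_dir[OF E(1) _ E(3)[unfolded vector_field_on_def]]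
  let ?K = "\<lambda>Y. D p v (\<lambda>q. nab (\<psi> q) (Y q) E) - nab (\<psi> p) (D p v Y) E"
  have "?K Y = ?K (\<lambda>q. F (\<psi> q))"
  proof (rule section_tensorial[OF Y sF F(2)[symmetric]])
    fix T Y assume T: "open T" "p \<in> T" and Y: "sect T Y"
    have U: "open (T \<inter> ?S)" "p \<in> T \<inter> ?S" using T sF by auto
    have YU: "sect (T \<inter> ?S) Y" using section_on_subset[OF Y] by blast
    have nabY: "sect (T \<inter> ?S) (\<lambda>q. nab (\<psi> q) (Y q) E)" by (rule nab_section[OF E(1,3) YU U(1)]) auto
    note Yp = section_on_tangent[OF Y T(2)] D_tangent[OF T Y v]
    { fix Y' assume Y': "sect T Y'"
      have YU': "sect (T \<inter> ?S) Y'" using section_on_subset[OF Y'] by blast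
      have nabY': "sect (T \<inter> ?S) (\<lambda>q. nab (\<psi> q) (Y' q) E)" by (rule nab_section[OF E(1,3) YU' U(1)]) auto
      have "D p v (\<lambda>q. nab (\<psi> q) (Y q + Y' q) E) = D p v (\<lambda>q. nab (\<psi> q) (Y q) E + nab (\<psi> q) (Y' q) E)"
        by (rule D_cong[OF U section_on_add[OF nabY nabY'] _ v, symmetric])
          (simp add: add_dir section_on_tangent[OF Y] section_on_tangent[OF Y'])
      also have "\<dots> = D p v (\<lambda>q. nab (\<psi> q) (Y q) E) + D p v (\<lambda>q. nab (\<psi> q) (Y' q) E)"
        by (rule D_add[OF U nabY v nabY'])
      finally show "?K (\<lambda>q. Y q + Y' q) = ?K Y + ?K Y'"
        by (simp add: D_add[OF T Y v Y'] add_dir E(2) Yp D_tangent[OF T Y' v]) }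
    { fix f :: "'a \<Rightarrow> real" assume f: "smooth_fun_on \<A> T f"
      have fU: "smooth_fun_on \<A> (T \<inter> ?S) f" using smooth_fun_on_subset[OF f] by blast
      have "D p v (\<lambda>q. nab (\<psi> q) (f q *\<^sub>R Y q) E) = D p v (\<lambda>q. f q *\<^sub>R nab (\<psi> q) (Y q) E)"
        by (rule D_cong[OF U section_on_scale[OF fU nabY] _ v, symmetric])
          (simp add: scale_dir section_on_tangent[OF Y])
      also have "\<dots> = v f *\<^sub>R nab (\<psi> p) (Y p) E + f p *\<^sub>R D p v (\<lambda>q. nab (\<psi> q) (Y q) E)"
        by (rule D_scale[OF U nabY v fU])
      finally show "?K (\<lambda>q. f q *\<^sub>R Y q) = f p *\<^sub>R ?K Y"
        by (simp add: D_scale[OF T Y v f] add_dir scale_dir E(2) Yp tangent_scale scaleR_diff_right) }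
    { fix Y' assume YY': "\<And>q. q \<in> T \<Longrightarrow> Y q = Y' q"
      have "D p v (\<lambda>q. nab (\<psi> q) (Y q) E) = D p v (\<lambda>q. nab (\<psi> q) (Y' q) E)"
        by (rule D_cong[OF U nabY _ v]) (simp add: YY')
      then show "?K Y = ?K Y'" using D_cong[OF T Y YY' v] by simp }
  qed
  also have "\<dots> = nab (\<psi> p) (d\<psi> p v) (\<lambda>r. nab r (F r) E) - nab (\<psi> p) (nab (\<psi> p) (d\<psi> p v) F) E"
  proof -
    have "vector_field_on \<B> W (\<lambda>r. nab r (F r) E)"
      using N.D_section[OF E(1) F(1) E(3)[unfolded vector_field_on_def]] by (simp add: vector_field_on_def)
    then show ?thesis
      using D_pullback[OF E(1) _ E(2) v] F(1) by simp
  qed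
  finally show ?thesis .
qed

text \<open>Inserting f Z, the first-order terms Y f * D_X Z + X f * D_Y Z are symmetric in X and Y
  and cancel, while the second derivatives of f are absorbed by the bracket term.\<close>

lemma D_curvature_tensorial:
  assumes S: "open S" "p \<in> S" and X: "vector_field_on \<A> S X" and Y: "vector_field_on \<A> S Y"
    and Z: "open S1" "p \<in> S1" "sect S1 Z" and Z': "open S2" "p \<in> S2" "sect S2 Z'" and ZZ': "Z p = Z' p"
  shows "D p (X p) (\<lambda>q. D q (Y q) Z) - D p (Y p) (\<lambda>q. D q (X q) Z) - D p (lie_bracket \<A> X Y p) Z =
    D p (X p) (\<lambda>q. D q (Y q) Z') - D p (Y p) (\<lambda>q. D q (X q) Z') - D p (lie_bracket \<A> X Y p) Z'"
    (is "?K Z = ?K Z'")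
proof (rule section_tensorial[OF Z Z' ZZ'])
  have Xq: "X q \<in> T\<^sub>A q" and Yq: "Y q \<in> T\<^sub>A q" if "q \<in> S" for q
    using vector_field_on_tangent X Y that by blast+
  note Xp = Xq[OF S(2)] and Yp = Yq[OF S(2)]
  note L = A.lie_bracket_tangent[OF S X Y]
  fix T Z assume T: "open T" "p \<in> T" and Z: "sect T Z"
  let ?U = "S \<inter> T"
  have U: "open ?U" "p \<in> ?U" using S T by auto
  have ZU: "sect ?U Z" using section_on_subset[OF Z] by blast
  have XU: "vector_field_on \<A> ?U X" and YU: "vector_field_on \<A> ?U Y"
    using vector_field_on_subset[OF X] vector_field_on_subset[OF Y] by blast+
  have DXZ: "sect ?U (\<lambda>q. D q (X q) Z)" and DYZ: "sect ?U (\<lambda>q. D q (Y q) Z)"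
    using D_section[OF U(1) XU ZU] D_section[OF U(1) YU ZU] by auto
  { fix Z' assume Z': "sect T Z'"
    have ZU': "sect ?U Z'" using section_on_subset[OF Z'] by blast
    have "D p v (\<lambda>q. D q (Y q) (\<lambda>q. Z q + Z' q)) = D p v (\<lambda>q. D q (Y q) Z) + D p v (\<lambda>q. D q (Y q) Z')"
      if v: "v \<in> T\<^sub>A p" and Y: "vector_field_on \<A> S Y" for v Y
    proof -
      have YU: "vector_field_on \<A> ?U Y" using vector_field_on_subset[OF Y] by blast
      note DZ = D_section[OF U(1) YU ZU] and DZ' = D_section[OF U(1) YU ZU']
      have "D p v (\<lambda>q. D q (Y q) (\<lambda>q. Z q + Z' q)) = D p v (\<lambda>q. D q (Y q) Z + D q (Y q) Z')"
        by (rule D_cong[OF U section_on_add[OF DZ DZ'] _ v, symmetric])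
          (simp add: D_add[OF T(1) _ Z _ Z'] vector_field_on_tangent[OF Y])
      then show ?thesis using D_add[OF U DZ v DZ'] by simp
    qed
    then show "?K (\<lambda>q. Z q + Z' q) = ?K Z + ?K Z'"
      by (simp add: Xp Yp X Y D_add[OF T Z L Z']) }
  { fix f :: "'a \<Rightarrow> real" assume f: "smooth_fun_on \<A> T f"
    have fU: "smooth_fun_on \<A> ?U f" using smooth_fun_on_subset[OF f] by blast
    have *: "D p v (\<lambda>q. D q (Y q) (\<lambda>q. f q *\<^sub>R Z q)) =
       v (\<lambda>q. Y q f) *\<^sub>R Z p + Y p f *\<^sub>R D p v Z + v f *\<^sub>R D p (Y p) Z + f p *\<^sub>R D p v (\<lambda>q. D q (Y q) Z)"
      if v: "v \<in> T\<^sub>A p" and Y: "vector_field_on \<A> S Y" for v Y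
    proof -
      have YU: "vector_field_on \<A> ?U Y" using vector_field_on_subset[OF Y] by blast
      note DZ = D_section[OF U(1) YU ZU]
      have Yf: "smooth_fun_on \<A> ?U (\<lambda>q. Y q f)" using vector_field_on_smooth[OF Y T(1) f] .
      have "D p v (\<lambda>q. D q (Y q) (\<lambda>q. f q *\<^sub>R Z q)) = D p v (\<lambda>q. Y q f *\<^sub>R Z q + f q *\<^sub>R D q (Y q) Z)"
        by (rule D_cong[OF U section_on_add[OF section_on_scale[OF Yf ZU] section_on_scale[OF fU DZ]] _ v, symmetric])
          (simp add: D_scale[OF T(1) _ Z _ f] vector_field_on_tangent[OF Y])
      also have "\<dots> = D p v (\<lambda>q. Y q f *\<^sub>R Z q) + D p v (\<lambda>q. f q *\<^sub>R D q (Y q) Z)"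
        by (rule D_add[OF U section_on_scale[OF Yf ZU] v section_on_scale[OF fU DZ]])
      finally show ?thesis by (simp add: D_scale[OF U ZU v Yf] D_scale[OF U DZ v fU])
    qed
    have "smooth_near \<A> p f" by (rule smooth_nearI[OF T f])
    then have Lf: "lie_bracket \<A> X Y p f = X p (\<lambda>q. Y q f) - Y p (\<lambda>q. X q f)" by (simp add: lie_bracket_def)
    show "?K (\<lambda>q. f q *\<^sub>R Z q) = f p *\<^sub>R ?K Z"
      by (simp add: *[OF Xp Y] *[OF Yp X] D_scale[OF T Z L f] Lf algebra_simps) }
  { fix Z' assume ZZ': "\<And>q. q \<in> T \<Longrightarrow> Z q = Z' q"
    have "D q (X q) Z = D q (X q) Z'" "D q (Y q) Z = D q (Y q) Z'" if "q \<in> ?U" for q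
      using D_cong[OF T(1) _ Z ZZ'] that Xq Yq by auto
    then have "D p (X p) (\<lambda>q. D q (Y q) Z) = D p (X p) (\<lambda>q. D q (Y q) Z')"
      "D p (Y p) (\<lambda>q. D q (X q) Z) = D p (Y p) (\<lambda>q. D q (X q) Z')"
      using D_cong[OF U DYZ _ Xp] D_cong[OF U DXZ _ Yp] by auto
    then show "?K Z = ?K Z'" using D_cong[OF T Z ZZ' L] by simp }
qed

text \<open>Needed for sections such as a unit normal, which are defined along \<psi> only. First Z
  is replaced by E through \<open>D_curvature_tensorial\<close>, then \<open>D_torsion\<close>
  rewrites the bracket, and \<open>D_nab\<close> exchanges the remaining first derivatives for
  ambient ones.\<close>

lemma D_curvature:
  assumes S: "open S" "p \<in> S" and X: "vector_field_on \<A> S X" and Y: "vector_field_on \<A> S Y" and Z: "sect S Z"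
    and W: "open W" "\<psi> p \<in> W" and F: "vector_field_on \<B> W F" "F (\<psi> p) = d\<psi> p (X p)"
    and G: "vector_field_on \<B> W G" "G (\<psi> p) = d\<psi> p (Y p)" and E: "vector_field_on \<B> W E" "E (\<psi> p) = Z p"
  shows "D p (X p) (\<lambda>q. D q (Y q) Z) - D p (Y p) (\<lambda>q. D q (X q) Z) - D p (lie_bracket \<A> X Y p) Z =
    curvature \<B> nab F G E (\<psi> p)"
proof -
  let ?S = "S \<inter> \<psi> -` W"
  have S': "open ?S" "p \<in> ?S" using S W vimage_open by auto
  have sE: "open (\<psi> -` W)" "p \<in> \<psi> -` W" "sect (\<psi> -` W) (\<lambda>q. E (\<psi> q))"
    using E W vimage_open pullback_section by auto
  have Xq: "X q \<in> T\<^sub>A q" and Yq: "Y q \<in> T\<^sub>A q" if "q \<in> S" for q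
    using vector_field_on_tangent X Y that by blast+
  note Xp = Xq[OF S(2)] and Yp = Yq[OF S(2)]
  note L = A.lie_bracket_tangent[OF S X Y]
  have dX: "sect S (\<lambda>q. d\<psi> q (X q))" and dY: "sect S (\<lambda>q. d\<psi> q (Y q))"
    using differential_section S(1) X Y by blast+
  have D2: "D p v (\<lambda>q. D q (Y q) (\<lambda>q. E (\<psi> q))) = D p v (\<lambda>q. nab (\<psi> q) (d\<psi> q (Y q)) E)"
    if v: "v \<in> T\<^sub>A p" and Y: "vector_field_on \<A> S Y" for v Y
  proof (rule D_cong[OF S' _ _ v])
    show "sect ?S (\<lambda>q. D q (Y q) (\<lambda>q. E (\<psi> q)))"
      by (rule D_section[OF S'(1) vector_field_on_subset[OF Y] section_on_subset[OF sE(3)]]) auto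
    show "D q (Y q) (\<lambda>q. E (\<psi> q)) = nab (\<psi> q) (d\<psi> q (Y q)) E" if "q \<in> ?S" for q
      using D_pullback[OF W(1) E(1)] vector_field_on_tangent[OF Y] that by simp
  qed
  note T = D_tangent[OF S dY Xp] D_tangent[OF S dX Yp]
    N.D_tangent[OF W G(1)[unfolded vector_field_on_def] differential_tangent[OF Xp]]
    N.D_tangent[OF W F(1)[unfolded vector_field_on_def] differential_tangent[OF Yp]]
  have diff: "nab (\<psi> p) (u - w) E = nab (\<psi> p) u E - nab (\<psi> p) w E" if "u \<in> T\<^sub>B p" "w \<in> T\<^sub>B p" for u w
    using N.D_add_dir[OF W E(1)[unfolded vector_field_on_def] that(1) tangent_minus[OF that(2)]]
      N.D_scale_dir[OF W E(1)[unfolded vector_field_on_def] that(2), of "-1"] by simp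
  have "D p (X p) (\<lambda>q. D q (Y q) Z) - D p (Y p) (\<lambda>q. D q (X q) Z) - D p (lie_bracket \<A> X Y p) Z =
    D p (X p) (\<lambda>q. D q (Y q) (\<lambda>q. E (\<psi> q))) - D p (Y p) (\<lambda>q. D q (X q) (\<lambda>q. E (\<psi> q)))
     - D p (lie_bracket \<A> X Y p) (\<lambda>q. E (\<psi> q))"
    by (rule D_curvature_tensorial[OF S X Y S Z sE]) (simp add: E(2))
  also have "\<dots> = D p (X p) (\<lambda>q. nab (\<psi> q) (d\<psi> q (Y q)) E) - D p (Y p) (\<lambda>q. nab (\<psi> q) (d\<psi> q (X q)) E)
     - nab (\<psi> p) (D p (X p) (\<lambda>q. d\<psi> q (Y q)) - D p (Y p) (\<lambda>q. d\<psi> q (X q))) E"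
    by (simp only: D2[OF Xp Y] D2[OF Yp X] D_pullback[OF W(1) E(1) W(2) L] D_torsion[OF S X Y])
  also have "\<dots> = (nab (\<psi> p) (d\<psi> p (X p)) (\<lambda>r. nab r (G r) E) - nab (\<psi> p) (d\<psi> p (Y p)) (\<lambda>r. nab r (F r) E))
     - nab (\<psi> p) (nab (\<psi> p) (d\<psi> p (X p)) G - nab (\<psi> p) (d\<psi> p (Y p)) F) E"
    unfolding diff[OF T(1,2)] diff[OF T(3,4)]
    by (rule diff_diff_cong[OF D_nab[OF W E(1) Xp S dY G] D_nab[OF W E(1) Yp S dX F]])
  also have "\<dots> = curvature \<B> nab F G E (\<psi> p)"
    using nab_torsion[OF W(1) F(1) G(1) W(2)] unfolding curvature_def by (simp add: F(2) G(2))
  finally show ?thesis .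
qed

end

section \<open>Orthonormal bases and the pointwise curvature tensor\<close>

context tensor_field
begin

text \<open>The tangent space embeds into the model space, so an orthonormal system of that length spans it.\<close>

lemma orthonormal_expansion:
  assumes b: "orthonormal_basis_at \<A> g p b" and w: "w \<in> tangent_space \<A> p"
  shows "w = (\<Sum>i<DIM('e). g p w (b i) *\<^sub>R b i)"
proof -
  let ?n = "DIM('e)" and ?T = "tangent_space \<A> p"
  have bT: "b i \<in> ?T" if "i < ?n" for i using b that unfolding orthonormal_basis_at_def by blast
  have bb: "g p (b i) (b j) = (if i = j then 1 else 0)" if "i < ?n" "j < ?n" for i j
    using b that unfolding orthonormal_basis_at_def by blast
  obtain \<kappa> :: "'a tvec \<Rightarrow> 'e" where \<kappa>: "linear \<kappa>" "inj_on \<kappa> ?T" by (rule coordinate_embedding)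
  have coeff: "c j = g p v (b j)" if "j < ?n" "v = (\<Sum>i<?n. c i *\<^sub>R b i)" for c :: "nat \<Rightarrow> real" and j v
  proof -
    have "g p v (b j) = (\<Sum>i<?n. g p (c i *\<^sub>R b i) (b j))"
      unfolding that(2) by (rule tensor_sum_left) (auto intro: tangent_scale bT that)
    also have "\<dots> = (\<Sum>i<?n. c i * (if i = j then 1 else 0))"
      by (rule sum.cong) (auto simp: tensor_scale_left bT bb that)
    also have "\<dots> = c j" using that(1) by (simp add: if_distrib[of "(*) _"] cong: if_cong)
    finally show ?thesis ..
  qed
  define k where "k i = \<kappa> (b i)" for i
  have inj: "inj_on k {..<?n}"
  proof (rule inj_onI)
    fix i j assume ij: "i \<in> {..<?n}" "j \<in> {..<?n}" "k i = k j"
    then have "b i = b j" using inj_onD[OF \<kappa>(2)] bT by (auto simp: k_def)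
    then show "i = j" using bb[of i j] bb[of j j] ij by (auto split: if_splits)
  qed
  have "independent (k ` {..<?n})"
  proof (rule independent_if_scalars_zero)
    fix u x assume s: "(\<Sum>x\<in>k ` {..<?n}. u x *\<^sub>R x) = 0" and x: "x \<in> k ` {..<?n}"
    have "\<kappa> (\<Sum>i<?n. u (k i) *\<^sub>R b i) = (\<Sum>i<?n. u (k i) *\<^sub>R k i)"
      by (simp add: linear_sum[OF \<kappa>(1)] linear_scale[OF \<kappa>(1)] k_def)
    also have "\<dots> = \<kappa> 0" using s by (simp add: sum.reindex[OF inj] linear_0[OF \<kappa>(1)])
    finally have *: "(\<Sum>i<?n. u (k i) *\<^sub>R b i) = 0"
      by (rule inj_onD[OF \<kappa>(2)]) (auto intro!: tangent_sum tangent_scale bT tangent_zero)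
    obtain j where j: "j < ?n" "x = k j" using x by blast
    show "u x = 0" using coeff[OF j(1) *[symmetric]] tensor_zero_left[OF bT[OF j(1)]] j(2) by simp
  qed simp
  \<comment> \<open>As many independent vectors as the dimension of the model space span it, so the
    image of w is a combination of the k i; injectivity of \<open>\<kappa>\<close> brings the
    combination back to the tangent space.\<close>
  then have "UNIV \<subseteq> span (k ` {..<?n})"
    by (rule card_ge_dim_independent[OF subset_UNIV]) (simp add: card_image[OF inj])
  then have "\<kappa> w \<in> range (\<lambda>u. \<Sum>x\<in>k ` {..<?n}. u x *\<^sub>R x)"
    unfolding span_finite[OF finite_imageI[OF finite_lessThan]] by (rule subsetD) simp
  then obtain u where u: "\<kappa> w = (\<Sum>x\<in>k ` {..<?n}. u x *\<^sub>R x)" by (rule imageE)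
  then have "\<kappa> w = \<kappa> (\<Sum>i<?n. u (k i) *\<^sub>R b i)"
    by (simp add: u sum.reindex[OF inj] linear_sum[OF \<kappa>(1)] linear_scale[OF \<kappa>(1)] k_def[symmetric])
  then have wu: "w = (\<Sum>i<?n. u (k i) *\<^sub>R b i)"
    by (rule inj_onD[OF \<kappa>(2) _ w]) (auto intro!: tangent_sum tangent_scale bT)
  also have "\<dots> = (\<Sum>i<?n. g p w (b i) *\<^sub>R b i)"
    by (rule sum.cong) (auto simp: coeff[OF _ wu])
  finally show ?thesis .
qed

lemma Parseval:
  assumes b: "orthonormal_basis_at \<A> g p b" and u: "u \<in> tangent_space \<A> p" and w: "w \<in> tangent_space \<A> p"
  shows "g p u w = (\<Sum>i<DIM('e). g p u (b i) * g p w (b i))"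
proof -
  have bT: "b i \<in> tangent_space \<A> p" if "i < DIM('e)" for i using b that unfolding orthonormal_basis_at_def by blast
  have "g p u w = g p u (\<Sum>i<DIM('e). g p w (b i) *\<^sub>R b i)" using orthonormal_expansion[OF b w] by simp
  also have "\<dots> = (\<Sum>i<DIM('e). g p u (g p w (b i) *\<^sub>R b i))"
    by (rule tensor_sum_right) (auto intro: tangent_scale bT u)
  also have "\<dots> = (\<Sum>i<DIM('e). g p u (b i) * g p w (b i))"
    by (rule sum.cong) (auto simp: tensor_scale_right bT u)
  finally show ?thesis .
qed

end

text \<open>\<open>curvature_at\<close> is a definite description. Its uniqueness half needs one
  triple of fields through u, v, w on a common domain, and tangency of the three vectors supplies
  it.\<close>

lemma (in smooth_manifold) curvature_at_eqI:
  assumes "\<And>S X Y Z. open S \<Longrightarrow> p \<in> S \<Longrightarrow> vector_field_on \<A> S X \<Longrightarrow> vector_field_on \<A> S Y \<Longrightarrow>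
      vector_field_on \<A> S Z \<Longrightarrow> X p = u \<Longrightarrow> Y p = v \<Longrightarrow> Z p = w \<Longrightarrow> curvature \<A> nab X Y Z p = r"
    and "u \<in> tangent_space \<A> p" "v \<in> tangent_space \<A> p" "w \<in> tangent_space \<A> p"
  shows "curvature_at \<A> nab p u v w = r"
  unfolding curvature_at_def
proof (rule the_equality)
  show "\<forall>S X Y Z. open S \<longrightarrow> p \<in> S \<longrightarrow> vector_field_on \<A> S X \<longrightarrow> vector_field_on \<A> S Y \<longrightarrow>
      vector_field_on \<A> S Z \<longrightarrow> X p = u \<longrightarrow> Y p = v \<longrightarrow> Z p = w \<longrightarrow> r = curvature \<A> nab X Y Z p"
    using assms(1) by simp
  fix s
  assume s: "\<forall>S X Y Z. open S \<longrightarrow> p \<in> S \<longrightarrow> vector_field_on \<A> S X \<longrightarrow> vector_field_on \<A> S Y \<longrightarrow>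
      vector_field_on \<A> S Z \<longrightarrow> X p = u \<longrightarrow> Y p = v \<longrightarrow> Z p = w \<longrightarrow> s = curvature \<A> nab X Y Z p"
  obtain S1 X where X: "open S1" "p \<in> S1" "vector_field_on \<A> S1 X" "X p = u"
    by (rule tangent_vector_extension[OF assms(2)])
  obtain S2 Y where Y: "open S2" "p \<in> S2" "vector_field_on \<A> S2 Y" "Y p = v"
    by (rule tangent_vector_extension[OF assms(3)])
  obtain S3 Z where Z: "open S3" "p \<in> S3" "vector_field_on \<A> S3 Z" "Z p = w"
    by (rule tangent_vector_extension[OF assms(4)])
  have S: "open (S1 \<inter> S2 \<inter> S3)" "p \<in> S1 \<inter> S2 \<inter> S3" "vector_field_on \<A> (S1 \<inter> S2 \<inter> S3) X"
    "vector_field_on \<A> (S1 \<inter> S2 \<inter> S3) Y" "vector_field_on \<A> (S1 \<inter> S2 \<inter> S3) Z"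
    using X Y Z by (auto intro: vector_field_on_subset)
  show "s = r" using s[rule_format, OF S X(4) Y(4) Z(4)] assms(1)[OF S X(4) Y(4) Z(4)] by simp
qed

text \<open>The uniqueness of the Levi-Civita connection in algebraic form: \<open>K x y z\<close> is the \<open>z\<close>-component of the
  difference of two connections.\<close>

lemma braid:
  fixes K :: "'i \<Rightarrow> 'i \<Rightarrow> 'i \<Rightarrow> real"
  assumes "\<And>x y z. P x \<Longrightarrow> P y \<Longrightarrow> P z \<Longrightarrow> K x y z = K y x z"
    and "\<And>x y z. P x \<Longrightarrow> P y \<Longrightarrow> P z \<Longrightarrow> K x y z = - K x z y"
    and "P x" "P y" "P z"
  shows "K x y z = 0"
  using assms(1)[OF assms(3,4,5)] assms(1)[OF assms(5,3,4)] assms(1)[OF assms(4,5,3)]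
    assms(2)[OF assms(3,4,5)] assms(2)[OF assms(4,3,5)] assms(2)[OF assms(5,3,4)] by linarith


section \<open>Sasakian space forms\<close>

locale sasakian_form =
  fixes \<B> :: "('b::{t2_space, second_countable_topology}, 'e::euclidean_space) atlas"
    and \<phi> \<xi> \<eta> g nab c
  assumes space_form: "sasakian_space_form \<B> \<phi> \<xi> \<eta> g nab c"
begin

lemmas sasakian = space_form[unfolded sasakian_space_form_def, THEN conjunct1, unfolded sasakian_def]

lemmas riemannian = sasakian[THEN conjunct2, THEN conjunct2, THEN conjunct1]
lemmas levi_civita = sasakian[THEN conjunct2, THEN conjunct2, THEN conjunct2, THEN conjunct1]
lemmas xi_field = sasakian[THEN conjunct2, THEN conjunct2, THEN conjunct2, THEN conjunct2, THEN conjunct1]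

sublocale tensor_field \<B> g
proof
  show "smooth_atlas \<B>" by (rule sasakian[THEN conjunct1])
  show "symmetric_tensor \<B> g" by (rule riemannian[unfolded riemannian_metric_def, THEN conjunct1])
qed

sublocale connection \<B> \<B> "\<lambda>p. p" nab
proof -
  interpret I: smooth_mapping \<B> \<B> "\<lambda>p. p" by (rule smooth_mapping_id)
  show "connection \<B> \<B> (\<lambda>p. p) nab"
    by unfold_locales (rule levi_civita[unfolded levi_civita_def, THEN conjunct1])
qed

lemma metric_pos: "v \<in> tangent_space \<B> p \<Longrightarrow> v \<noteq> 0 \<Longrightarrow> g p v v > 0"
  by (rule riemannian[unfolded riemannian_metric_def, THEN conjunct2, rule_format])

lemma metric_nonneg: "v \<in> tangent_space \<B> p \<Longrightarrow> g p v v \<ge> 0"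
  using metric_pos[of v p] tensor_zero_left[of v p] by (cases "v = 0") auto

lemma phi_field: "open S \<Longrightarrow> vector_field_on \<B> S X \<Longrightarrow> vector_field_on \<B> S (\<lambda>p. \<phi> p (X p))"
  by (rule sasakian[THEN conjunct2, THEN conjunct2, THEN conjunct2, THEN conjunct2, THEN conjunct2, THEN conjunct1, rule_format])

lemma xi_tangent: "\<xi> p \<in> tangent_space \<B> p"
  by (rule vector_field_on_tangent[OF xi_field UNIV_I])

context
  fixes p :: 'b
begin

lemmas pointwise = sasakian[THEN conjunct2, THEN conjunct2, THEN conjunct2, THEN conjunct2, THEN conjunct2,
    THEN conjunct2, THEN conjunct1, rule_format]

lemma phi_tangent: "v \<in> tangent_space \<B> p \<Longrightarrow> \<phi> p v \<in> tangent_space \<B> p"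
  using pointwise[of v p v 0] by blast

lemma phi_add: "v \<in> tangent_space \<B> p \<Longrightarrow> w \<in> tangent_space \<B> p \<Longrightarrow> \<phi> p (v + w) = \<phi> p v + \<phi> p w"
  using pointwise[of v p w 0] by blast

lemma phi_scale: "v \<in> tangent_space \<B> p \<Longrightarrow> \<phi> p (r *\<^sub>R v) = r *\<^sub>R \<phi> p v"
  using pointwise[of v p v r] by blast

lemma phi_phi: "v \<in> tangent_space \<B> p \<Longrightarrow> \<phi> p (\<phi> p v) = - v + \<eta> p v *\<^sub>R \<xi> p"
  using pointwise[of v p v 0] by blast

lemma eta_def: "v \<in> tangent_space \<B> p \<Longrightarrow> \<eta> p v = g p (\<xi> p) v"
  using pointwise[of v p v 0] by blast

lemma metric_phi_phi:
  "v \<in> tangent_space \<B> p \<Longrightarrow> w \<in> tangent_space \<B> p \<Longrightarrow> g p (\<phi> p v) (\<phi> p w) = g p v w - \<eta> p v * \<eta> p w"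
  using pointwise[of v p w 0] by blast

lemma eta_xi: "\<eta> p (\<xi> p) = 1"
  by (rule sasakian[THEN conjunct2, THEN conjunct2, THEN conjunct2, THEN conjunct2, THEN conjunct2,
    THEN conjunct2, THEN conjunct2, THEN conjunct1, rule_format, THEN conjunct1])

lemma phi_xi: "\<phi> p (\<xi> p) = 0"
  by (rule sasakian[THEN conjunct2, THEN conjunct2, THEN conjunct2, THEN conjunct2, THEN conjunct2,
    THEN conjunct2, THEN conjunct2, THEN conjunct1, rule_format, THEN conjunct2])

lemma phi_minus: "v \<in> tangent_space \<B> p \<Longrightarrow> \<phi> p (- v) = - \<phi> p v"
  using phi_scale[of v "-1"] by simp

lemma phi_diff: "v \<in> tangent_space \<B> p \<Longrightarrow> w \<in> tangent_space \<B> p \<Longrightarrow> \<phi> p (v - w) = \<phi> p v - \<phi> p w"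
  using phi_add[of v "- w"] phi_minus[of w] tangent_minus[of w \<B> p] by simp

lemma eta_add: "v \<in> tangent_space \<B> p \<Longrightarrow> w \<in> tangent_space \<B> p \<Longrightarrow> \<eta> p (v + w) = \<eta> p v + \<eta> p w"
  by (simp add: eta_def tensor_simps tangent_closure xi_tangent)

lemma eta_scale: "v \<in> tangent_space \<B> p \<Longrightarrow> \<eta> p (r *\<^sub>R v) = r * \<eta> p v"
  by (simp add: eta_def tensor_simps tangent_closure xi_tangent)

lemma eta_minus: "v \<in> tangent_space \<B> p \<Longrightarrow> \<eta> p (- v) = - \<eta> p v"
  by (simp add: eta_def tensor_simps tangent_closure xi_tangent)

lemma eta_diff: "v \<in> tangent_space \<B> p \<Longrightarrow> w \<in> tangent_space \<B> p \<Longrightarrow> \<eta> p (v - w) = \<eta> p v - \<eta> p w"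
  by (simp add: eta_def tensor_simps tangent_closure xi_tangent)

lemma metric_xi: "v \<in> tangent_space \<B> p \<Longrightarrow> g p (\<xi> p) v = \<eta> p v" "v \<in> tangent_space \<B> p \<Longrightarrow> g p v (\<xi> p) = \<eta> p v"
  using eta_def tensor_sym[OF _ xi_tangent] by auto

text \<open>Evaluating the third power of \<phi> at v in its two bracketings leaves \<eta>(\<phi> v)
  \<xi> = 0.\<close>

lemma eta_phi: assumes v: "v \<in> tangent_space \<B> p" shows "\<eta> p (\<phi> p v) = 0"
proof -
  have "- \<phi> p v + \<eta> p (\<phi> p v) *\<^sub>R \<xi> p = \<phi> p (\<phi> p (\<phi> p v))" using phi_phi[OF phi_tangent[OF v]] by simp
  also have "\<dots> = - \<phi> p v"
    by (simp add: phi_phi[OF v] phi_diff phi_scale phi_xi v tangent_closure xi_tangent)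
  finally have "\<eta> p (\<phi> p v) *\<^sub>R \<xi> p = 0 *\<^sub>R \<xi> p" by (simp del: scaleR_eq_0_iff)
  then have "\<eta> p (\<eta> p (\<phi> p v) *\<^sub>R \<xi> p) = \<eta> p (0 *\<^sub>R \<xi> p)" by (rule arg_cong)
  then show ?thesis by (simp only: eta_scale[OF xi_tangent] eta_xi)
qed

text \<open>Metric compatibility applied to the pair \<phi> v, w, with the square of \<phi>
  resolved.\<close>

lemma phi_skew: assumes v: "v \<in> tangent_space \<B> p" and w: "w \<in> tangent_space \<B> p"
  shows "g p (\<phi> p v) w = - g p v (\<phi> p w)"
  using metric_phi_phi[OF phi_tangent[OF v] w]
  by (simp add: phi_phi[OF v] eta_phi v w tensor_simps tangent_closure xi_tangent phi_tangent metric_xi)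

lemma phi_self: "v \<in> tangent_space \<B> p \<Longrightarrow> g p (\<phi> p v) v = 0" "v \<in> tangent_space \<B> p \<Longrightarrow> g p v (\<phi> p v) = 0"
  using phi_skew[of v v] tensor_sym[OF _ phi_tangent, of v v] by auto

end

lemmas structure_simps = phi_add phi_scale phi_minus phi_diff phi_xi eta_add eta_scale eta_minus eta_diff eta_xi
  eta_phi metric_xi phi_tangent xi_tangent tangent_closure

end

context sasakian_form
begin

lemmas derivative_rules = sasakian[THEN conjunct2, THEN conjunct2, THEN conjunct2, THEN conjunct2, THEN conjunct2,
    THEN conjunct2, THEN conjunct2, THEN conjunct2, rule_format, THEN conjunct2]

lemma nab_torsion:
  "open S \<Longrightarrow> vector_field_on \<B> S X \<Longrightarrow> vector_field_on \<B> S Y \<Longrightarrow> p \<in> S \<Longrightarrow>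
    nab p (X p) Y - nab p (Y p) X = lie_bracket \<B> X Y p"
  by (rule levi_civita[unfolded levi_civita_def, THEN conjunct2, THEN conjunct1, rule_format])

lemma nab_metric:
  "open S \<Longrightarrow> vector_field_on \<B> S Y \<Longrightarrow> vector_field_on \<B> S Z \<Longrightarrow> p \<in> S \<Longrightarrow> v \<in> tangent_space \<B> p \<Longrightarrow>
    v (\<lambda>q. g q (Y q) (Z q)) = g p (nab p v Y) (Z p) + g p (Y p) (nab p v Z)"
  by (rule levi_civita[unfolded levi_civita_def, THEN conjunct2, THEN conjunct2, rule_format])

lemma nab_phi:
  assumes S: "open S" "p \<in> S" and Y: "vector_field_on \<B> S Y" and v: "v \<in> tangent_space \<B> p"
  shows "nab p v (\<lambda>q. \<phi> q (Y q)) = \<phi> p (nab p v Y) + g p v (Y p) *\<^sub>R \<xi> p - \<eta> p (Y p) *\<^sub>R v"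
proof -
  obtain T X where T: "open T" "p \<in> T" "vector_field_on \<B> T X" "X p = v"
    by (rule tangent_vector_extension[OF v])
  have ST: "open (S \<inter> T)" "vector_field_on \<B> (S \<inter> T) X" "vector_field_on \<B> (S \<inter> T) Y" "p \<in> S \<inter> T"
    using S T Y by (auto intro: vector_field_on_subset)
  from derivative_rules[OF ST, THEN conjunct1] T(4) show ?thesis by (simp add: algebra_simps)
qed

lemma nab_xi:
  assumes v: "v \<in> tangent_space \<B> p"
  shows "nab p v \<xi> = - \<phi> p v"
proof -
  obtain T X where T: "open T" "p \<in> T" "vector_field_on \<B> T X" "X p = v"
    by (rule tangent_vector_extension[OF v])
  from derivative_rules[OF T(1,3,3,2), THEN conjunct2] T(4) show ?thesis by simp
qed

lemma eta_derivative:
  assumes S: "open S" "p \<in> S" and Y: "vector_field_on \<B> S Y" and v: "v \<in> tangent_space \<B> p"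
  shows "v (\<lambda>q. \<eta> q (Y q)) = \<eta> p (nab p v Y) - g p (\<phi> p v) (Y p)"
proof -
  have Yp: "Y p \<in> tangent_space \<B> p" "nab p v Y \<in> tangent_space \<B> p"
    using vector_field_on_tangent[OF Y S(2)] D_tangent[OF S Y[unfolded vector_field_on_def] v] .
  have "v (\<lambda>q. \<eta> q (Y q)) = v (\<lambda>q. g q (\<xi> q) (Y q))"
    by (rule tangent_vector_cong[OF v S]) (rule eta_def[OF vector_field_on_tangent[OF Y]])
  also have "\<dots> = g p (nab p v \<xi>) (Y p) + g p (\<xi> p) (nab p v Y)"
    by (rule nab_metric[OF S(1) vector_field_on_subset[OF xi_field] Y S(2) v]) simp
  finally show ?thesis
    by (simp add: nab_xi[OF v] metric_xi tensor_minus_left phi_tangent v Yp)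
qed

lemma eta_smooth: "open S \<Longrightarrow> vector_field_on \<B> S Y \<Longrightarrow> smooth_fun_on \<B> S (\<lambda>q. \<eta> q (Y q))"
  by (rule smooth_fun_on_cong[OF _ _ tensor_smooth[OF _ vector_field_on_subset[OF xi_field]]])
    (auto simp: eta_def vector_field_on_tangent)

definition curv :: "'b \<Rightarrow> 'b tvec \<Rightarrow> 'b tvec \<Rightarrow> 'b tvec \<Rightarrow> 'b tvec" where
  "curv p u v w =
    - ((c - 1) / 4) *\<^sub>R
      (\<eta> p w *\<^sub>R (\<eta> p v *\<^sub>R u - \<eta> p u *\<^sub>R v)
       + (g p v w * \<eta> p u - g p u w * \<eta> p v) *\<^sub>R \<xi> p
       + g p (\<phi> p u) w *\<^sub>R \<phi> p v
       + (2 * g p (\<phi> p u) v) *\<^sub>R \<phi> p w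
       - g p (\<phi> p v) w *\<^sub>R \<phi> p u)
    + ((c + 3) / 4) *\<^sub>R (g p v w *\<^sub>R u - g p u w *\<^sub>R v)"

lemma curvature_eq:
  "open S \<Longrightarrow> vector_field_on \<B> S X \<Longrightarrow> vector_field_on \<B> S Y \<Longrightarrow> vector_field_on \<B> S Z \<Longrightarrow> p \<in> S \<Longrightarrow>
    curvature \<B> nab X Y Z p = curv p (X p) (Y p) (Z p)"
  unfolding curv_def by (rule space_form[unfolded sasakian_space_form_def, THEN conjunct2, rule_format])

lemma curvature_at_eq:
  assumes "u \<in> tangent_space \<B> p" "v \<in> tangent_space \<B> p" "w \<in> tangent_space \<B> p"
  shows "curvature_at \<B> nab p u v w = curv p u v w"
  by (rule curvature_at_eqI[OF _ assms]) (auto simp: curvature_eq)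

lemma curv_inner:
  assumes "u \<in> tangent_space \<B> p" "v \<in> tangent_space \<B> p" "w \<in> tangent_space \<B> p" "z \<in> tangent_space \<B> p"
  shows "g p (curv p u v w) z =
    - ((c - 1) / 4) * (\<eta> p w * (\<eta> p v * g p u z - \<eta> p u * g p v z)
      + (g p v w * \<eta> p u - g p u w * \<eta> p v) * \<eta> p z
      + g p (\<phi> p u) w * g p (\<phi> p v) z + 2 * g p (\<phi> p u) v * g p (\<phi> p w) z - g p (\<phi> p v) w * g p (\<phi> p u) z)
    + (c + 3) / 4 * (g p v w * g p u z - g p u w * g p v z)"
  unfolding curv_def
  by (simp add: tensor_left structure_simps assms)

text \<open>Each term of the traced curvature is constant in i or a product of two inner products
  with b i, which Parseval sums. With dimension 2 m + 1 the coefficients of g and of \<eta> times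
  \<eta> come out as k2 and k1.\<close>

lemma ricci_eq:
  assumes Ric: "ricci_tensor \<B> g nab Ric" and dim: "DIM('e) = 2 * m + 1"
    and v: "v \<in> tangent_space \<B> p" and w: "w \<in> tangent_space \<B> p"
  shows "Ric p v w = k2 m c * g p v w + k1 m c * \<eta> p v * \<eta> p w"
proof -
  obtain b where b: "orthonormal_basis_at \<B> g p b"
    and R': "\<forall>v\<in>tangent_space \<B> p. \<forall>w\<in>tangent_space \<B> p.
      Ric p v w = (\<Sum>i<DIM('e). g p (curvature_at \<B> nab p (b i) v w) (b i))"
    using Ric[unfolded ricci_tensor_def, THEN spec, of p] by (elim exE conjE)
  note R = R'[rule_format, OF v w]
  let ?I = "{..<DIM('e)}"
  have bT: "b i \<in> tangent_space \<B> p" if "i \<in> ?I" for i using b that unfolding orthonormal_basis_at_def by blast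
  have bb: "g p (b i) (b i) = 1" if "i \<in> ?I" for i using b that unfolding orthonormal_basis_at_def by auto
  have P: "(\<Sum>i\<in>?I. g p x (b i) * g p y (b i)) = g p x y"
    if "x \<in> tangent_space \<B> p" "y \<in> tangent_space \<B> p" for x y using Parseval[OF b that] by simp
  have "Ric p v w = (\<Sum>i\<in>?I. - ((c - 1) / 4) * (\<eta> p w * \<eta> p v - \<eta> p w * (g p (\<xi> p) (b i) * g p v (b i))
      + g p v w * (g p (\<xi> p) (b i) * g p (\<xi> p) (b i)) - \<eta> p v * (g p w (b i) * g p (\<xi> p) (b i))
      - g p (\<phi> p w) (b i) * g p (\<phi> p v) (b i) - 2 * (g p (\<phi> p v) (b i) * g p (\<phi> p w) (b i)))
    + (c + 3) / 4 * (g p v w - g p w (b i) * g p v (b i)))"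
    unfolding R
  proof (rule sum.cong)
    fix i assume i: "i \<in> ?I"
    note bi = bT[OF i]
    have "g p (\<phi> p (b i)) w = - g p (\<phi> p w) (b i)" "g p (\<phi> p (b i)) v = - g p (\<phi> p v) (b i)" "g p (b i) w = g p w (b i)"
      using phi_skew[OF bi w] phi_skew[OF bi v] tensor_sym[OF bi phi_tangent[OF w]] tensor_sym[OF bi phi_tangent[OF v]]
        tensor_sym[OF bi w] by auto
    then show "g p (curvature_at \<B> nab p (b i) v w) (b i) = - ((c - 1) / 4) * (\<eta> p w * \<eta> p v - \<eta> p w * (g p (\<xi> p) (b i) * g p v (b i))
      + g p v w * (g p (\<xi> p) (b i) * g p (\<xi> p) (b i)) - \<eta> p v * (g p w (b i) * g p (\<xi> p) (b i))
      - g p (\<phi> p w) (b i) * g p (\<phi> p v) (b i) - 2 * (g p (\<phi> p v) (b i) * g p (\<phi> p w) (b i)))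
    + (c + 3) / 4 * (g p v w - g p w (b i) * g p v (b i))"
      by (simp add: curvature_at_eq[OF bi v w] curv_inner[OF bi v w bi] bb[OF i] phi_self[OF bi] metric_xi[OF bi])
        (simp add: algebra_simps)
  qed simp
  also have "\<dots> = - ((c - 1) / 4) * (real DIM('e) * (\<eta> p w * \<eta> p v) - \<eta> p w * g p (\<xi> p) v
      + g p v w * g p (\<xi> p) (\<xi> p) - \<eta> p v * g p w (\<xi> p)
      - g p (\<phi> p w) (\<phi> p v) - 2 * g p (\<phi> p v) (\<phi> p w))
    + (c + 3) / 4 * (real DIM('e) * g p v w - g p w v)"
    by (simp only: sum.distrib sum_subtractf sum_distrib_left[symmetric] P v w xi_tangent phi_tangent
        sum_constant card_lessThan of_nat_mult mult.left_commute[of "real DIM('e)"])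
  also have "\<dots> = k2 m c * g p v w + k1 m c * \<eta> p v * \<eta> p w"
    using tensor_sym[OF w v]
    by (simp add: dim metric_xi v w xi_tangent eta_xi metric_phi_phi k1_def k2_def field_simps)
  finally show ?thesis .
qed

text \<open>For k2 = 0 the tensor \<open>Ric\<close> would be a multiple of \<eta> times \<eta>,
  whose radical contains the kernel of \<eta>. In dimension at least 3 that kernel is nonzero,
  against nondegeneracy.\<close>

lemma k2_nonzero:
  assumes Ric: "ricci_tensor \<B> g nab Ric" and dim: "DIM('e) = 2 * m + 1" and m: "m \<ge> 1"
    and nondeg: "pseudo_riemannian_metric \<B> Ric"
  shows "k2 m c \<noteq> 0"
proof
  assume k2: "k2 m c = 0"
  fix p :: 'b
  obtain b where b: "orthonormal_basis_at \<B> g p b"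
    using Ric[unfolded ricci_tensor_def, THEN spec, of p] by (elim exE conjE)
  have b01: "b 0 \<in> tangent_space \<B> p" "b 1 \<in> tangent_space \<B> p" "g p (b 0) (b 0) = 1" "g p (b 1) (b 1) = 1"
    "g p (b 0) (b 1) = 0" "g p (b 1) (b 0) = 0"
    using b m unfolding orthonormal_basis_at_def dim by auto
  have zero: "u = 0" if u: "u \<in> tangent_space \<B> p" and "\<eta> p u = 0" for u
    using nondeg u ricci_eq[OF Ric dim u] k2 that(2) unfolding pseudo_riemannian_metric_def by simp
  \<comment> \<open>This combination lies in the kernel of \<eta> by construction. Its vanishing
    forces \<eta> (b 0) = 0, so the unit vector b 0 lies in the kernel as well.\<close>
  let ?u = "\<eta> p (b 1) *\<^sub>R b 0 - \<eta> p (b 0) *\<^sub>R b 1"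
  have "?u = 0" by (rule zero) (simp_all add: structure_simps b01 del: One_nat_def)
  then have "g p ?u (b 1) = 0" using tensor_zero_left[OF b01(2)] by simp
  then have "\<eta> p (b 0) = 0" by (simp add: tensor_simps tangent_closure b01 del: One_nat_def)
  then have "b 0 = 0" by (rule zero[OF b01(1)])
  then show False using b01(3) tensor_zero_left[OF b01(1)] by simp
qed

end

section \<open>The Levi-Civita connection of \<open>Ric\<close> and its curvature\<close>

locale ricci_form = sasakian_form \<B> \<phi> \<xi> \<eta> g nab c
  for \<B> :: "('b::{t2_space, second_countable_topology}, 'e::euclidean_space) atlas"
    and \<phi> \<xi> \<eta> g nab c +
  fixes Ric and nabs and m :: nat
  assumes ricci: "ricci_tensor \<B> g nab Ric" and dim: "DIM('e) = 2 * m + 1" and m: "m \<ge> 1"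
    and nondegenerate: "pseudo_riemannian_metric \<B> Ric" and star_levi_civita: "levi_civita \<B> Ric nabs"
begin

sublocale R: tensor_field \<B> Ric
  by unfold_locales (rule nondegenerate[unfolded pseudo_riemannian_metric_def, THEN conjunct1])

sublocale S: connection \<B> \<B> "\<lambda>p. p" nabs
  by unfold_locales (rule star_levi_civita[unfolded levi_civita_def, THEN conjunct1])

text \<open>Since k1 + k2 = 2 m, the number 1 + a equals 2 m / k2, the parameter s of the final
  estimate.\<close>

definition a :: real where "a = k1 m c / k2 m c"

lemmas k2 = k2_nonzero[OF ricci dim m nondegenerate]
lemmas Ric_eq = ricci_eq[OF ricci dim]

lemma k2_a: "k2 m c * a = k1 m c"
  using k2 by (simp add: a_def)

text \<open>The difference of the Levi-Civita connections of \<open>g\<close> and of \<open>Ric\<close>.\<close>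

definition correction :: "'b \<Rightarrow> 'b tvec \<Rightarrow> 'b tvec \<Rightarrow> 'b tvec" where
  "correction p v w = a *\<^sub>R (\<eta> p v *\<^sub>R \<phi> p w + \<eta> p w *\<^sub>R \<phi> p v)"

lemma correction_tangent:
  "v \<in> tangent_space \<B> p \<Longrightarrow> w \<in> tangent_space \<B> p \<Longrightarrow> correction p v w \<in> tangent_space \<B> p"
  by (simp add: correction_def structure_simps)

lemma correction_sym: "correction p v w = correction p w v"
  by (simp add: correction_def add.commute)

text \<open>The metric g is parallel for \<open>nab\<close>, so \<open>nab\<close> fails to preserve
  \<open>Ric\<close> only through k1 times \<eta> times \<eta>. The right-hand side is minus the
  covariant derivative of that term; subtracting \<open>correction\<close> therefore restores
  compatibility, and the factor fits because k2 a = k1.\<close>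

lemma correction_skew:
  assumes "v \<in> tangent_space \<B> p" "y \<in> tangent_space \<B> p" "z \<in> tangent_space \<B> p"
  shows "Ric p (correction p v y) z + Ric p y (correction p v z) =
    k1 m c * (\<eta> p y * g p (\<phi> p v) z + \<eta> p z * g p (\<phi> p v) y)"
proof -
  have "g p y (\<phi> p z) = - g p (\<phi> p y) z" "g p y (\<phi> p v) = g p (\<phi> p v) y"
    using phi_skew[OF assms(2,3)] tensor_sym[OF assms(2) phi_tangent[OF assms(1)]] by simp_all
  then show ?thesis
    using assms
    by (simp add: Ric_eq correction_tangent)
      (simp add: correction_def tensor_simps structure_simps k2_a[symmetric] algebra_simps)
qed

lemma field_section: "vector_field_on \<B> = section_on \<B> \<B> (\<lambda>p. p)"
  by (intro ext) (simp add: vector_field_on_def)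

context
  fixes S :: "'b set" and p :: 'b
  assumes S: "open S" "p \<in> S"
begin

lemma star_metric:
  assumes Y: "vector_field_on \<B> S Y" and Z: "vector_field_on \<B> S Z" and v: "v \<in> tangent_space \<B> p"
  shows "v (\<lambda>q. Ric q (Y q) (Z q)) =
    Ric p (nab p v Y - correction p v (Y p)) (Z p) + Ric p (Y p) (nab p v Z - correction p v (Z p))"
proof -
  note Yp = vector_field_on_tangent[OF Y S(2)] D_tangent[OF S Y[unfolded field_section] v]
  note Zp = vector_field_on_tangent[OF Z S(2)] D_tangent[OF S Z[unfolded field_section] v]
  have gs: "smooth_near \<B> p (\<lambda>q. k2 m c * g q (Y q) (Z q))"
    by (rule smooth_nearI[OF S smooth_fun_on_cmult[OF tensor_smooth[OF S(1) Y Z]]])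
  note Ys = smooth_nearI[OF S eta_smooth[OF S(1) Y]] and Zs = smooth_nearI[OF S eta_smooth[OF S(1) Z]]
  note Ys' = smooth_near_mult[OF smooth_near_const[of _ _ "k1 m c"] Ys]
  have "v (\<lambda>q. Ric q (Y q) (Z q)) = v (\<lambda>q. k2 m c * g q (Y q) (Z q) + (k1 m c * \<eta> q (Y q)) * \<eta> q (Z q))"
    by (rule tangent_vector_cong[OF v S])
      (rule Ric_eq[OF vector_field_on_tangent[OF Y] vector_field_on_tangent[OF Z]])
  also have "\<dots> = k2 m c * v (\<lambda>q. g q (Y q) (Z q)) + (k1 m c * v (\<lambda>q. \<eta> q (Y q)) * \<eta> p (Z p) + k1 m c * \<eta> p (Y p) * v (\<lambda>q. \<eta> q (Z q)))"
    by (simp only: tangent_vector_add[OF v gs smooth_near_mult[OF Ys' Zs]] tangent_vector_mult[OF v Ys' Zs]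
        tangent_vector_cmult[OF v Ys] tangent_vector_cmult[OF v smooth_nearI[OF S tensor_smooth[OF S(1) Y Z]]])
  also have "\<dots> = Ric p (nab p v Y) (Z p) + Ric p (Y p) (nab p v Z)
      - k1 m c * (g p (\<phi> p v) (Y p) * \<eta> p (Z p) + \<eta> p (Y p) * g p (\<phi> p v) (Z p))"
    by (simp add: nab_metric[OF S(1) Y Z S(2) v] eta_derivative[OF S _ v] Y Z Ric_eq Yp Zp algebra_simps)
  also have "\<dots> = Ric p (nab p v Y) (Z p) + Ric p (Y p) (nab p v Z)
      - (Ric p (correction p v (Y p)) (Z p) + Ric p (Y p) (correction p v (Z p)))"
    using correction_skew[OF v Yp(1) Zp(1)] by (simp add: algebra_simps)
  finally show ?thesis
    by (simp add: R.tensor_simps Yp Zp v correction_tangent)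
qed

text \<open>The difference between \<open>nabs\<close> and its candidate is symmetric in X and Y, as
  both have no torsion and \<open>correction\<close> is symmetric, and skew in Y and Z, as both
  preserve \<open>Ric\<close>. \<open>braid\<close> leaves only zero.\<close>

lemma star_eq_weak:
  assumes XYZ: "vector_field_on \<B> S X" "vector_field_on \<B> S Y" "vector_field_on \<B> S Z"
  shows "Ric p (nabs p (X p) Y - (nab p (X p) Y - correction p (X p) (Y p))) (Z p) = 0"
proof -
  let ?d = "\<lambda>X Y. nabs p (X p) Y - (nab p (X p) Y - correction p (X p) (Y p))"
  let ?V = "vector_field_on \<B> S"
  have T: "X p \<in> tangent_space \<B> p" "nab p (X p) Y \<in> tangent_space \<B> p" "nabs p (X p) Y \<in> tangent_space \<B> p"
    if "?V X" "?V Y" for X Y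
    using vector_field_on_tangent[OF that(1) S(2)] D_tangent[OF S that(2)[unfolded field_section]]
      S.D_tangent[OF S that(2)[unfolded field_section]] by auto
  have dT: "?d X Y \<in> tangent_space \<B> p" if "?V X" "?V Y" for X Y
    using T[OF that] T(1)[OF that(2,2)] by (simp add: correction_tangent tangent_closure)
  show ?thesis
  proof (rule braid[of ?V "\<lambda>X Y Z. Ric p (?d X Y) (Z p)", OF _ _ XYZ])
    fix X Y Z assume V: "?V X" "?V Y" "?V Z"
    have "nabs p (X p) Y - nabs p (Y p) X = nab p (X p) Y - nab p (Y p) X"
      using nab_torsion[OF S(1) V(1,2) S(2)]
        star_levi_civita[unfolded levi_civita_def, THEN conjunct2, THEN conjunct1, rule_format, OF S(1) V(1,2) S(2)] by simp
    then have "?d X Y = ?d Y X" by (simp add: correction_sym[of p "X p"] algebra_simps)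
    then show "Ric p (?d X Y) (Z p) = Ric p (?d Y X) (Z p)" by simp
    have "Ric p (nabs p (X p) Y) (Z p) + Ric p (Y p) (nabs p (X p) Z) =
        Ric p (nab p (X p) Y - correction p (X p) (Y p)) (Z p) + Ric p (Y p) (nab p (X p) Z - correction p (X p) (Z p))"
      using star_metric[OF V(2,3) T(1)[OF V(1,1)]]
        star_levi_civita[unfolded levi_civita_def, THEN conjunct2, THEN conjunct2, rule_format, OF S(1) V(2,3) S(2) T(1)[OF V(1,1)]]
      by simp
    then have "Ric p (?d X Y) (Z p) + Ric p (Y p) (?d X Z) = 0"
      using T[OF V(1,2)] T[OF V(1,3)] T(1)[OF V(2,2)] T(1)[OF V(3,3)]
      by (simp add: R.tensor_diff_left R.tensor_diff_right tangent_closure correction_tangent)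
    then show "Ric p (?d X Y) (Z p) = - Ric p (?d X Z) (Y p)"
      using R.tensor_sym[OF T(1)[OF V(2,2)] dT[OF V(1,3)]] by simp
  qed
qed

end

text \<open>\<open>Ric\<close> may be indefinite, so the vanishing of all pairings is turned into an
  equation by nondegeneracy instead of positivity.\<close>

lemma star_eq:
  assumes Y: "open S" "p \<in> S" "vector_field_on \<B> S Y" and v: "v \<in> tangent_space \<B> p"
  shows "nabs p v Y = nab p v Y - correction p v (Y p)"
proof -
  have T: "nabs p v Y - (nab p v Y - correction p v (Y p)) \<in> tangent_space \<B> p"
    by (intro tangent_diff correction_tangent v D_tangent[OF Y[unfolded field_section] v] S.D_tangent[OF Y[unfolded field_section] v]
        vector_field_on_tangent[OF Y(3,2)])
  obtain U X where X: "open U" "p \<in> U" "vector_field_on \<B> U X" "X p = v" by (rule tangent_vector_extension[OF v])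
  have "nabs p v Y - (nab p v Y - correction p v (Y p)) = 0"
  proof (rule nondegenerate[unfolded pseudo_riemannian_metric_def, THEN conjunct2, rule_format, OF T])
    fix w assume w: "w \<in> tangent_space \<B> p"
    obtain W Z where Z: "open W" "p \<in> W" "vector_field_on \<B> W Z" "Z p = w" by (rule tangent_vector_extension[OF w])
    have "open (S \<inter> U \<inter> W)" "p \<in> S \<inter> U \<inter> W" using Y X Z by auto
    moreover have "vector_field_on \<B> (S \<inter> U \<inter> W) X" "vector_field_on \<B> (S \<inter> U \<inter> W) Y" "vector_field_on \<B> (S \<inter> U \<inter> W) Z"
      using Y(3) X(3) Z(3) by (auto elim: vector_field_on_subset)
    ultimately have "Ric p (nabs p (X p) Y - (nab p (X p) Y - correction p (X p) (Y p))) (Z p) = 0"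
      by (rule star_eq_weak)
    then show "Ric p (nabs p v Y - (nab p v Y - correction p v (Y p))) w = 0" by (simp only: X(4) Z(4))
  qed
  then show ?thesis by (simp only: right_minus_eq)
qed

lemma correction_field:
  assumes "open S" "vector_field_on \<B> S Y" "vector_field_on \<B> S Z"
  shows "vector_field_on \<B> S (\<lambda>q. correction q (Y q) (Z q))"
  unfolding correction_def
  by (intro vector_field_on_cscale vector_field_on_add vector_field_on_scale eta_smooth phi_field assms)

text \<open>The last summand is the covariant derivative of the tensor \<open>correction\<close>:
  each product of \<eta> with \<phi> is differentiated factor by factor through the Sasakian
  formulas for the derivatives of \<eta> and \<phi>.\<close>

lemma nab_correction:
  assumes S: "open S" "p \<in> S" and Y: "vector_field_on \<B> S Y" and Z: "vector_field_on \<B> S Z"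
    and v: "v \<in> tangent_space \<B> p"
  shows "nab p v (\<lambda>q. correction q (Y q) (Z q)) =
    correction p (nab p v Y) (Z p) + correction p (Y p) (nab p v Z)
    + a *\<^sub>R (\<eta> p (Y p) *\<^sub>R (g p v (Z p) *\<^sub>R \<xi> p - \<eta> p (Z p) *\<^sub>R v) - g p (\<phi> p v) (Y p) *\<^sub>R \<phi> p (Z p)
      + \<eta> p (Z p) *\<^sub>R (g p v (Y p) *\<^sub>R \<xi> p - \<eta> p (Y p) *\<^sub>R v) - g p (\<phi> p v) (Z p) *\<^sub>R \<phi> p (Y p))"
proof -
  note s = eta_smooth[OF S(1)] and f = phi_field[OF S(1)]
  have 1: "nab p v (\<lambda>q. \<eta> q (Y q) *\<^sub>R \<phi> q (Z q)) = (\<eta> p (nab p v Y) - g p (\<phi> p v) (Y p)) *\<^sub>R \<phi> p (Z p)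
      + \<eta> p (Y p) *\<^sub>R (\<phi> p (nab p v Z) + g p v (Z p) *\<^sub>R \<xi> p - \<eta> p (Z p) *\<^sub>R v)"
    if "vector_field_on \<B> S Y" "vector_field_on \<B> S Z" for Y Z
    by (simp only: D_scale[OF S f[OF that(2), unfolded field_section] v s[OF that(1)]] nab_phi[OF S that(2) v] eta_derivative[OF S that(1) v])
  have "nab p v (\<lambda>q. correction q (Y q) (Z q)) =
     a *\<^sub>R nab p v (\<lambda>q. \<eta> q (Y q) *\<^sub>R \<phi> q (Z q) + \<eta> q (Z q) *\<^sub>R \<phi> q (Y q))"
    unfolding correction_def
    by (rule D_cscale[OF S _ v], fold field_section) (intro vector_field_on_add vector_field_on_scale s f Y Z)
  also have "\<dots> = a *\<^sub>R (nab p v (\<lambda>q. \<eta> q (Y q) *\<^sub>R \<phi> q (Z q)) + nab p v (\<lambda>q. \<eta> q (Z q) *\<^sub>R \<phi> q (Y q)))"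
    by (subst D_add[OF S _ v], fold field_section) (intro vector_field_on_scale s f Y Z refl)+
  finally show ?thesis by (simp add: 1 Y Z correction_def algebra_simps)
qed

lemma star_second:
  assumes S: "open S" "p \<in> S" and X: "vector_field_on \<B> S X" and Y: "vector_field_on \<B> S Y" and Z: "vector_field_on \<B> S Z"
  shows "nabs p (X p) (\<lambda>q. nabs q (Y q) Z) =
    nab p (X p) (\<lambda>q. nab q (Y q) Z) - nab p (X p) (\<lambda>q. correction q (Y q) (Z q))
    - correction p (X p) (nab p (Y p) Z) + correction p (X p) (correction p (Y p) (Z p))"
proof -
  have Xp: "X p \<in> tangent_space \<B> p" and Yp: "Y p \<in> tangent_space \<B> p" and Zp: "Z p \<in> tangent_space \<B> p"
    using X Y Z S(2) by (auto intro: vector_field_on_tangent)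
  have N: "vector_field_on \<B> S (\<lambda>q. nab q (Y q) Z)"
    using D_section[OF S(1) Y Z[unfolded field_section]] by (simp add: field_section)
  note C = correction_field[OF S(1) Y Z]
  note NC = vector_field_on_diff[OF N C]
  have "nabs p (X p) (\<lambda>q. nabs q (Y q) Z) = nabs p (X p) (\<lambda>q. nab q (Y q) Z - correction q (Y q) (Z q))"
    by (rule S.D_cong[OF S NC[unfolded field_section] _ Xp, symmetric])
      (simp add: star_eq[OF S(1) _ Z] vector_field_on_tangent[OF Y])
  also have "\<dots> = nab p (X p) (\<lambda>q. nab q (Y q) Z - correction q (Y q) (Z q))
      - correction p (X p) (nab p (Y p) Z - correction p (Y p) (Z p))"
    by (rule star_eq[OF S NC Xp])
  also have "nab p (X p) (\<lambda>q. nab q (Y q) Z - correction q (Y q) (Z q)) =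
      nab p (X p) (\<lambda>q. nab q (Y q) Z) - nab p (X p) (\<lambda>q. correction q (Y q) (Z q))"
    by (rule D_diff[OF S N[unfolded field_section] Xp C[unfolded field_section]])
  also have "correction p (X p) (nab p (Y p) Z - correction p (Y p) (Z p)) =
      correction p (X p) (nab p (Y p) Z) - correction p (X p) (correction p (Y p) (Z p))"
    using D_tangent[OF S Z[unfolded field_section] Yp] correction_tangent[OF Yp Zp]
    by (simp add: correction_def[of p "X p"] structure_simps algebra_simps)
  finally show ?thesis by (simp add: algebra_simps)
qed

text \<open>With C for \<open>correction\<close>, the terms containing derivatives of X, Y, Z cancel
  against the bracket term. What is added to \<open>curv\<close> is the antisymmetrised derivative
  of C, linear in a, and the commutator of C with itself, which gives the term with the square of
  a.\<close>

lemma star_curvature: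
  assumes S: "open S" "p \<in> S" and X: "vector_field_on \<B> S X" and Y: "vector_field_on \<B> S Y" and Z: "vector_field_on \<B> S Z"
  shows "curvature \<B> nabs X Y Z p = curv p (X p) (Y p) (Z p)
    - a *\<^sub>R (- (2 * g p (\<phi> p (X p)) (Y p)) *\<^sub>R \<phi> p (Z p) - g p (\<phi> p (X p)) (Z p) *\<^sub>R \<phi> p (Y p)
      + g p (\<phi> p (Y p)) (Z p) *\<^sub>R \<phi> p (X p)
      + (\<eta> p (Y p) * g p (X p) (Z p) - \<eta> p (X p) * g p (Y p) (Z p)) *\<^sub>R \<xi> p
      - (2 * \<eta> p (Z p)) *\<^sub>R (\<eta> p (Y p) *\<^sub>R X p - \<eta> p (X p) *\<^sub>R Y p))
    + (a\<^sup>2 * \<eta> p (Z p)) *\<^sub>R (\<eta> p (Y p) *\<^sub>R X p - \<eta> p (X p) *\<^sub>R Y p)"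
proof -
  have Xp: "X p \<in> tangent_space \<B> p" and Yp: "Y p \<in> tangent_space \<B> p" and Zp: "Z p \<in> tangent_space \<B> p"
    using X Y Z S(2) by (auto intro: vector_field_on_tangent)
  define xy where "xy = nab p (X p) Y"
  define yx where "yx = nab p (Y p) X"
  define xz where "xz = nab p (X p) Z"
  define yz where "yz = nab p (Y p) Z"
  have T: "xy \<in> tangent_space \<B> p" "yx \<in> tangent_space \<B> p" "xz \<in> tangent_space \<B> p" "yz \<in> tangent_space \<B> p"
    using D_tangent[OF S] X Y Z Xp Yp by (auto simp: xy_def yx_def xz_def yz_def field_section)
  have L: "lie_bracket \<B> X Y p = xy - yx" "lie_bracket \<B> X Y p \<in> tangent_space \<B> p"
    using nab_torsion[OF S(1) X Y S(2)] lie_bracket_tangent[OF S X Y] by (auto simp: xy_def yx_def)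
  have "curvature \<B> nab X Y Z p = nab p (X p) (\<lambda>q. nab q (Y q) Z) - nab p (Y p) (\<lambda>q. nab q (X q) Z)
      - nab p (lie_bracket \<B> X Y p) Z" by (simp add: curvature_def)
  then have "curvature \<B> nabs X Y Z p = curvature \<B> nab X Y Z p
     - (nab p (X p) (\<lambda>q. correction q (Y q) (Z q)) + correction p (X p) yz - correction p (X p) (correction p (Y p) (Z p)))
     + (nab p (Y p) (\<lambda>q. correction q (X q) (Z q)) + correction p (Y p) xz - correction p (Y p) (correction p (X p) (Z p)))
     + correction p (xy - yx) (Z p)"
    unfolding curvature_def star_second[OF S X Y Z] star_second[OF S Y X Z] star_eq[OF S Z L(2)]
    by (simp add: L(1) xz_def yz_def algebra_simps)
  also have "\<dots> = curv p (X p) (Y p) (Z p)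
    - a *\<^sub>R (- (2 * g p (\<phi> p (X p)) (Y p)) *\<^sub>R \<phi> p (Z p) - g p (\<phi> p (X p)) (Z p) *\<^sub>R \<phi> p (Y p)
      + g p (\<phi> p (Y p)) (Z p) *\<^sub>R \<phi> p (X p)
      + (\<eta> p (Y p) * g p (X p) (Z p) - \<eta> p (X p) * g p (Y p) (Z p)) *\<^sub>R \<xi> p
      - (2 * \<eta> p (Z p)) *\<^sub>R (\<eta> p (Y p) *\<^sub>R X p - \<eta> p (X p) *\<^sub>R Y p))
    + (a\<^sup>2 * \<eta> p (Z p)) *\<^sub>R (\<eta> p (Y p) *\<^sub>R X p - \<eta> p (X p) *\<^sub>R Y p)"
  proof -
    have "g p (\<phi> p (Y p)) (X p) = - g p (\<phi> p (X p)) (Y p)" "g p (Y p) (X p) = g p (X p) (Y p)"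
      using phi_skew[OF Yp Xp] tensor_sym[OF Yp Xp] tensor_sym[OF Yp phi_tangent[OF Xp]] by auto
    then show ?thesis
      unfolding nab_correction[OF S Y Z Xp] nab_correction[OF S X Z Yp] curvature_eq[OF S(1) X Y Z S(2)]
        xy_def[symmetric] yx_def[symmetric] xz_def[symmetric] yz_def[symmetric]
      using T Xp Yp Zp
      \<comment> \<open>Vectors are functionals, so evaluation at an arbitrary function turns the
        vector identity into real algebra.\<close>
      by (intro ext)
        (simp add: correction_def structure_simps phi_phi plus_fun_apply minus_apply scaleR_fun_apply uminus_apply
          power2_eq_square, simp add: algebra_simps)
  qed
  finally show ?thesis .
qed

end

context ricci_form
begin

definition star_curv :: "'b \<Rightarrow> 'b tvec \<Rightarrow> 'b tvec \<Rightarrow> 'b tvec \<Rightarrow> 'b tvec" where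
  "star_curv p u v w = curv p u v w
    - a *\<^sub>R (- (2 * g p (\<phi> p u) v) *\<^sub>R \<phi> p w - g p (\<phi> p u) w *\<^sub>R \<phi> p v
      + g p (\<phi> p v) w *\<^sub>R \<phi> p u
      + (\<eta> p v * g p u w - \<eta> p u * g p v w) *\<^sub>R \<xi> p
      - (2 * \<eta> p w) *\<^sub>R (\<eta> p v *\<^sub>R u - \<eta> p u *\<^sub>R v))
    + (a\<^sup>2 * \<eta> p w) *\<^sub>R (\<eta> p v *\<^sub>R u - \<eta> p u *\<^sub>R v)"

lemma star_curvature_at:
  assumes "u \<in> tangent_space \<B> p" "v \<in> tangent_space \<B> p" "w \<in> tangent_space \<B> p"
  shows "curvature_at \<B> nabs p u v w = star_curv p u v w"
  by (rule curvature_at_eqI[OF _ assms]) (auto simp: star_curvature star_curv_def)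

end

section \<open>Hypersurfaces\<close>

locale hypersurface = ricci_form \<B> \<phi> \<xi> \<eta> g nab c Ric nabs m
  for \<B> :: "('b::{t2_space, second_countable_topology}, 'e::euclidean_space) atlas"
    and \<phi> \<xi> \<eta> g nab c Ric nabs m +
  fixes \<A> :: "('a::{t2_space, second_countable_topology}, 'd::euclidean_space) atlas"
    and \<psi> :: "'a \<Rightarrow> 'b" and nabla :: "('a, 'a) conn" and D Ds :: "('a, 'b) conn"
  assumes m2: "m \<ge> 2" and dimA: "DIM('d) = 2 * m"
    and atlasA: "smooth_atlas \<A>" and immersion: "immersion \<A> \<B> \<psi>"
    and nabla: "levi_civita \<A> (pullback_metric \<A> \<B> \<psi> g) nabla"
    and pullback_D: "pullback_connection \<A> \<B> \<psi> nab D"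
    and pullback_Ds: "pullback_connection \<A> \<B> \<psi> nabs Ds"
    and xi_image: "\<And>p. \<xi> (\<psi> p) \<in> differential \<A> \<B> \<psi> p ` tangent_space \<A> p"
begin

sublocale M: pullback_levi_civita \<A> \<B> \<psi> D g nab
proof
  show "smooth_atlas \<A>" by (rule atlasA)
  show "smooth_map \<A> \<B> \<psi>" using immersion unfolding immersion_def by (rule conjunct1)
  show "connection_along \<A> \<B> \<psi> D" by (rule pullback_D[unfolded pullback_connection_def, THEN conjunct1])
  show "levi_civita \<B> g nab" by (rule levi_civita)
  show "pullback_connection \<A> \<B> \<psi> nab D" by (rule pullback_D)
qed

text \<open>The same calculus serves for g and for the possibly indefinite \<open>Ric\<close>,
  because the locale asks only for a symmetric tensor with a Levi-Civita connection.\<close>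

sublocale Ms: pullback_levi_civita \<A> \<B> \<psi> Ds Ric nabs
proof
  show "connection_along \<A> \<B> \<psi> Ds" by (rule pullback_Ds[unfolded pullback_connection_def, THEN conjunct1])
  show "levi_civita \<B> Ric nabs" by (rule star_levi_civita)
  show "pullback_connection \<A> \<B> \<psi> nabs Ds" by (rule pullback_Ds)
qed

sublocale I: connection \<A> \<A> "\<lambda>p. p" nabla
proof -
  interpret J: smooth_mapping \<A> \<A> "\<lambda>p. p" by (rule M.A.smooth_mapping_id)
  show "connection \<A> \<A> (\<lambda>p. p) nabla"
    by unfold_locales (rule nabla[unfolded levi_civita_def, THEN conjunct1])
qed

notation M.d\<psi> ("d\<psi>")
notation M.sect ("sect")

lemma differential_inj: "v \<in> tangent_space \<A> p \<Longrightarrow> w \<in> tangent_space \<A> p \<Longrightarrow> d\<psi> p v = d\<psi> p w \<Longrightarrow> v = w"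
  by (rule inj_onD[OF immersion[unfolded immersion_def, THEN conjunct2, rule_format]])

lemma tangent_lift_eq:
  assumes "v \<in> tangent_space \<A> p" "d\<psi> p v = w"
  shows "tangent_lift \<A> \<B> \<psi> p w = v"
  unfolding tangent_lift_def
proof (rule the_equality)
  show "v' = v" if "v' \<in> tangent_space \<A> p \<and> d\<psi> p v' = w" for v'
    by (rule differential_inj[OF _ assms(1)]) (use that assms(2) in auto)
qed (use assms in auto)

lemma phi_section:
  assumes S: "open S" and Y: "sect S Y"
  shows "sect S (\<lambda>q. \<phi> (\<psi> q) (Y q))"
proof (rule M.section_local)
  fix p assume p: "p \<in> S"
  from S p Y show "\<exists>T. open T \<and> p \<in> T \<and> sect T (\<lambda>q. \<phi> (\<psi> q) (Y q))"
  proof (induction rule: M.section_induct)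
    case (pullback W E)
    have "sect (\<psi> -` W) (\<lambda>q. \<phi> (\<psi> q) (E (\<psi> q)))"
      by (rule M.pullback_section[OF pullback(1) phi_field[OF pullback(1,3)]])
    then show ?case using M.vimage_open[OF pullback(1)] pullback(2) by (intro exI[of _ "\<psi> -` W"]) auto
  next
    case (add T Y Y')
    then obtain T1 T2 where T: "open T1" "p \<in> T1" "sect T1 (\<lambda>q. \<phi> (\<psi> q) (Y q))"
      "open T2" "p \<in> T2" "sect T2 (\<lambda>q. \<phi> (\<psi> q) (Y' q))" by blast
    let ?U = "T \<inter> T1 \<inter> T2"
    have "sect ?U (\<lambda>q. \<phi> (\<psi> q) (Y q) + \<phi> (\<psi> q) (Y' q))"
      by (rule section_on_add[OF section_on_subset[OF T(3)] section_on_subset[OF T(6)]]) auto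
    then have "sect ?U (\<lambda>q. \<phi> (\<psi> q) (Y q + Y' q))"
      by (rule M.section_cong[rotated 2])
        (use add(1,2) T in \<open>auto simp: phi_add section_on_tangent[OF add(3)] section_on_tangent[OF add(4)]\<close>)
    then show ?case using add(1,2) T by (intro exI[of _ ?U]) auto
  next
    case (scale T f Y)
    then obtain T1 where T: "open T1" "p \<in> T1" "sect T1 (\<lambda>q. \<phi> (\<psi> q) (Y q))" by blast
    let ?U = "T \<inter> T1"
    have "sect ?U (\<lambda>q. f q *\<^sub>R \<phi> (\<psi> q) (Y q))"
      by (rule section_on_scale[OF smooth_fun_on_subset[OF scale(3)] section_on_subset[OF T(3)]]) auto
    then have "sect ?U (\<lambda>q. \<phi> (\<psi> q) (f q *\<^sub>R Y q))"
      by (rule M.section_cong[rotated 2])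
        (use scale(1,2) T in \<open>auto simp: phi_scale section_on_tangent[OF scale(4)]\<close>)
    then show ?case using scale(1,2) T by (intro exI[of _ ?U]) auto
  next
    case (cong T Y Y')
    then obtain T1 where T: "open T1" "p \<in> T1" "sect T1 (\<lambda>q. \<phi> (\<psi> q) (Y q))" by blast
    have "sect (T \<inter> T1) (\<lambda>q. \<phi> (\<psi> q) (Y' q))"
      by (rule M.section_cong[OF _ _ section_on_subset[OF T(3)], of "T \<inter> T1"]) (use cong T in auto)
    then show ?case using cong T by (intro exI[of _ "T \<inter> T1"]) auto
  qed
qed

lemma D_phi:
  assumes S: "open S" "p \<in> S" and Y: "sect S Y" and v: "v \<in> tangent_space \<A> p"
  shows "D p v (\<lambda>q. \<phi> (\<psi> q) (Y q)) =
    \<phi> (\<psi> p) (D p v Y) + g (\<psi> p) (d\<psi> p v) (Y p) *\<^sub>R \<xi> (\<psi> p) - \<eta> (\<psi> p) (Y p) *\<^sub>R d\<psi> p v"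
proof -
  let ?K = "\<lambda>Y. D p v (\<lambda>q. \<phi> (\<psi> q) (Y q)) - \<phi> (\<psi> p) (D p v Y)"
  obtain W E where E: "open W" "\<psi> p \<in> W" "vector_field_on \<B> W E" "E (\<psi> p) = Y p"
    and sE: "open (\<psi> -` W)" "p \<in> \<psi> -` W" "sect (\<psi> -` W) (\<lambda>q. E (\<psi> q))"
    by (rule M.section_pullback_extension[OF section_on_tangent[OF Y S(2)]])
  have "?K Y = ?K (\<lambda>q. E (\<psi> q))"
  proof (rule M.section_tensorial[OF S Y sE E(4)[symmetric]])
    fix T Y assume T: "open T" "p \<in> T" and Y: "sect T Y"
    note fY = phi_section[OF T(1) Y] and DY = M.D_tangent[OF T Y v]
    { fix Y' assume Y': "sect T Y'"
      note fY' = phi_section[OF T(1) Y']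
      have "D p v (\<lambda>q. \<phi> (\<psi> q) (Y q + Y' q)) = D p v (\<lambda>q. \<phi> (\<psi> q) (Y q) + \<phi> (\<psi> q) (Y' q))"
        by (rule M.D_cong[OF T section_on_add[OF fY fY'] _ v, symmetric])
          (simp add: phi_add section_on_tangent[OF Y] section_on_tangent[OF Y'])
      then show "?K (\<lambda>q. Y q + Y' q) = ?K Y + ?K Y'"
        by (simp add: M.D_add[OF T fY v fY'] M.D_add[OF T Y v Y'] phi_add DY M.D_tangent[OF T Y' v]) }
    { fix f :: "'a \<Rightarrow> real" assume f: "smooth_fun_on \<A> T f"
      have "D p v (\<lambda>q. \<phi> (\<psi> q) (f q *\<^sub>R Y q)) = D p v (\<lambda>q. f q *\<^sub>R \<phi> (\<psi> q) (Y q))"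
        by (rule M.D_cong[OF T section_on_scale[OF f fY] _ v, symmetric])
          (simp add: phi_scale section_on_tangent[OF Y])
      then show "?K (\<lambda>q. f q *\<^sub>R Y q) = f p *\<^sub>R ?K Y"
        by (simp add: M.D_scale[OF T fY v f] M.D_scale[OF T Y v f] phi_add phi_scale DY
            section_on_tangent[OF Y T(2)] tangent_scale scaleR_diff_right) }
    { fix Y' assume YY': "\<And>q. q \<in> T \<Longrightarrow> Y q = Y' q"
      have "D p v (\<lambda>q. \<phi> (\<psi> q) (Y q)) = D p v (\<lambda>q. \<phi> (\<psi> q) (Y' q))"
        by (rule M.D_cong[OF T fY _ v]) (simp add: YY')
      then show "?K Y = ?K Y'" using M.D_cong[OF T Y YY' v] by simp }
  qed
  also have "\<dots> = g (\<psi> p) (d\<psi> p v) (Y p) *\<^sub>R \<xi> (\<psi> p) - \<eta> (\<psi> p) (Y p) *\<^sub>R d\<psi> p v"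
    using M.D_pullback[OF E(1) phi_field[OF E(1,3)] E(2) v] M.D_pullback[OF E(1,3,2) v]
      nab_phi[OF E(1,2,3) M.differential_tangent[OF v]] E(4) by simp
  finally show ?thesis by (simp add: algebra_simps)
qed

lemma xi_section: "sect S (\<lambda>q. \<xi> (\<psi> q))"
  using section_on_subset[OF M.pullback_section[OF open_UNIV xi_field]] by simp

lemma D_xi: "v \<in> tangent_space \<A> p \<Longrightarrow> D p v (\<lambda>q. \<xi> (\<psi> q)) = - \<phi> (\<psi> p) (d\<psi> p v)"
  by (simp add: M.D_pullback[OF open_UNIV xi_field UNIV_I] nab_xi M.differential_tangent)

text \<open>In the difference of two connections along \<psi> the derivatives of coefficients
  cancel, so it is tensorial and can be read off on ambient fields, where \<open>star_eq\<close>
  applies.\<close>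

lemma Ds_eq:
  assumes S: "open S" "p \<in> S" and Y: "sect S Y" and v: "v \<in> tangent_space \<A> p"
  shows "Ds p v Y = D p v Y - correction (\<psi> p) (d\<psi> p v) (Y p)"
proof -
  let ?K = "\<lambda>Y. Ds p v Y - D p v Y"
  obtain W E where E: "open W" "\<psi> p \<in> W" "vector_field_on \<B> W E" "E (\<psi> p) = Y p"
    and sE: "open (\<psi> -` W)" "p \<in> \<psi> -` W" "sect (\<psi> -` W) (\<lambda>q. E (\<psi> q))"
    by (rule M.section_pullback_extension[OF section_on_tangent[OF Y S(2)]])
  have "?K Y = ?K (\<lambda>q. E (\<psi> q))"
  proof (rule M.section_tensorial[OF S Y sE E(4)[symmetric]])
    fix T Y assume T: "open T" "p \<in> T" and Y: "sect T Y"
    show "?K (\<lambda>q. Y q + Y' q) = ?K Y + ?K Y'" if "sect T Y'" for Y'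
      by (simp add: M.D_add[OF T Y v that] Ms.D_add[OF T Y v that])
    show "?K (\<lambda>q. f q *\<^sub>R Y q) = f p *\<^sub>R ?K Y" if "smooth_fun_on \<A> T f" for f
      by (simp add: M.D_scale[OF T Y v that] Ms.D_scale[OF T Y v that] scaleR_diff_right)
    show "?K Y = ?K Y'" if "\<And>q. q \<in> T \<Longrightarrow> Y q = Y' q" for Y'
      using M.D_cong[OF T Y that v] Ms.D_cong[OF T Y that v] by simp
  qed
  also have "\<dots> = - correction (\<psi> p) (d\<psi> p v) (Y p)"
    using M.D_pullback[OF E(1,3,2) v] Ms.D_pullback[OF E(1,3,2) v]
      star_eq[OF E(1,2,3) M.differential_tangent[OF v]] E(4) by simp
  finally show ?thesis by (simp add: algebra_simps)
qed

text \<open>No orthogonal projection is formed. Paired with tangent vectors, the defect is symmetric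
  in X and Y by \<open>D_torsion\<close> and skew in the last two arguments because both connections
  are metric, so \<open>braid\<close> kills it: the second fundamental form is normal.\<close>

lemma Gauss:
  assumes S: "open S" "p \<in> S" and XY: "vector_field_on \<A> S X" "vector_field_on \<A> S Y" and w: "w \<in> tangent_space \<A> p"
  shows "g (\<psi> p) (D p (X p) (\<lambda>q. d\<psi> q (Y q)) - d\<psi> p (nabla p (X p) Y)) (d\<psi> p w) = 0"
proof -
  have field_section: "vector_field_on \<A> = section_on \<A> \<A> (\<lambda>p. p)" by (intro ext) (simp add: vector_field_on_def)
  obtain U Z where Z: "open U" "p \<in> U" "vector_field_on \<A> U Z" "Z p = w" by (rule M.A.tangent_vector_extension[OF w])
  let ?S = "S \<inter> U"
  let ?V = "vector_field_on \<A> ?S"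
  have S: "open ?S" "p \<in> ?S" using S Z by auto
  have V: "?V X" "?V Y" "?V Z" using XY Z(3) by (auto elim: vector_field_on_subset)
  let ?d = "\<lambda>X Y. D p (X p) (\<lambda>q. d\<psi> q (Y q)) - d\<psi> p (nabla p (X p) Y)"
  have "g (\<psi> p) (?d X Y) (d\<psi> p (Z p)) = 0"
  proof (rule braid[of ?V "\<lambda>X Y Z. g (\<psi> p) (?d X Y) (d\<psi> p (Z p))", OF _ _ V])
    fix X Y Z assume V: "?V X" "?V Y" "?V Z"
    have tan: "X p \<in> tangent_space \<A> p" "d\<psi> p (X p) \<in> tangent_space \<B> (\<psi> p)" if "?V X" for X
      using vector_field_on_tangent[OF that S(2)] M.differential_tangent by auto
    have T: "D p (X p) (\<lambda>q. d\<psi> q (Y q)) \<in> tangent_space \<B> (\<psi> p)" "d\<psi> p (nabla p (X p) Y) \<in> tangent_space \<B> (\<psi> p)"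
      if "?V X" "?V Y" for X Y
      using M.D_tangent[OF S M.differential_section[OF S(1) that(2)] tan(1)[OF that(1)]]
        M.differential_tangent[OF I.D_tangent[OF S that(2)[unfolded field_section] tan(1)[OF that(1)]]] by auto
    have "nabla p (X p) Y - nabla p (Y p) X = lie_bracket \<A> X Y p"
      by (rule nabla[unfolded levi_civita_def, THEN conjunct2, THEN conjunct1, rule_format, OF S(1) V(1,2) S(2)])
    then have "d\<psi> p (nabla p (X p) Y) - d\<psi> p (nabla p (Y p) X) = d\<psi> p (lie_bracket \<A> X Y p)"
      by (metis linear_diff[OF M.linear_differential])
    then have "?d X Y = ?d Y X"
      using M.D_torsion[OF S V(1,2)] by (simp add: algebra_simps)
    then show "g (\<psi> p) (?d X Y) (d\<psi> p (Z p)) = g (\<psi> p) (?d Y X) (d\<psi> p (Z p))" by simp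
    have "X p (\<lambda>q. g (\<psi> q) (d\<psi> q (Y q)) (d\<psi> q (Z q))) =
        g (\<psi> p) (d\<psi> p (nabla p (X p) Y)) (d\<psi> p (Z p)) + g (\<psi> p) (d\<psi> p (Y p)) (d\<psi> p (nabla p (X p) Z))"
      using nabla[unfolded levi_civita_def, THEN conjunct2, THEN conjunct2, rule_format, OF S(1) V(2,3) S(2) tan(1)[OF V(1)]]
      unfolding pullback_metric_def .
    moreover have "X p (\<lambda>q. g (\<psi> q) (d\<psi> q (Y q)) (d\<psi> q (Z q))) =
        g (\<psi> p) (D p (X p) (\<lambda>q. d\<psi> q (Y q))) (d\<psi> p (Z p)) + g (\<psi> p) (d\<psi> p (Y p)) (D p (X p) (\<lambda>q. d\<psi> q (Z q)))"
      by (rule M.D_metric[OF S M.differential_section[OF S(1) V(2)] M.differential_section[OF S(1) V(3)] tan(1)[OF V(1)]])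
    ultimately have "g (\<psi> p) (?d X Y) (d\<psi> p (Z p)) + g (\<psi> p) (d\<psi> p (Y p)) (?d X Z) = 0"
      using T[OF V(1,2)] T[OF V(1,3)] tan(2)[OF V(2)] tan(2)[OF V(3)] by (simp add: tensor_diff_left tensor_diff_right)
    then show "g (\<psi> p) (?d X Y) (d\<psi> p (Z p)) = - g (\<psi> p) (?d X Z) (d\<psi> p (Y p))"
      using tensor_sym[OF tan(2)[OF V(2)] tangent_diff[OF T[OF V(1,3)]]] by simp
  qed
  then show ?thesis by (simp only: Z(4))
qed

end

section \<open>The mean curvature field, unit normals and the shape operator\<close>

locale mean_curved_hypersurface = hypersurface +
  fixes H
  assumes mean_curvature: "mean_curvature_field \<A> \<B> \<psi> g nabla D H"
begin

abbreviation "orthonormal_at \<equiv> orthonormal_basis_at \<A> (pullback_metric \<A> \<B> \<psi> g)"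
abbreviation "orthonormal_on \<equiv> orthonormal_frame_on \<A> (pullback_metric \<A> \<B> \<psi> g)"

lemma mean_curvature_frame:
  obtains S e where "open S" "p \<in> S" "orthonormal_on S e"
    "\<forall>q\<in>S. H q = (1 / real DIM('d)) *\<^sub>R (\<Sum>i<DIM('d). second_fundamental_form \<A> \<B> \<psi> nabla D (e i) (e i) q)"
  using mean_curvature[unfolded mean_curvature_field_def, THEN spec, of p] by (elim exE conjE) (rule that)

lemma frame_field: "orthonormal_on S e \<Longrightarrow> i < 2 * m \<Longrightarrow> vector_field_on \<A> S (e i)"
  unfolding orthonormal_frame_on_def dimA by simp

lemma frame_at: "orthonormal_on S e \<Longrightarrow> q \<in> S \<Longrightarrow> orthonormal_at q (\<lambda>i. e i q)"
  unfolding orthonormal_frame_on_def by simp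

lemma basis_tangent: "orthonormal_at q b \<Longrightarrow> i < 2 * m \<Longrightarrow> b i \<in> tangent_space \<A> q"
  unfolding orthonormal_basis_at_def dimA by simp

lemma basis_orthonormal:
  "orthonormal_at q b \<Longrightarrow> i < 2 * m \<Longrightarrow> j < 2 * m \<Longrightarrow> g (\<psi> q) (d\<psi> q (b i)) (d\<psi> q (b j)) = (if i = j then 1 else 0)"
  unfolding orthonormal_basis_at_def dimA pullback_metric_def by simp

lemma H_section: "sect UNIV H"
proof (rule M.section_local)
  fix p
  obtain S e where S: "open S" "p \<in> S" "orthonormal_on S e"
    "\<forall>q\<in>S. H q = (1 / real DIM('d)) *\<^sub>R (\<Sum>i<DIM('d). second_fundamental_form \<A> \<B> \<psi> nabla D (e i) (e i) q)"
    by (rule mean_curvature_frame)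
  have "sect S (\<lambda>q. second_fundamental_form \<A> \<B> \<psi> nabla D (e i) (e i) q)" if "i \<in> {..<DIM('d)}" for i
  proof -
    have e: "vector_field_on \<A> S (e i)" using frame_field[OF S(3)] that dimA by simp
    have "vector_field_on \<A> S (\<lambda>q. nabla q (e i q) (e i))"
      using I.D_section[OF S(1) e e[unfolded vector_field_on_def]] by (simp add: vector_field_on_def)
    then show ?thesis
      unfolding second_fundamental_form_def
      by (intro section_on_diff M.D_section[OF S(1) e] M.differential_section S(1) e)
  qed
  then have s: "sect S (\<lambda>q. (1 / real DIM('d)) *\<^sub>R (\<Sum>i<DIM('d). second_fundamental_form \<A> \<B> \<psi> nabla D (e i) (e i) q))"
    by (intro section_on_cscale section_on_sum)
  have "sect S H" by (rule M.section_cong[OF S(1) S(4)[rule_format, symmetric] s])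
  then show "\<exists>T. open T \<and> p \<in> T \<and> sect T H" using S(1,2) by blast
qed

lemma H_tangent: "H p \<in> tangent_space \<B> (\<psi> p)"
  by (rule section_on_tangent[OF H_section UNIV_I])

lemma H_normal: assumes w: "w \<in> tangent_space \<A> p" shows "g (\<psi> p) (H p) (d\<psi> p w) = 0"
proof -
  obtain S e where S: "open S" "p \<in> S" "orthonormal_on S e"
    "\<forall>q\<in>S. H q = (1 / real DIM('d)) *\<^sub>R (\<Sum>i<DIM('d). second_fundamental_form \<A> \<B> \<psi> nabla D (e i) (e i) q)"
    by (rule mean_curvature_frame)
  note dw = M.differential_tangent[OF w]
  let ?B = "\<lambda>i. second_fundamental_form \<A> \<B> \<psi> nabla D (e i) (e i) p"
  have B: "?B i \<in> tangent_space \<B> (\<psi> p)" "g (\<psi> p) (?B i) (d\<psi> p w) = 0" if "i \<in> {..<DIM('d)}" for i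
  proof -
    have e: "vector_field_on \<A> S (e i)" using frame_field[OF S(3)] that dimA by simp
    have "e i p \<in> tangent_space \<A> p" by (rule vector_field_on_tangent[OF e S(2)])
    then show "?B i \<in> tangent_space \<B> (\<psi> p)"
      unfolding second_fundamental_form_def
      using I.D_tangent[OF S(1,2) e[unfolded vector_field_on_def]]
      by (intro tangent_diff M.D_tangent[OF S(1,2) M.differential_section[OF S(1) e]] M.differential_tangent) auto
    show "g (\<psi> p) (?B i) (d\<psi> p w) = 0"
      unfolding second_fundamental_form_def by (rule Gauss[OF S(1,2) e e w])
  qed
  have "g (\<psi> p) (H p) (d\<psi> p w) = (1 / real DIM('d)) * g (\<psi> p) (\<Sum>i<DIM('d). ?B i) (d\<psi> p w)"
    unfolding S(4)[rule_format, OF S(2)] by (rule tensor_scale_left[OF tangent_sum dw]) (rule B)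
  also have "g (\<psi> p) (\<Sum>i<DIM('d). ?B i) (d\<psi> p w) = (\<Sum>i<DIM('d). g (\<psi> p) (?B i) (d\<psi> p w))"
    by (rule tensor_sum_left[OF B(1) dw])
  finally show ?thesis using B(2) by simp
qed

end

locale normal_field = mean_curved_hypersurface +
  fixes \<Omega> N
  assumes open_\<Omega>: "open \<Omega>" and normal: "unit_normal_on \<A> \<B> \<psi> g \<Omega> N"
begin

lemma N_section: "sect \<Omega> N"
  using normal unfolding unit_normal_on_def by (rule conjunct1)

context
  fixes p assumes p: "p \<in> \<Omega>"
begin

lemma N_tangent: "N p \<in> tangent_space \<B> (\<psi> p)"
  by (rule section_on_tangent[OF N_section p])

lemma N_unit: "g (\<psi> p) (N p) (N p) = 1"
  using normal p unfolding unit_normal_on_def by simp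

lemma N_orthogonal: "v \<in> tangent_space \<A> p \<Longrightarrow> g (\<psi> p) (N p) (d\<psi> p v) = 0"
  using normal p unfolding unit_normal_on_def by simp

lemma N_orthogonal': "v \<in> tangent_space \<A> p \<Longrightarrow> g (\<psi> p) (d\<psi> p v) (N p) = 0"
  using N_orthogonal tensor_sym[OF N_tangent M.differential_tangent] by simp

lemma eta_N: "\<eta> (\<psi> p) (N p) = 0"
proof -
  obtain v where "v \<in> tangent_space \<A> p" "\<xi> (\<psi> p) = d\<psi> p v" using xi_image by blast
  then show ?thesis using N_orthogonal by (simp add: metric_xi(2)[OF N_tangent, symmetric])
qed

lemma phi_N: "\<phi> (\<psi> p) (N p) \<in> tangent_space \<B> (\<psi> p)" "\<eta> (\<psi> p) (\<phi> (\<psi> p) (N p)) = 0"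
  "g (\<psi> p) (\<phi> (\<psi> p) (N p)) (N p) = 0" "g (\<psi> p) (N p) (\<phi> (\<psi> p) (N p)) = 0"
  "g (\<psi> p) (\<phi> (\<psi> p) (N p)) (\<phi> (\<psi> p) (N p)) = 1" "\<phi> (\<psi> p) (\<phi> (\<psi> p) (N p)) = - N p"
  using phi_tangent eta_phi phi_self metric_phi_phi[OF N_tangent N_tangent] phi_phi[OF N_tangent] N_tangent eta_N N_unit
  by auto

text \<open>The index 2 m holds the normal. For a vector orthogonal to N that slot drops out of
  expansions and Parseval sums, which become sums over the tangent basis.\<close>

lemma adapted_basis:
  assumes b: "orthonormal_at p b"
  shows "orthonormal_basis_at \<B> g (\<psi> p) (\<lambda>i. if i < 2 * m then d\<psi> p (b i) else N p)"
  unfolding orthonormal_basis_at_def dim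
  using basis_tangent[OF b] basis_orthonormal[OF b] N_tangent N_unit
  by (auto simp: M.differential_tangent N_orthogonal N_orthogonal')

lemma tangential_expansion:
  assumes b: "orthonormal_at p b" and u: "u \<in> tangent_space \<B> (\<psi> p)" "g (\<psi> p) u (N p) = 0"
  shows "u = (\<Sum>i<2 * m. g (\<psi> p) u (d\<psi> p (b i)) *\<^sub>R d\<psi> p (b i))"
  using orthonormal_expansion[OF adapted_basis[OF b] u(1)] u(2) by (simp add: dim)

lemma tangential_Parseval:
  assumes b: "orthonormal_at p b" and u: "u \<in> tangent_space \<B> (\<psi> p)" "g (\<psi> p) u (N p) = 0"
    and w: "w \<in> tangent_space \<B> (\<psi> p)"
  shows "g (\<psi> p) u w = (\<Sum>i<2 * m. g (\<psi> p) u (d\<psi> p (b i)) * g (\<psi> p) w (d\<psi> p (b i)))"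
  using Parseval[OF adapted_basis[OF b] u(1) w] u(2) by (simp add: dim)

lemma tangential_lift:
  assumes u: "u \<in> tangent_space \<B> (\<psi> p)" "g (\<psi> p) u (N p) = 0"
  obtains v where "v \<in> tangent_space \<A> p" "d\<psi> p v = u"
proof -
  obtain S e where S: "open S" "p \<in> S" "orthonormal_on S e" by (rule mean_curvature_frame)
  note b = frame_at[OF S(3,2)]
  have "d\<psi> p (\<Sum>i<2 * m. g (\<psi> p) u (d\<psi> p (e i p)) *\<^sub>R e i p) = u"
    using tangential_expansion[OF b u] by (simp add: linear_sum[OF M.linear_differential] M.differential_scale)
  moreover have "(\<Sum>i<2 * m. g (\<psi> p) u (d\<psi> p (e i p)) *\<^sub>R e i p) \<in> tangent_space \<A> p"
    by (intro tangent_sum tangent_scale basis_tangent[OF b]) simp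
  ultimately show thesis using that by blast
qed

lemma tangential_zero:
  assumes u: "u \<in> tangent_space \<B> (\<psi> p)" "g (\<psi> p) u (N p) = 0"
    and "\<And>v. v \<in> tangent_space \<A> p \<Longrightarrow> g (\<psi> p) u (d\<psi> p v) = 0"
  shows "u = 0"
proof -
  obtain v where "v \<in> tangent_space \<A> p" "d\<psi> p v = u" by (rule tangential_lift[OF u])
  then have "g (\<psi> p) u u = 0" using assms(3) by blast
  then show ?thesis using metric_pos[OF u(1)] by (cases "u = 0") auto
qed

lemma DN_tangent: "v \<in> tangent_space \<A> p \<Longrightarrow> D p v N \<in> tangent_space \<B> (\<psi> p)"
  by (rule M.D_tangent[OF open_\<Omega> p N_section])

lemma DN_normal: assumes v: "v \<in> tangent_space \<A> p" shows "g (\<psi> p) (D p v N) (N p) = 0"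
proof -
  have "v (\<lambda>q. g (\<psi> q) (N q) (N q)) = v (\<lambda>q. 1)"
    by (rule M.A.tangent_vector_cong[OF v open_\<Omega> p]) (use normal in \<open>simp add: unit_normal_on_def\<close>)
  then have "g (\<psi> p) (D p v N) (N p) + g (\<psi> p) (N p) (D p v N) = 0"
    using M.D_metric[OF open_\<Omega> p N_section N_section v] tangent_vector_const[OF v] by simp
  then show ?thesis using tensor_sym[OF N_tangent DN_tangent[OF v]] by simp
qed

lemma DN_differential:
  assumes S: "open S" "p \<in> S" and Y: "vector_field_on \<A> S Y" and v: "v \<in> tangent_space \<A> p"
  shows "g (\<psi> p) (D p v N) (d\<psi> p (Y p)) = - g (\<psi> p) (N p) (D p v (\<lambda>q. d\<psi> q (Y q)))"
proof -
  let ?S = "S \<inter> \<Omega>"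
  have S': "open ?S" "p \<in> ?S" using S open_\<Omega> p by auto
  have Y': "vector_field_on \<A> ?S Y" using Y by (rule vector_field_on_subset) simp
  have N': "sect ?S N" using N_section by (rule section_on_subset) simp
  have "v (\<lambda>q. g (\<psi> q) (N q) (d\<psi> q (Y q))) = v (\<lambda>q. 0)"
    by (rule M.A.tangent_vector_cong[OF v S'])
      (use normal vector_field_on_tangent[OF Y] in \<open>simp add: unit_normal_on_def\<close>)
  then show ?thesis
    using M.D_metric[OF S' N' M.differential_section[OF S'(1) Y'] v] tangent_vector_const[OF v] by simp
qed

text \<open>Self-adjointness of the shape operator. By \<open>DN_differential\<close> the difference
  is a pairing of N with D_X d\<psi> Y - D_Y d\<psi> X, which is the image of a Lie bracket and
  hence tangent.\<close>

lemma DN_sym: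
  assumes v: "v \<in> tangent_space \<A> p" and w: "w \<in> tangent_space \<A> p"
  shows "g (\<psi> p) (D p v N) (d\<psi> p w) = g (\<psi> p) (D p w N) (d\<psi> p v)"
proof -
  obtain S1 X where X: "open S1" "p \<in> S1" "vector_field_on \<A> S1 X" "X p = v" by (rule M.A.tangent_vector_extension[OF v])
  obtain S2 Y where Y: "open S2" "p \<in> S2" "vector_field_on \<A> S2 Y" "Y p = w" by (rule M.A.tangent_vector_extension[OF w])
  have S: "open (S1 \<inter> S2)" "p \<in> S1 \<inter> S2" "vector_field_on \<A> (S1 \<inter> S2) X" "vector_field_on \<A> (S1 \<inter> S2) Y"
    using X Y by (auto elim: vector_field_on_subset)
  let ?XY = "D p v (\<lambda>q. d\<psi> q (Y q))" and ?YX = "D p w (\<lambda>q. d\<psi> q (X q))"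
  have T: "?XY \<in> tangent_space \<B> (\<psi> p)" "?YX \<in> tangent_space \<B> (\<psi> p)"
    by (rule M.D_tangent[OF S(1,2) M.differential_section[OF S(1,4)] v]
        M.D_tangent[OF S(1,2) M.differential_section[OF S(1,3)] w])+
  have "g (\<psi> p) (N p) (?XY - ?YX) = 0"
    using M.D_torsion[OF S] N_orthogonal[OF M.A.lie_bracket_tangent[OF S]] X(4) Y(4) by simp
  then show ?thesis
    using DN_differential[OF S(1,2,4) v] DN_differential[OF S(1,2,3) w] T X(4) Y(4)
    by (simp add: tensor_diff_right N_tangent)
qed

text \<open>This is A \<xi> = -V. Self-adjointness moves the derivative to an arbitrary direction w,
  and differentiating g(N, \<xi>) = 0 brings in the derivative of \<xi>, which is -\<phi>.\<close>

lemma DN_xi: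
  assumes v: "v \<in> tangent_space \<A> p" and xi: "d\<psi> p v = \<xi> (\<psi> p)"
  shows "D p v N = - \<phi> (\<psi> p) (N p)"
proof -
  have "D p v N + \<phi> (\<psi> p) (N p) = 0"
  proof (rule tangential_zero)
    show "D p v N + \<phi> (\<psi> p) (N p) \<in> tangent_space \<B> (\<psi> p)" by (intro tangent_add DN_tangent[OF v] phi_N)
    show "g (\<psi> p) (D p v N + \<phi> (\<psi> p) (N p)) (N p) = 0"
      by (simp add: tensor_add_left DN_tangent[OF v] phi_N N_tangent DN_normal[OF v])
    fix w assume w: "w \<in> tangent_space \<A> p"
    note dw = M.differential_tangent[OF w]
    have "g (\<psi> p) (D p v N) (d\<psi> p w) = g (\<psi> p) (D p w N) (\<xi> (\<psi> p))" using DN_sym[OF v w] xi by simp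
    also have "\<dots> = - g (\<psi> p) (N p) (D p w (\<lambda>q. \<xi> (\<psi> q)))"
    proof -
      have "w (\<lambda>q. g (\<psi> q) (N q) (\<xi> (\<psi> q))) = w (\<lambda>q. 0)"
      proof (rule M.A.tangent_vector_cong[OF w open_\<Omega> p])
        fix q assume q: "q \<in> \<Omega>"
        obtain v where "v \<in> tangent_space \<A> q" "\<xi> (\<psi> q) = d\<psi> q v" using xi_image by blast
        then show "g (\<psi> q) (N q) (\<xi> (\<psi> q)) = 0" using normal q unfolding unit_normal_on_def by simp
      qed
      then show ?thesis
        using M.D_metric[OF open_\<Omega> p N_section xi_section w] tangent_vector_const[OF w] by simp
    qed
    also have "\<dots> = - g (\<psi> p) (\<phi> (\<psi> p) (N p)) (d\<psi> p w)"
      by (simp add: D_xi[OF w] phi_skew[OF N_tangent dw] tensor_minus_right N_tangent phi_tangent dw)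
    finally show "g (\<psi> p) (D p v N + \<phi> (\<psi> p) (N p)) (d\<psi> p w) = 0"
      by (simp add: tensor_add_left DN_tangent[OF v] phi_N dw)
  qed
  then show ?thesis by (simp add: eq_neg_iff_add_eq_0)
qed

lemma eta_DN:
  assumes v: "v \<in> tangent_space \<A> p"
  shows "\<eta> (\<psi> p) (D p v N) = - g (\<psi> p) (\<phi> (\<psi> p) (N p)) (d\<psi> p v)"
proof -
  obtain w where w: "w \<in> tangent_space \<A> p" "\<xi> (\<psi> p) = d\<psi> p w" using xi_image by blast
  have "\<eta> (\<psi> p) (D p v N) = g (\<psi> p) (D p v N) (d\<psi> p w)"
    using metric_xi(2)[OF DN_tangent[OF v]] w(2) by simp
  also have "\<dots> = g (\<psi> p) (D p w N) (d\<psi> p v)" by (rule DN_sym[OF v w(1)])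
  finally show ?thesis
    by (simp add: DN_xi[OF w(1) w(2)[symmetric]] tensor_minus_left phi_N M.differential_tangent[OF v])
qed

end

text \<open>The coefficients in a local orthonormal frame are smooth, so lifting tangential vectors
  pointwise yields a smooth field on the hypersurface.\<close>

lemma lift_field:
  assumes S: "open S" "p \<in> S" "S \<subseteq> \<Omega>" and Y: "sect S Y" "\<And>q. q \<in> S \<Longrightarrow> g (\<psi> q) (Y q) (N q) = 0"
  obtains T X where "open T" "p \<in> T" "T \<subseteq> S" "vector_field_on \<A> T X" "\<And>q. q \<in> T \<Longrightarrow> d\<psi> q (X q) = Y q"
proof -
  obtain U e where U: "open U" "p \<in> U" "orthonormal_on U e" by (rule mean_curvature_frame)
  let ?T = "S \<inter> U"
  have T: "open ?T" "p \<in> ?T" using S U by auto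
  have e: "vector_field_on \<A> ?T (e i)" if "i < 2 * m" for i
    using frame_field[OF U(3) that] by (rule vector_field_on_subset) simp
  have Y': "sect ?T Y" using Y(1) by (rule section_on_subset) simp
  let ?X = "\<lambda>q. \<Sum>i<2 * m. g (\<psi> q) (Y q) (d\<psi> q (e i q)) *\<^sub>R e i q"
  show thesis
  proof (rule that[of ?T ?X])
    show "vector_field_on \<A> ?T ?X"
      by (intro vector_field_on_sum vector_field_on_scale M.tensor_smooth_section[OF T(1) Y']
          M.differential_section T(1)) (auto intro: e)
    show "d\<psi> q (?X q) = Y q" if q: "q \<in> ?T" for q
    proof -
      have q': "q \<in> \<Omega>" "q \<in> U" "q \<in> S" using q S(3) by auto
      show ?thesis
        unfolding linear_sum[OF M.linear_differential] M.differential_scale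
        by (rule tangential_expansion[OF q'(1) frame_at[OF U(3) q'(2)] section_on_tangent[OF Y' q] Y(2)[OF q'(3)], symmetric])
    qed
  qed (use T in auto)
qed

end

lemma (in sasakian_form) Bessel:
  fixes n :: nat
  assumes x: "x \<in> tangent_space \<B> p" and y: "\<And>i. i < n \<Longrightarrow> y i \<in> tangent_space \<B> p"
    and yy: "\<And>i j. i < n \<Longrightarrow> j < n \<Longrightarrow> g p (y i) (y j) = (if i = j then 1 else 0)"
  shows "(\<Sum>i<n. (g p x (y i))\<^sup>2) \<le> g p x x"
proof -
  let ?s = "\<Sum>i<n. g p x (y i) *\<^sub>R y i"
  let ?z = "x - ?s"
  have s: "?s \<in> tangent_space \<B> p" by (intro tangent_sum tangent_scale y) simp
  have sy: "g p ?s w = (\<Sum>i<n. g p x (y i) * g p (y i) w)" if w: "w \<in> tangent_space \<B> p" for w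
  proof -
    have "g p ?s w = (\<Sum>i<n. g p (g p x (y i) *\<^sub>R y i) w)"
      by (rule tensor_sum_left[OF _ w]) (auto intro: tangent_scale y)
    then show ?thesis by (simp add: tensor_scale_left y w)
  qed
  have zy: "g p ?z (y j) = 0" if j: "j < n" for j
  proof -
    have "g p ?s (y j) = (\<Sum>i<n. if i = j then g p x (y i) else 0)"
      unfolding sy[OF y[OF j]] by (rule sum.cong) (auto simp: yy j)
    also have "\<dots> = g p x (y j)" using j by (simp only: sum.delta finite_lessThan lessThan_iff if_True)
    finally show ?thesis by (simp add: tensor_diff_left x s y j)
  qed
  have "g p ?s ?z = 0"
    unfolding sy[OF tangent_diff[OF x s]]
  proof (rule sum.neutral, rule ballI)
    fix i assume "i \<in> {..<n}"
    then have i: "i < n" by simp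
    show "g p x (y i) * g p (y i) ?z = 0"
      using zy[OF i] tensor_sym[OF y[OF i] tangent_diff[OF x s]] by simp
  qed
  then have "g p ?z ?z = g p x ?z" by (simp add: tensor_diff_left[OF x s tangent_diff[OF x s]])
  also have "\<dots> = g p x x - g p ?s x" using tensor_sym[OF x s] by (simp add: tensor_diff_right x s)
  also have "g p ?s x = (\<Sum>i<n. (g p x (y i))\<^sup>2)"
    unfolding sy[OF x] by (rule sum.cong) (auto simp: power2_eq_square tensor_sym[OF y x])
  finally show ?thesis using metric_nonneg[OF tangent_diff[OF x s]] by simp
qed

section \<open>The distribution D and the vanishing of the gradient\<close>

context normal_field
begin

text \<open>The distribution \<open>D\<close>; recall that \<open>V = - \<phi> N\<close>.\<close>

definition holomorphic where
  "holomorphic p v \<longleftrightarrow> v \<in> tangent_space \<A> p \<and> \<eta> (\<psi> p) (d\<psi> p v) = 0 \<and>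
     g (\<psi> p) (\<phi> (\<psi> p) (N p)) (d\<psi> p v) = 0"

text \<open>Since m >= 2, the basis has two unit vectors orthogonal to \<xi>, and a combination of
  them is orthogonal to \<phi> N. It is extended and projected into D; then \<phi> X is tangent and
  in D again.\<close>

lemma holomorphic_fields:
  assumes p: "p \<in> \<Omega>" and b: "orthonormal_at p b" and b0: "d\<psi> p (b 0) = \<xi> (\<psi> p)"
  obtains T X Y where "open T" "p \<in> T" "T \<subseteq> \<Omega>" "vector_field_on \<A> T X" "vector_field_on \<A> T Y"
    "\<forall>q\<in>T. holomorphic q (X q) \<and> holomorphic q (Y q) \<and> d\<psi> q (Y q) = \<phi> (\<psi> q) (d\<psi> q (X q))"
    "g (\<psi> p) (d\<psi> p (X p)) (d\<psi> p (X p)) = 1"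
proof -
  let ?fN = "\<lambda>q. \<phi> (\<psi> q) (N q)"
  have bT: "b 1 \<in> tangent_space \<A> p" "b 2 \<in> tangent_space \<A> p"
    using basis_tangent[OF b] m2 by auto
  note dbT = M.differential_tangent[OF bT(1)] M.differential_tangent[OF bT(2)]
  have bb: "g (\<psi> p) (d\<psi> p (b i)) (d\<psi> p (b j)) = (if i = j then 1 else 0)" if "i \<in> {0, 1, 2}" "j \<in> {0, 1, 2}" for i j
    by (rule basis_orthonormal[OF b]) (use that m2 in auto)
  have eta_b: "\<eta> (\<psi> p) (d\<psi> p (b 1)) = 0" "\<eta> (\<psi> p) (d\<psi> p (b 2)) = 0"
    using bb[of 0 1] bb[of 0 2] b0 dbT by (auto simp: metric_xi simp del: One_nat_def)
  obtain x where x: "holomorphic p x" "g (\<psi> p) (d\<psi> p x) (d\<psi> p x) = 1"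
  proof (cases "g (\<psi> p) (?fN p) (d\<psi> p (b 1)) = 0")
    case True
    then show thesis using that[of "b 1"] bb[of 1 1] bT eta_b by (simp add: holomorphic_def del: One_nat_def)
  next
    case False
    define s where "s = g (\<psi> p) (?fN p) (d\<psi> p (b 1))"
    define t where "t = g (\<psi> p) (?fN p) (d\<psi> p (b 2))"
    define r where "r = sqrt (s\<^sup>2 + t\<^sup>2)"
    have r: "r > 0" "r * r = s\<^sup>2 + t\<^sup>2"
      using False unfolding r_def s_def[symmetric] by (auto simp: add_pos_nonneg)
    \<comment> \<open>A quarter turn of the projection of \<phi> N to the plane of b 1 and b 2,
      normalised by its length r.\<close>
    let ?x = "(t / r) *\<^sub>R b 1 - (s / r) *\<^sub>R b 2"
    have dx: "d\<psi> p ?x = (t / r) *\<^sub>R d\<psi> p (b 1) - (s / r) *\<^sub>R d\<psi> p (b 2)"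
      by (simp add: linear_diff[OF M.linear_differential] M.differential_scale)
    have "holomorphic p ?x"
      unfolding holomorphic_def dx
      using s_def[symmetric] t_def[symmetric]
      by (simp add: tangent_closure bT dbT eta_diff eta_scale eta_b tensor_simps phi_N[OF p] del: One_nat_def)
    moreover have "g (\<psi> p) (d\<psi> p ?x) (d\<psi> p ?x) = 1"
    proof -
      have "g (\<psi> p) (d\<psi> p ?x) (d\<psi> p ?x) = (t / r) * (t / r) + (s / r) * (s / r)"
        unfolding dx using bb[of 1 1] bb[of 1 2] bb[of 2 1] bb[of 2 2]
        by (simp add: tensor_simps tangent_closure dbT del: One_nat_def)
      also have "\<dots> = (t * t + s * s) / (r * r)" by (simp add: add_divide_distrib)
      also have "t * t + s * s = r * r" using r(2) by (simp add: power2_eq_square)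
      finally show ?thesis using r(1) by simp
    qed
    ultimately show thesis by (rule that)
  qed
  note xT = x(1)[unfolded holomorphic_def, THEN conjunct1]
  obtain S X0 where X0: "open S" "p \<in> S" "vector_field_on \<A> S X0" "X0 p = x" by (rule M.A.tangent_vector_extension[OF xT])
  let ?S = "S \<inter> \<Omega>"
  have S: "open ?S" "p \<in> ?S" "?S \<subseteq> \<Omega>" using X0 p open_\<Omega> by auto
  have dX0: "sect ?S (\<lambda>q. d\<psi> q (X0 q))"
    using M.differential_section[OF X0(1,3)] by (rule section_on_subset) simp
  have fN: "sect ?S ?fN"
    using phi_section[OF open_\<Omega> N_section] by (rule section_on_subset) simp
  \<comment> \<open>Removing the components along \<xi> and \<phi> N puts the extended field into D
    at nearby points; at p nothing changes, as x is already in D.\<close>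
  define Z where "Z q = d\<psi> q (X0 q) - g (\<psi> q) (\<xi> (\<psi> q)) (d\<psi> q (X0 q)) *\<^sub>R \<xi> (\<psi> q)
      - g (\<psi> q) (?fN q) (d\<psi> q (X0 q)) *\<^sub>R ?fN q" for q
  have sZ: "sect ?S Z"
    unfolding Z_def
    by (intro section_on_diff section_on_scale M.tensor_smooth_section S(1) dX0 fN xi_section)
  have Z: "g (\<psi> q) (Z q) (N q) = 0" "\<eta> (\<psi> q) (Z q) = 0" "g (\<psi> q) (?fN q) (Z q) = 0" if q: "q \<in> ?S" for q
  proof -
    have q': "q \<in> \<Omega>" using q by simp
    have X0q: "X0 q \<in> tangent_space \<A> q" using vector_field_on_tangent[OF X0(3)] q by simp
    note T = M.differential_tangent[OF X0q] N_tangent[OF q'] phi_N[OF q'] N_orthogonal'[OF q' X0q] eta_N[OF q']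
    show "g (\<psi> q) (Z q) (N q) = 0" "\<eta> (\<psi> q) (Z q) = 0" "g (\<psi> q) (?fN q) (Z q) = 0"
      unfolding Z_def by (simp_all add: tensor_simps structure_simps T)
  qed
  obtain T1 X where X: "open T1" "p \<in> T1" "T1 \<subseteq> ?S" "vector_field_on \<A> T1 X" "\<And>q. q \<in> T1 \<Longrightarrow> d\<psi> q (X q) = Z q"
    using lift_field[OF S sZ Z(1)] by auto
  have Xq: "X q \<in> tangent_space \<A> q" "d\<psi> q (X q) \<in> tangent_space \<B> (\<psi> q)" "d\<psi> q (X q) = Z q" "q \<in> \<Omega>" "q \<in> ?S"
    if "q \<in> T1" for q
    using vector_field_on_tangent[OF X(4) that] M.differential_tangent[OF vector_field_on_tangent[OF X(4) that]]
      X(5)[OF that] subsetD[OF X(3) that] by simp_all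
  have hX: "holomorphic q (X q)" if "q \<in> T1" for q
    using Z[OF Xq(5)[OF that]] Xq[OF that] by (simp add: holomorphic_def)
  have dX: "sect T1 (\<lambda>q. \<phi> (\<psi> q) (d\<psi> q (X q)))"
    by (rule phi_section[OF X(1) M.differential_section[OF X(1,4)]])
  \<comment> \<open>By skewness this pairing is -g(X, \<phi> N), which vanishes in D; so \<phi> X is
    tangent and can be lifted.\<close>
  have fXN: "g (\<psi> q) (\<phi> (\<psi> q) (d\<psi> q (X q))) (N q) = 0" if q: "q \<in> T1" for q
    using phi_skew[OF Xq(2)[OF q] N_tangent[OF Xq(4)[OF q]]] hX[OF q] tensor_sym[OF Xq(2)[OF q] phi_N(1)[OF Xq(4)[OF q]]]
    by (simp add: holomorphic_def)
  have T1: "T1 \<subseteq> \<Omega>" using X(3) by auto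
  obtain T Y where Y: "open T" "p \<in> T" "T \<subseteq> T1" "vector_field_on \<A> T Y" "\<And>q. q \<in> T \<Longrightarrow> d\<psi> q (Y q) = \<phi> (\<psi> q) (d\<psi> q (X q))"
    using lift_field[OF X(1,2) T1 dX fXN] by auto
  have hY: "holomorphic q (Y q)" if q: "q \<in> T" for q
  proof -
    have q1: "q \<in> T1" using q Y(3) by auto
    have "g (\<psi> q) (?fN q) (\<phi> (\<psi> q) (d\<psi> q (X q))) = 0"
      by (simp only: metric_phi_phi[OF N_tangent[OF Xq(4)[OF q1]] Xq(2)[OF q1]]
          N_orthogonal[OF Xq(4)[OF q1] Xq(1)[OF q1]] eta_N[OF Xq(4)[OF q1]] mult_zero_left diff_zero)
    then show ?thesis
      using vector_field_on_tangent[OF Y(4) q] eta_phi[OF Xq(2)[OF q1]] by (simp add: holomorphic_def Y(5)[OF q])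
  qed
  have "Z p = d\<psi> p x"
    using x(1) M.differential_tangent[OF xT] unfolding Z_def holomorphic_def by (simp add: X0(4) metric_xi)
  then have "g (\<psi> p) (d\<psi> p (X p)) (d\<psi> p (X p)) = 1" using x(2) Xq(3)[OF X(2)] by simp
  then show thesis
    by (intro that[OF Y(1,2) order_trans[OF Y(3) T1] vector_field_on_subset[OF X(4) Y(3)] Y(4)] ballI conjI
        hX[OF subsetD[OF Y(3)]] hY Y(5))
qed

text \<open>The contact condition: D is not integrable. As \<eta> vanishes on both fields, only the
  derivative -\<phi> of \<xi> contributes to each half of the torsion formula, and skewness of
  \<phi> doubles the result.\<close>

lemma eta_bracket:
  assumes T: "open T" "p \<in> T" and X: "vector_field_on \<A> T X" and Y: "vector_field_on \<A> T Y"
    and hX: "\<And>q. q \<in> T \<Longrightarrow> holomorphic q (X q)" and hY: "\<And>q. q \<in> T \<Longrightarrow> holomorphic q (Y q)"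
  shows "\<eta> (\<psi> p) (d\<psi> p (lie_bracket \<A> X Y p)) = 2 * g (\<psi> p) (\<phi> (\<psi> p) (d\<psi> p (X p))) (d\<psi> p (Y p))"
proof -
  have D_eta: "\<eta> (\<psi> p) (D p v (\<lambda>q. d\<psi> q (Y q))) = g (\<psi> p) (\<phi> (\<psi> p) (d\<psi> p v)) (d\<psi> p (Y p))"
    if v: "v \<in> tangent_space \<A> p" and Y: "vector_field_on \<A> T Y" and hY: "\<And>q. q \<in> T \<Longrightarrow> holomorphic q (Y q)" for v Y
  proof -
    note dY = M.differential_section[OF T(1) Y]
    have dYp: "d\<psi> q (Y q) \<in> tangent_space \<B> (\<psi> q)" if "q \<in> T" for q by (rule section_on_tangent[OF dY that])
    have "v (\<lambda>q. g (\<psi> q) (\<xi> (\<psi> q)) (d\<psi> q (Y q))) = v (\<lambda>q. 0)"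
      by (rule M.A.tangent_vector_cong[OF v T]) (use hY dYp in \<open>simp add: holomorphic_def metric_xi\<close>)
    then show ?thesis
      using M.D_metric[OF T xi_section dY v] tangent_vector_const[OF v] M.D_tangent[OF T dY v]
      by (simp add: D_xi[OF v] metric_xi tensor_minus_left dYp[OF T(2)] phi_tangent M.differential_tangent[OF v])
  qed
  have Xp: "X p \<in> tangent_space \<A> p" "Y p \<in> tangent_space \<A> p"
    using vector_field_on_tangent X Y T(2) by auto
  note dX = M.differential_tangent[OF Xp(1)] and dY = M.differential_tangent[OF Xp(2)]
  have "g (\<psi> p) (\<phi> (\<psi> p) (d\<psi> p (Y p))) (d\<psi> p (X p)) = - g (\<psi> p) (\<phi> (\<psi> p) (d\<psi> p (X p))) (d\<psi> p (Y p))"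
    using phi_skew[OF dY dX] tensor_sym[OF dY phi_tangent[OF dX]] by simp
  then show ?thesis
    unfolding M.D_torsion[OF T X Y, symmetric]
    by (simp add: eta_diff M.D_tangent[OF T] M.differential_section[OF T(1)] X Y Xp D_eta hX hY)
qed

lemma gradient_zero:
  assumes p: "p \<in> \<Omega>" and b: "orthonormal_at p b" "d\<psi> p (b 0) = \<xi> (\<psi> p)"
    and f: "smooth_fun_on \<A> \<Omega> f"
    and grad: "\<And>q v. q \<in> \<Omega> \<Longrightarrow> v \<in> tangent_space \<A> q \<Longrightarrow> v f = \<alpha> q * \<eta> (\<psi> q) (d\<psi> q v)"
    and v: "v \<in> tangent_space \<A> p"
  shows "v f = 0"
proof -
  obtain T X Y where T: "open T" "p \<in> T" "T \<subseteq> \<Omega>" "vector_field_on \<A> T X" "vector_field_on \<A> T Y"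
    "\<forall>q\<in>T. holomorphic q (X q) \<and> holomorphic q (Y q) \<and> d\<psi> q (Y q) = \<phi> (\<psi> q) (d\<psi> q (X q))"
    "g (\<psi> p) (d\<psi> p (X p)) (d\<psi> p (X p)) = 1"
    by (rule holomorphic_fields[OF p b])
  have hX: "holomorphic q (X q)" and hY: "holomorphic q (Y q)" if "q \<in> T" for q using T(6) that by auto
  have XY: "X p \<in> tangent_space \<A> p" "Y p \<in> tangent_space \<A> p" using hX hY T(2) by (auto simp: holomorphic_def)
  have Xf: "X q f = 0" and Yf: "Y q f = 0" if "q \<in> T" for q
    using grad[of q "X q"] grad[of q "Y q"] subsetD[OF T(3) that] hX[OF that] hY[OF that]
    by (auto simp: holomorphic_def)
  have "X p (\<lambda>q. Y q f) = X p (\<lambda>q. 0)" by (rule M.A.tangent_vector_cong[OF XY(1) T(1,2)]) (rule Yf)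
  moreover have "Y p (\<lambda>q. X q f) = Y p (\<lambda>q. 0)" by (rule M.A.tangent_vector_cong[OF XY(2) T(1,2)]) (rule Xf)
  ultimately have "lie_bracket \<A> X Y p f = 0"
    using tangent_vector_const[OF XY(1)] tangent_vector_const[OF XY(2)] by (simp add: lie_bracket_def)
  then have "\<alpha> p * \<eta> (\<psi> p) (d\<psi> p (lie_bracket \<A> X Y p)) = 0"
    using grad[OF p M.A.lie_bracket_tangent[OF T(1,2,4,5)]] by simp
  \<comment> \<open>Here Y is \<phi> X with X of unit length and orthogonal to \<xi>, so g(\<phi> X,
    Y) = 1.\<close>
  moreover have "\<eta> (\<psi> p) (d\<psi> p (lie_bracket \<A> X Y p)) = 2"
    using eta_bracket[OF T(1,2,4,5) hX hY] T(6)[rule_format, OF T(2)] hX[OF T(2)] T(7)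
    by (simp add: metric_phi_phi M.differential_tangent XY holomorphic_def)
  ultimately have "\<alpha> p = 0" by simp
  then show ?thesis using grad[OF p v] by simp
qed

end

section \<open>Pseudo-Hopf hypersurfaces, the Codazzi relation and bounds for the shape
  operator\<close>

locale hopf_normal_field = normal_field +
  assumes pseudo_hopf: "pseudo_hopf \<A> \<B> \<psi> \<phi> \<xi> g D"
begin

text \<open>The vector w is V, and \<open>\<beta>\<close> is the entry g(A V, V). The hypothesis
  leaves only a \<xi>-component besides it, which self-adjointness and A \<xi> = -V fix to g(A V,
  \<xi>) = -1.\<close>

lemma hopf:
  assumes p: "p \<in> \<Omega>"
  obtains w \<beta> where "w \<in> tangent_space \<A> p" "d\<psi> p w = - \<phi> (\<psi> p) (N p)"
    "D p w N = \<xi> (\<psi> p) + \<beta> *\<^sub>R \<phi> (\<psi> p) (N p)"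
proof -
  note fN = phi_N[OF p]
  obtain v where v: "v \<in> tangent_space \<A> p" "d\<psi> p v = \<xi> (\<psi> p)" using xi_image by (metis imageE)
  obtain w where w: "w \<in> tangent_space \<A> p" "d\<psi> p w = - \<phi> (\<psi> p) (N p)"
    by (rule tangential_lift[OF p, of "- \<phi> (\<psi> p) (N p)"])
      (simp_all add: tangent_minus fN tensor_minus_left N_tangent[OF p])
  note DT = DN_tangent[OF p w(1)]
  obtain z where z: "z \<in> tangent_space \<A> p" "d\<psi> p z = - D p w N"
    by (rule tangential_lift[OF p, of "- D p w N"])
      (simp_all add: tangent_minus DT tensor_minus_left N_tangent[OF p] DN_normal[OF p w(1)])
  have lifts: "tangent_lift \<A> \<B> \<psi> p (\<xi> (\<psi> p)) = v" "tangent_lift \<A> \<B> \<psi> p (- \<phi> (\<psi> p) (N p)) = w"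
    "shape_operator \<A> \<B> \<psi> D N p w = z"
    unfolding shape_operator_def using v w z by (auto intro: tangent_lift_eq)
  have "shape_operator \<A> \<B> \<psi> D N p ` span {v, w} \<subseteq> span {v, w}"
    using pseudo_hopf[unfolded pseudo_hopf_def, rule_format, OF open_\<Omega> normal p] lifts(1,2) by (simp add: Let_def)
  moreover have "w \<in> span {v, w}" by (simp add: span_base)
  ultimately have "z \<in> span {v, w}" using lifts(3) by auto
  then obtain k where "z - k *\<^sub>R v \<in> span {w}" by (auto simp: span_insert)
  then obtain l where "z - k *\<^sub>R v = l *\<^sub>R w" by (auto simp: span_singleton)
  then have "z = k *\<^sub>R v + l *\<^sub>R w" by (simp add: algebra_simps)
  then have "- D p w N = k *\<^sub>R \<xi> (\<psi> p) + l *\<^sub>R (- \<phi> (\<psi> p) (N p))"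
    using z(2) v(2) w(2) by (simp add: M.differential_add M.differential_scale)
  then have "- (- D p w N) = - (k *\<^sub>R \<xi> (\<psi> p) + l *\<^sub>R (- \<phi> (\<psi> p) (N p)))" by (rule arg_cong)
  then have DN: "D p w N = - k *\<^sub>R \<xi> (\<psi> p) + l *\<^sub>R \<phi> (\<psi> p) (N p)" by simp
  have "\<eta> (\<psi> p) (D p w N) = 1"
    by (simp add: eta_DN[OF p w(1)] w(2) tensor_minus_right fN)
  then have "k = -1" by (simp add: DN structure_simps fN)
  with DN have "D p w N = \<xi> (\<psi> p) + l *\<^sub>R \<phi> (\<psi> p) (N p)" by simp
  then show thesis by (rule that[OF w])
qed

text \<open>A maps D into D: self-adjointness carries the invariance of the span of \<xi> and V over
  to its orthogonal complement.\<close>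

lemma DN_holomorphic:
  assumes p: "p \<in> \<Omega>" and v: "holomorphic p v"
  shows "\<eta> (\<psi> p) (D p v N) = 0" "g (\<psi> p) (D p v N) (\<phi> (\<psi> p) (N p)) = 0"
proof -
  have vT: "v \<in> tangent_space \<A> p" and v0: "\<eta> (\<psi> p) (d\<psi> p v) = 0" "g (\<psi> p) (\<phi> (\<psi> p) (N p)) (d\<psi> p v) = 0"
    using v by (auto simp: holomorphic_def)
  note dv = M.differential_tangent[OF vT]
  show "\<eta> (\<psi> p) (D p v N) = 0" by (simp add: eta_DN[OF p vT] v0)
  obtain w \<beta> where w: "w \<in> tangent_space \<A> p" "d\<psi> p w = - \<phi> (\<psi> p) (N p)"
    "D p w N = \<xi> (\<psi> p) + \<beta> *\<^sub>R \<phi> (\<psi> p) (N p)" by (rule hopf[OF p])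
  have "- g (\<psi> p) (D p v N) (\<phi> (\<psi> p) (N p)) = g (\<psi> p) (D p w N) (d\<psi> p v)"
    using DN_sym[OF p vT w(1)] by (simp add: w(2) tensor_minus_right DN_tangent[OF p vT] phi_N[OF p])
  also have "\<dots> = 0" by (simp add: w(3) tensor_simps structure_simps dv phi_N[OF p] v0)
  finally show "g (\<psi> p) (D p v N) (\<phi> (\<psi> p) (N p)) = 0" by simp
qed

text \<open>The curvature identity for the section N, paired with \<phi> N. Differentiating the
  orthogonalities of \<phi> N to D_Y N and to d\<psi> Y removes all second derivatives, leaving
  terms quadratic in A. The coefficient (c + 3) / 2 is the sum of (c - 1) / 2 from the curvature and
  2 from the \<xi>-component of the bracket.\<close>

lemma Codazzi:
  assumes T: "open T" "p \<in> T" "T \<subseteq> \<Omega>" and X: "vector_field_on \<A> T X" and Y: "vector_field_on \<A> T Y"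
    and hX: "\<And>q. q \<in> T \<Longrightarrow> holomorphic q (X q)" and hY: "\<And>q. q \<in> T \<Longrightarrow> holomorphic q (Y q)"
    and w: "w \<in> tangent_space \<A> p" "d\<psi> p w = - \<phi> (\<psi> p) (N p)" "D p w N = \<xi> (\<psi> p) + \<beta> *\<^sub>R \<phi> (\<psi> p) (N p)"
  shows "2 * g (\<psi> p) (D p (X p) N) (\<phi> (\<psi> p) (D p (Y p) N))
      + \<beta> * (g (\<psi> p) (\<phi> (\<psi> p) (D p (Y p) N)) (d\<psi> p (X p)) - g (\<psi> p) (\<phi> (\<psi> p) (D p (X p) N)) (d\<psi> p (Y p)))
    = - (c + 3) / 2 * g (\<psi> p) (\<phi> (\<psi> p) (d\<psi> p (X p))) (d\<psi> p (Y p))"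
proof -
  let ?fN = "\<lambda>q. \<phi> (\<psi> q) (N q)"
  have p: "p \<in> \<Omega>" using T by auto
  note fN = phi_N[OF p] and Np = N_tangent[OF p]
  have sN: "sect T N" using N_section T(3) by (rule section_on_subset)
  have sfN: "sect T ?fN" by (rule phi_section[OF T(1) sN])
  have Xp: "X p \<in> tangent_space \<A> p" and Yp: "Y p \<in> tangent_space \<A> p"
    using vector_field_on_tangent X Y T(2) by auto
  note dX = M.differential_tangent[OF Xp] and dY = M.differential_tangent[OF Yp]
  note DX = DN_tangent[OF p Xp] and DY = DN_tangent[OF p Yp]
  \<comment> \<open>The two extra terms of \<open>D_phi\<close> vanish, since N is orthogonal to the
    hypersurface and to \<xi>.\<close>
  have DfN: "D p v ?fN = \<phi> (\<psi> p) (D p v N)" if v: "v \<in> tangent_space \<A> p" for v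
    by (simp add: D_phi[OF T(1,2) sN v] N_orthogonal'[OF p v] eta_N[OF p])
  have second: "g (\<psi> p) (D p v (\<lambda>q. D q (Y q) N)) (?fN p) = - g (\<psi> p) (D p (Y p) N) (\<phi> (\<psi> p) (D p v N))"
    if v: "v \<in> tangent_space \<A> p" and Y: "vector_field_on \<A> T Y" and hY: "\<And>q. q \<in> T \<Longrightarrow> holomorphic q (Y q)" for v Y
  proof -
    have "v (\<lambda>q. g (\<psi> q) (D q (Y q) N) (?fN q)) = v (\<lambda>q. 0)"
      by (rule M.A.tangent_vector_cong[OF v T(1,2)]) (use DN_holomorphic(2) hY T(3) in auto)
    then show ?thesis
      using M.D_metric[OF T(1,2) M.D_section[OF T(1) Y sN] sfN v] tangent_vector_const[OF v] DfN[OF v] by simp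
  qed
  have D_fN: "g (\<psi> p) (?fN p) (D p v (\<lambda>q. d\<psi> q (Y q))) = - g (\<psi> p) (\<phi> (\<psi> p) (D p v N)) (d\<psi> p (Y p))"
    if v: "v \<in> tangent_space \<A> p" and Y: "vector_field_on \<A> T Y" and hY: "\<And>q. q \<in> T \<Longrightarrow> holomorphic q (Y q)" for v Y
  proof -
    have "v (\<lambda>q. g (\<psi> q) (?fN q) (d\<psi> q (Y q))) = v (\<lambda>q. 0)"
      by (rule M.A.tangent_vector_cong[OF v T(1,2)]) (use hY in \<open>simp add: holomorphic_def\<close>)
    then show ?thesis
      using M.D_metric[OF T(1,2) sfN M.differential_section[OF T(1) Y] v] tangent_vector_const[OF v] DfN[OF v] by simp
  qed
  define L where "L = lie_bracket \<A> X Y p"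
  have L: "L \<in> tangent_space \<A> p" unfolding L_def by (rule M.A.lie_bracket_tangent[OF T(1,2) X Y])
  have T': "D p (X p) (\<lambda>q. d\<psi> q (Y q)) \<in> tangent_space \<B> (\<psi> p)" "D p (Y p) (\<lambda>q. d\<psi> q (X q)) \<in> tangent_space \<B> (\<psi> p)"
    by (rule M.D_tangent[OF T(1,2) M.differential_section[OF T(1) Y] Xp]
        M.D_tangent[OF T(1,2) M.differential_section[OF T(1) X] Yp])+
  have fNL: "g (\<psi> p) (?fN p) (d\<psi> p L) = - g (\<psi> p) (\<phi> (\<psi> p) (D p (X p) N)) (d\<psi> p (Y p))
      + g (\<psi> p) (\<phi> (\<psi> p) (D p (Y p) N)) (d\<psi> p (X p))"
    unfolding L_def M.D_torsion[OF T(1,2) X Y, symmetric]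
    by (simp add: tensor_diff_right T' fN D_fN[OF Xp Y hY] D_fN[OF Yp X hX])
  have "- g (\<psi> p) (D p L N) (?fN p) = g (\<psi> p) (D p w N) (d\<psi> p L)"
    using DN_sym[OF p L w(1)] by (simp add: w(2) tensor_minus_right DN_tangent[OF p L] fN)
  also have "\<dots> = \<eta> (\<psi> p) (d\<psi> p L) + \<beta> * g (\<psi> p) (?fN p) (d\<psi> p L)"
    by (simp add: w(3) tensor_simps structure_simps fN M.differential_tangent[OF L])
  also have "\<eta> (\<psi> p) (d\<psi> p L) = 2 * g (\<psi> p) (\<phi> (\<psi> p) (d\<psi> p (X p))) (d\<psi> p (Y p))"
    unfolding L_def by (rule eta_bracket[OF T(1,2) X Y hX hY])
  finally have DLN: "- g (\<psi> p) (D p L N) (?fN p) = 2 * g (\<psi> p) (\<phi> (\<psi> p) (d\<psi> p (X p))) (d\<psi> p (Y p)) + \<beta> * g (\<psi> p) (?fN p) (d\<psi> p L)" .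
  have "D p (X p) (\<lambda>q. D q (Y q) N) - D p (Y p) (\<lambda>q. D q (X q) N) - D p L N
      = curv (\<psi> p) (d\<psi> p (X p)) (d\<psi> p (Y p)) (N p)"
  proof -
    obtain W1 F where F: "open W1" "\<psi> p \<in> W1" "vector_field_on \<B> W1 F" "F (\<psi> p) = d\<psi> p (X p)"
      by (rule tangent_vector_extension[OF dX])
    obtain W2 G where G: "open W2" "\<psi> p \<in> W2" "vector_field_on \<B> W2 G" "G (\<psi> p) = d\<psi> p (Y p)"
      by (rule tangent_vector_extension[OF dY])
    obtain W3 E where E: "open W3" "\<psi> p \<in> W3" "vector_field_on \<B> W3 E" "E (\<psi> p) = N p"
      by (rule tangent_vector_extension[OF Np])
    let ?W = "W1 \<inter> W2 \<inter> W3"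
    have W: "open ?W" "\<psi> p \<in> ?W" using F G E by auto
    have V: "vector_field_on \<B> ?W F" "vector_field_on \<B> ?W G" "vector_field_on \<B> ?W E"
      using F(3) G(3) E(3) by (auto elim: vector_field_on_subset)
    show ?thesis
      unfolding L_def M.D_curvature[OF T(1,2) X Y sN W V(1) F(4) V(2) G(4) V(3) E(4)]
        curvature_eq[OF W(1) V W(2)] F(4) G(4) E(4) ..
  qed
  then have "g (\<psi> p) (D p (X p) (\<lambda>q. D q (Y q) N)) (?fN p) - g (\<psi> p) (D p (Y p) (\<lambda>q. D q (X q) N)) (?fN p)
      - g (\<psi> p) (D p L N) (?fN p) = g (\<psi> p) (curv (\<psi> p) (d\<psi> p (X p)) (d\<psi> p (Y p)) (N p)) (?fN p)"
    using M.D_tangent[OF T(1,2) M.D_section[OF T(1) Y sN] Xp] M.D_tangent[OF T(1,2) M.D_section[OF T(1) X sN] Yp]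
      DN_tangent[OF p L] fN(1) by (simp add: tensor_diff_left tangent_diff flip: tensor_diff_left)
  moreover have "g (\<psi> p) (curv (\<psi> p) (d\<psi> p (X p)) (d\<psi> p (Y p)) (N p)) (?fN p) =
      - (c - 1) / 2 * g (\<psi> p) (\<phi> (\<psi> p) (d\<psi> p (X p))) (d\<psi> p (Y p))"
  proof -
    have "g (\<psi> p) (\<phi> (\<psi> p) (d\<psi> p (X p))) (N p) = 0" "g (\<psi> p) (\<phi> (\<psi> p) (d\<psi> p (Y p))) (N p) = 0"
      using phi_skew[OF dX Np] phi_skew[OF dY Np] tensor_sym[OF dX fN(1)] tensor_sym[OF dY fN(1)] hX[OF T(2)] hY[OF T(2)]
      by (auto simp: holomorphic_def)
    then show ?thesis
      by (simp add: curv_inner[OF dX dY Np fN(1)] eta_N[OF p] N_orthogonal'[OF p Xp] N_orthogonal'[OF p Yp] fN)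
        (simp add: algebra_simps)
  qed
  moreover have "g (\<psi> p) (D p (Y p) N) (\<phi> (\<psi> p) (D p (X p) N)) = - g (\<psi> p) (D p (X p) N) (\<phi> (\<psi> p) (D p (Y p) N))"
    using phi_skew[OF DY DX] tensor_sym[OF DX phi_tangent[OF DY]] by simp
  ultimately show ?thesis
    using second[OF Xp Y hY] second[OF Yp X hX] DLN fNL by (simp add: field_simps)
qed

text \<open>\<open>|A|\<^sup>2\<close>, because \<open>A X\<close> is the tangent vector with differential \<open>- D\<^sub>X N\<close>.\<close>

definition shape_norm where
  "shape_norm e p = (\<Sum>i<2 * m. g (\<psi> p) (D p (e i) N) (D p (e i) N))"

text \<open>The frame in which the Laplacian is computed need not contain the adapted vectors y.
  Self-adjointness exchanges the roles of b and y in the double sum of squared entries, and Bessel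
  bounds the sum over y for each b i.\<close>

lemma shape_norm_ge:
  fixes n :: nat
  assumes p: "p \<in> \<Omega>" and b: "orthonormal_at p b"
    and y: "\<And>k. k < n \<Longrightarrow> y k \<in> tangent_space \<A> p"
    and yy: "\<And>k l. k < n \<Longrightarrow> l < n \<Longrightarrow> g (\<psi> p) (d\<psi> p (y k)) (d\<psi> p (y l)) = (if k = l then 1 else 0)"
  shows "(\<Sum>k<n. g (\<psi> p) (D p (y k) N) (D p (y k) N)) \<le> shape_norm b p"
proof -
  have "(\<Sum>k<n. g (\<psi> p) (D p (y k) N) (D p (y k) N)) = (\<Sum>k<n. \<Sum>i<2 * m. (g (\<psi> p) (D p (b i) N) (d\<psi> p (y k)))\<^sup>2)"
  proof (rule sum.cong)
    fix k assume "k \<in> {..<n}"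
    then have k: "y k \<in> tangent_space \<A> p" using y by simp
    have "g (\<psi> p) (D p (y k) N) (D p (y k) N) = (\<Sum>i<2 * m. g (\<psi> p) (D p (y k) N) (d\<psi> p (b i)) * g (\<psi> p) (D p (y k) N) (d\<psi> p (b i)))"
      by (rule tangential_Parseval[OF p b DN_tangent[OF p k] DN_normal[OF p k] DN_tangent[OF p k]])
    also have "\<dots> = (\<Sum>i<2 * m. (g (\<psi> p) (D p (b i) N) (d\<psi> p (y k)))\<^sup>2)"
      by (rule sum.cong) (auto simp: power2_eq_square DN_sym[OF p k basis_tangent[OF b]])
    finally show "g (\<psi> p) (D p (y k) N) (D p (y k) N) = (\<Sum>i<2 * m. (g (\<psi> p) (D p (b i) N) (d\<psi> p (y k)))\<^sup>2)" .
  qed simp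
  also have "\<dots> = (\<Sum>i<2 * m. \<Sum>k<n. (g (\<psi> p) (D p (b i) N) (d\<psi> p (y k)))\<^sup>2)" by (rule sum.swap)
  also have "\<dots> \<le> shape_norm b p"
    unfolding shape_norm_def
    by (rule sum_mono, rule Bessel) (auto intro: DN_tangent[OF p] basis_tangent[OF b] M.differential_tangent y simp: yy)
  finally show ?thesis .
qed

text \<open>The two lower bounds come from the Codazzi relation for the pair \<open>X\<close>, \<open>\<phi> X\<close> and from
  \<open>A \<xi> = \<phi> N\<close>, which makes \<open>\<xi>\<close> and \<open>\<phi> N\<close> contribute at least 2 to the squared norm of \<open>A\<close>.\<close>

lemma shape_norm_bounds:
  assumes p: "p \<in> \<Omega>" and e: "orthonormal_at p e" and b: "orthonormal_at p b" "d\<psi> p (b 0) = \<xi> (\<psi> p)"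
  shows "shape_norm e p - 2 \<ge> (c + 3) / 4" "shape_norm e p - 2 \<ge> - 2 * ((c + 3) / 4)"
proof -
  let ?g = "g (\<psi> p)" and ?f = "\<phi> (\<psi> p)"
  obtain T X Y where T: "open T" "p \<in> T" "T \<subseteq> \<Omega>" "vector_field_on \<A> T X" "vector_field_on \<A> T Y"
    "\<forall>q\<in>T. holomorphic q (X q) \<and> holomorphic q (Y q) \<and> d\<psi> q (Y q) = \<phi> (\<psi> q) (d\<psi> q (X q))"
    "g (\<psi> p) (d\<psi> p (X p)) (d\<psi> p (X p)) = 1"
    by (rule holomorphic_fields[OF p b])
  have hX: "holomorphic q (X q)" and hY: "holomorphic q (Y q)" if "q \<in> T" for q using T(6) that by auto
  have dYX: "d\<psi> p (Y p) = ?f (d\<psi> p (X p))" using T(6) T(2) by simp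
  have Xp: "X p \<in> tangent_space \<A> p" "\<eta> (\<psi> p) (d\<psi> p (X p)) = 0" "?g (?f (N p)) (d\<psi> p (X p)) = 0"
    and Yp: "Y p \<in> tangent_space \<A> p" "\<eta> (\<psi> p) (d\<psi> p (Y p)) = 0" "?g (?f (N p)) (d\<psi> p (Y p)) = 0"
    using hX[OF T(2)] hY[OF T(2)] by (auto simp: holomorphic_def)
  note dX = M.differential_tangent[OF Xp(1)] and dY = M.differential_tangent[OF Yp(1)] and fN = phi_N[OF p]
  have YY: "?g (d\<psi> p (Y p)) (d\<psi> p (Y p)) = 1"
    by (simp add: dYX metric_phi_phi dX Xp(2) T(7))
  have XY: "?g (d\<psi> p (X p)) (d\<psi> p (Y p)) = 0" "?g (d\<psi> p (Y p)) (d\<psi> p (X p)) = 0"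
    by (simp_all add: dYX phi_self[OF dX])
  have fN': "?g (d\<psi> p (X p)) (?f (N p)) = 0" "?g (d\<psi> p (Y p)) (?f (N p)) = 0"
    using Xp(3) Yp(3) tensor_sym[OF dX fN(1)] tensor_sym[OF dY fN(1)] by auto
  obtain w \<beta> where w: "w \<in> tangent_space \<A> p" "d\<psi> p w = - ?f (N p)" "D p w N = \<xi> (\<psi> p) + \<beta> *\<^sub>R ?f (N p)"
    by (rule hopf[OF p])
  have b0: "b 0 \<in> tangent_space \<A> p" using basis_tangent[OF b(1)] m2 by simp
  define u where "u = D p (X p) N"
  define v where "v = D p (Y p) N"
  define z where "z = ?f v"
  have uT: "u \<in> tangent_space \<B> (\<psi> p)" and vT: "v \<in> tangent_space \<B> (\<psi> p)" and zT: "z \<in> tangent_space \<B> (\<psi> p)"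
    unfolding u_def v_def z_def by (simp_all add: DN_tangent[OF p] Xp Yp phi_tangent)
  have eta0: "\<eta> (\<psi> p) v = 0" "\<eta> (\<psi> p) u = 0" unfolding u_def v_def
    using DN_holomorphic(1)[OF p hX[OF T(2)]] DN_holomorphic(1)[OF p hY[OF T(2)]] by auto
  have zz: "?g z z = ?g v v" unfolding z_def by (simp add: metric_phi_phi vT eta0)
  \<comment> \<open>The adapted orthonormal system \<xi>, V, X, \<phi> X.\<close>
  define y where "y k = (if k = 0 then b 0 else if k = 1 then w else if k = 2 then X p else Y p)" for k :: nat
  have "(\<Sum>k<4. ?g (D p (y k) N) (D p (y k) N)) \<le> shape_norm e p"
  proof (rule shape_norm_ge[OF p e])
    show "y k \<in> tangent_space \<A> p" for k using b0 w(1) Xp(1) Yp(1) by (simp add: y_def)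
    have dy: "d\<psi> p (y k) = (if k = 0 then \<xi> (\<psi> p) else if k = 1 then - ?f (N p) else if k = 2 then d\<psi> p (X p) else d\<psi> p (Y p))" for k
      by (simp add: y_def b(2) w(2))
    show "?g (d\<psi> p (y k)) (d\<psi> p (y l)) = (if k = l then 1 else 0)" if "k < 4" "l < 4" for k l
    proof -
      have "k \<in> {0, 1, 2, 3}" "l \<in> {0, 1, 2, 3}" using that by auto
      then show ?thesis
        unfolding dy
        by (auto simp: tensor_simps structure_simps dX dY fN fN' Xp Yp YY XY T(7))
    qed
  qed
  \<comment> \<open>The column of \<xi> contributes 1 and that of V contributes 1 + \<beta>^2; the
    surplus over 2 is what the bounds use.\<close>
  moreover have "(\<Sum>k<4. ?g (D p (y k) N) (D p (y k) N)) = 2 + \<beta>\<^sup>2 + ?g u u + ?g v v"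
  proof -
    have "(\<Sum>k<4. ?g (D p (y k) N) (D p (y k) N)) =
        ?g (D p (b 0) N) (D p (b 0) N) + ?g (D p w N) (D p w N) + ?g u u + ?g v v"
      by (simp add: y_def u_def v_def eval_nat_numeral lessThan_Suc)
    also have "?g (D p (b 0) N) (D p (b 0) N) = 1"
      by (simp add: DN_xi[OF p b0 b(2)] tensor_simps structure_simps fN)
    also have "?g (D p w N) (D p w N) = 1 + \<beta>\<^sup>2"
      by (simp add: w(3) tensor_simps structure_simps fN power2_eq_square)
    finally show ?thesis by simp
  qed
  ultimately have Q: "\<beta>\<^sup>2 + (?g u u + ?g z z) \<le> shape_norm e p - 2" using zz by simp
  define s where "s = ?g u z"
  define t where "t = ?g (u - z) (d\<psi> p (X p))"
  define n where "n = ?g u u + ?g z z"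
  have "2 * s + \<beta> * (?g z (d\<psi> p (X p)) - ?g (?f u) (d\<psi> p (Y p))) = - (c + 3) / 2"
    using Codazzi[OF T(1-5) hX hY w] YY by (simp add: u_def v_def z_def s_def dYX)
  moreover have "?g (?f u) (d\<psi> p (Y p)) = ?g u (d\<psi> p (X p))"
    by (simp add: dYX metric_phi_phi uT dX Xp(2))
  \<comment> \<open>Codazzi for X and \<phi> X, solved for K: the product s of u and z, and the
    product of \<beta> with the X-component t of u - z.\<close>
  ultimately have kappa: "(c + 3) / 4 = - s + \<beta> * t / 2"
    by (simp add: t_def tensor_diff_left uT zT dX field_simps)
  \<comment> \<open>Cauchy-Schwarz for u - z against the unit vector X, written as nonnegativity of
    the residual.\<close>
  have "0 \<le> ?g (u - z - t *\<^sub>R d\<psi> p (X p)) (u - z - t *\<^sub>R d\<psi> p (X p))"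
    by (rule metric_nonneg) (simp add: tangent_closure uT zT dX)
  also have "\<dots> = ?g (u - z) (u - z) - t\<^sup>2"
    using tensor_sym[OF dX tangent_diff[OF uT zT]] T(7)
    by (simp add: tensor_diff_left[of "u - z"] tensor_diff_right[of "u - z"] tensor_scale_left tensor_scale_right
        tangent_closure uT zT dX t_def[symmetric] power2_eq_square)
  also have "?g (u - z) (u - z) = n - 2 * s"
    using tensor_sym[OF uT zT] by (simp add: tensor_simps tangent_closure uT zT n_def s_def)
  finally have t: "t\<^sup>2 \<le> n - 2 * s" by simp
  have "0 \<le> ?g (u + z) (u + z)" by (rule metric_nonneg[OF tangent_add[OF uT zT]])
  also have "\<dots> = n + 2 * s"
    using tensor_sym[OF uT zT] by (simp add: tensor_simps tangent_closure uT zT n_def s_def)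
  finally have s: "0 \<le> n + 2 * s" .
  \<comment> \<open>Expanded squares of \<beta> - t / 2 and \<beta> + t / 2, one for each sign of
    the mixed term.\<close>
  have bt: "\<beta> * t \<le> \<beta>\<^sup>2 + t\<^sup>2 / 4" "0 \<le> \<beta>\<^sup>2 + \<beta> * t + t\<^sup>2 / 4"
    using zero_le_power2[of "\<beta> - t / 2"] zero_le_power2[of "\<beta> + t / 2"]
    by (simp_all add: power2_eq_square algebra_simps)
  show "shape_norm e p - 2 \<ge> (c + 3) / 4"
    unfolding kappa using Q[folded n_def] s t bt(1) zero_le_power2[of \<beta>] zero_le_power2[of t] by linarith
  \<comment> \<open>The chain is 2 s - \<beta> t \<le> 2 s + \<beta>^2 + t^2 / 4 \<le> n +
    \<beta>^2, the last step by t^2 \<le> n - 2 s.\<close>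
  have "- 2 * ((c + 3) / 4) = 2 * s - \<beta> * t" unfolding kappa by (simp add: algebra_simps)
  then show "shape_norm e p - 2 \<ge> - 2 * ((c + 3) / 4)"
    using Q[folded n_def] t bt(2) zero_le_power2[of t] by linarith
qed

end

section \<open>The normal component of the Ricci-biharmonic equation\<close>

context hopf_normal_field
begin

context
  fixes f
  assumes f: "smooth_fun_on \<A> \<Omega> f" and H: "\<And>q. q \<in> \<Omega> \<Longrightarrow> H q = f q *\<^sub>R N q"
    and df: "\<And>q v. q \<in> \<Omega> \<Longrightarrow> v \<in> tangent_space \<A> q \<Longrightarrow> v f = 0"
begin

text \<open>Derivatives of f vanish, so only N is differentiated, and \<eta> N = 0 leaves one of the
  two terms of \<open>correction\<close>.\<close>

lemma Ds_H:
  assumes q: "q \<in> \<Omega>" and v: "v \<in> tangent_space \<A> q"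
  shows "Ds q v H = f q *\<^sub>R (D q v N - (a * \<eta> (\<psi> q) (d\<psi> q v)) *\<^sub>R \<phi> (\<psi> q) (N q))"
proof -
  have "Ds q v H = Ds q v (\<lambda>r. f r *\<^sub>R N r)"
    by (rule Ms.D_cong[OF open_\<Omega> q section_on_subset[OF H_section] H v]) auto
  also have "\<dots> = f q *\<^sub>R (D q v N - correction (\<psi> q) (d\<psi> q v) (N q))"
    by (simp add: Ms.D_scale[OF open_\<Omega> q N_section v f] df[OF q v] Ds_eq[OF open_\<Omega> q N_section v])
  finally show ?thesis by (simp add: correction_def eta_N[OF q])
qed

text \<open>The first derivative of H is f W with W tangential. Hence the normal part of the next
  derivative of W is -g(W, D N), and the term with \<open>nabla\<close> has no normal part because D
  N and \<phi> N are tangential.\<close>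

lemma laplacian_term:
  assumes S: "open S" "p \<in> S" and p: "p \<in> \<Omega>" and e: "vector_field_on \<A> S e"
  shows "g (\<psi> p) (Ds p (e p) (\<lambda>q. Ds q (e q) H) - Ds p (nabla p (e p) e) H) (N p) =
    - f p * (g (\<psi> p) (D p (e p) N) (D p (e p) N)
      - 2 * a * (\<eta> (\<psi> p) (d\<psi> p (e p)) * g (\<psi> p) (D p (e p) N) (\<phi> (\<psi> p) (N p)))
      + a\<^sup>2 * (\<eta> (\<psi> p) (d\<psi> p (e p)))\<^sup>2 + a * (g (\<psi> p) (\<phi> (\<psi> p) (N p)) (d\<psi> p (e p)))\<^sup>2)"
proof -
  let ?g = "g (\<psi> p)" and ?fN = "\<lambda>q. \<phi> (\<psi> q) (N q)" and ?U = "S \<inter> \<Omega>"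
  have U: "open ?U" "p \<in> ?U" using S p open_\<Omega> by auto
  have eU: "vector_field_on \<A> ?U e" using e by (rule vector_field_on_subset) simp
  have NU: "sect ?U N" using N_section by (rule section_on_subset) simp
  have fU: "smooth_fun_on \<A> ?U f" using f by (rule smooth_fun_on_subset) simp
  have eq: "e q \<in> tangent_space \<A> q" if "q \<in> ?U" for q using vector_field_on_tangent[OF eU that] .
  note ep = eq[OF U(2)] and fN = phi_N[OF p] and Np = N_tangent[OF p]
  note de = M.differential_tangent[OF ep] and DN = DN_tangent[OF p ep]
  define W where "W q = D q (e q) N - (a * g (\<psi> q) (\<xi> (\<psi> q)) (d\<psi> q (e q))) *\<^sub>R ?fN q" for q
  have W: "sect ?U W"
    unfolding W_def
    by (intro section_on_diff section_on_scale smooth_fun_on_cmult M.tensor_smooth_section xi_section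
        M.differential_section M.D_section[OF U(1) eU NU] phi_section NU U(1) eU)
  have Wp: "W p = D p (e p) N - (a * \<eta> (\<psi> p) (d\<psi> p (e p))) *\<^sub>R ?fN p"
    by (simp add: W_def metric_xi de)
  have WT: "W p \<in> tangent_space \<B> (\<psi> p)" by (rule section_on_tangent[OF W U(2)])
  have WN: "g (\<psi> q) (W q) (N q) = 0" if q: "q \<in> ?U" for q
  proof -
    have q': "q \<in> \<Omega>" using q by simp
    show ?thesis
      by (simp add: W_def tensor_simps tangent_closure DN_tangent[OF q' eq[OF q]] phi_N[OF q'] N_tangent[OF q']
          DN_normal[OF q' eq[OF q]])
  qed
  have "Ds p (e p) (\<lambda>q. Ds q (e q) H) = Ds p (e p) (\<lambda>q. f q *\<^sub>R W q)"
  proof (rule Ms.D_cong[OF U section_on_scale[OF fU W] _ ep, symmetric])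
    fix q assume q: "q \<in> ?U"
    then show "f q *\<^sub>R W q = Ds q (e q) H"
      using Ds_H[of q "e q"] eq[OF q] by (simp add: W_def metric_xi M.differential_tangent)
  qed
  also have "\<dots> = f p *\<^sub>R (D p (e p) W - correction (\<psi> p) (d\<psi> p (e p)) (W p))"
    by (simp add: Ms.D_scale[OF U W ep fU] df[OF p ep] Ds_eq[OF U W ep])
  finally have 1: "Ds p (e p) (\<lambda>q. Ds q (e q) H) = f p *\<^sub>R (D p (e p) W - correction (\<psi> p) (d\<psi> p (e p)) (W p))" .
  have nab: "nabla p (e p) e \<in> tangent_space \<A> p"
    by (rule I.D_tangent[OF S e[unfolded vector_field_on_def] ep])
  note DH = Ds_H[OF p nab]
  have 2: "?g (Ds p (nabla p (e p) e) H) (N p) = 0" "Ds p (nabla p (e p) e) H \<in> tangent_space \<B> (\<psi> p)"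
    by (simp_all add: DH tensor_simps tangent_closure DN_tangent[OF p nab] fN Np DN_normal[OF p nab])
  have "e p (\<lambda>q. g (\<psi> q) (W q) (N q)) = e p (\<lambda>q. 0)"
    by (rule M.A.tangent_vector_cong[OF ep U]) (rule WN)
  then have 3: "?g (D p (e p) W) (N p) = - ?g (W p) (D p (e p) N)"
    using M.D_metric[OF U W NU ep] tangent_vector_const[OF ep] by simp
  note DW = M.D_tangent[OF U W ep]
  have etaW: "\<eta> (\<psi> p) (W p) = - ?g (?fN p) (d\<psi> p (e p))"
    by (simp add: Wp structure_simps DN fN eta_DN[OF p ep])
  have phiN: "?g (\<phi> (\<psi> p) u) (N p) = - ?g (?fN p) u" if "u \<in> tangent_space \<B> (\<psi> p)" for u
    using phi_skew[OF that Np] tensor_sym[OF that fN(1)] by simp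
  have "?g (Ds p (e p) (\<lambda>q. Ds q (e q) H) - Ds p (nabla p (e p) e) H) (N p) =
      f p * (?g (D p (e p) W) (N p) - ?g (correction (\<psi> p) (d\<psi> p (e p)) (W p)) (N p))"
    using 2 by (simp add: 1 tensor_simps tangent_closure DW correction_tangent de WT Np)
  also have "?g (correction (\<psi> p) (d\<psi> p (e p)) (W p)) (N p) =
      a * (- \<eta> (\<psi> p) (d\<psi> p (e p)) * ?g (?fN p) (W p) + (?g (?fN p) (d\<psi> p (e p)))\<^sup>2)"
    by (simp add: correction_def tensor_simps structure_simps de WT Np phiN etaW power2_eq_square)
  also have "?g (?fN p) (W p) = ?g (D p (e p) N) (?fN p) - a * \<eta> (\<psi> p) (d\<psi> p (e p))"
    using tensor_sym[OF DN fN(1)] by (simp add: Wp tensor_simps tangent_closure DN fN)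
  also have "?g (D p (e p) W) (N p) = - ?g (D p (e p) N) (D p (e p) N)
      + a * \<eta> (\<psi> p) (d\<psi> p (e p)) * ?g (D p (e p) N) (?fN p)"
    using tensor_sym[OF DN fN(1)] by (simp add: 3) (simp add: Wp tensor_simps tangent_closure DN fN)
  finally show ?thesis by (simp add: power2_eq_square algebra_simps)
qed

text \<open>Summed over the frame, the squared components of \<xi> and of \<phi> N give 1 each by
  Parseval, and the mixed sum is g(D_\<xi> N, \<phi> N) = -1. So the mixed term contributes 2 a, the
  \<phi> N term a, and the \<xi> term the square of a.\<close>

lemma laplacian_normal:
  assumes S: "open S" "p \<in> S" and p: "p \<in> \<Omega>" and e: "orthonormal_on S e"
  shows "g (\<psi> p) (rough_laplacian (2 * m) Ds nabla e H p) (N p) = f p * (shape_norm (\<lambda>i. e i p) p + 3 * a + a\<^sup>2)"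
proof -
  let ?g = "g (\<psi> p)" and ?fN = "\<phi> (\<psi> p) (N p)" and ?eta = "\<lambda>i. \<eta> (\<psi> p) (d\<psi> p (e i p))"
  note b = frame_at[OF e S(2)] and fN = phi_N[OF p]
  have eT: "e i p \<in> tangent_space \<A> p" if "i < 2 * m" for i using basis_tangent[OF b that] .
  note deT = M.differential_tangent[OF eT]
  let ?t = "\<lambda>i. Ds p (e i p) (\<lambda>q. Ds q (e i q) H) - Ds p (nabla p (e i p) (e i)) H"
  have tT: "?t i \<in> tangent_space \<B> (\<psi> p)" if "i < 2 * m" for i
  proof -
    note ei = frame_field[OF e that]
    have "sect S H" using H_section by (rule section_on_subset) simp
    then show ?thesis
      by (intro tangent_diff Ms.D_tangent[OF S] Ms.D_section[OF S(1) ei] eT that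
          I.D_tangent[OF S ei[unfolded vector_field_on_def]])
  qed
  have "?g (rough_laplacian (2 * m) Ds nabla e H p) (N p) = - (\<Sum>i<2 * m. ?g (?t i) (N p))"
  proof -
    have sT: "(\<Sum>i<2 * m. ?t i) \<in> tangent_space \<B> (\<psi> p)" by (rule tangent_sum) (auto intro: tT)
    show ?thesis
      unfolding rough_laplacian_def tensor_minus_left[OF sT N_tangent[OF p]]
      using tensor_sum_left[of "{..<2 * m}" ?t "\<psi> p" "N p"] tT N_tangent[OF p] by simp
  qed
  also have "\<dots> = f p * (\<Sum>i<2 * m. ?g (D p (e i p) N) (D p (e i p) N) - 2 * a * (?eta i * ?g (D p (e i p) N) ?fN)
      + a\<^sup>2 * (?g (\<xi> (\<psi> p)) (d\<psi> p (e i p)) * ?g (\<xi> (\<psi> p)) (d\<psi> p (e i p)))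
      + a * (?g ?fN (d\<psi> p (e i p)) * ?g ?fN (d\<psi> p (e i p))))"
    unfolding sum_distrib_left sum_negf[symmetric]
    by (rule sum.cong) (auto simp: laplacian_term[OF S p frame_field[OF e]] metric_xi deT power2_eq_square)
  also have "\<dots> = f p * (shape_norm (\<lambda>i. e i p) p - 2 * a * (\<Sum>i<2 * m. ?eta i * ?g (D p (e i p) N) ?fN)
      + a\<^sup>2 * (\<Sum>i<2 * m. ?g (\<xi> (\<psi> p)) (d\<psi> p (e i p)) * ?g (\<xi> (\<psi> p)) (d\<psi> p (e i p)))
      + a * (\<Sum>i<2 * m. ?g ?fN (d\<psi> p (e i p)) * ?g ?fN (d\<psi> p (e i p))))"
    by (simp only: shape_norm_def sum.distrib sum_subtractf sum_distrib_left[symmetric])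
  also have "(\<Sum>i<2 * m. ?g (\<xi> (\<psi> p)) (d\<psi> p (e i p)) * ?g (\<xi> (\<psi> p)) (d\<psi> p (e i p))) = 1"
    using tangential_Parseval[OF p b xi_tangent _ xi_tangent]
    by (simp add: metric_xi N_tangent[OF p] eta_N[OF p] xi_tangent eta_xi)
  also have "(\<Sum>i<2 * m. ?g ?fN (d\<psi> p (e i p)) * ?g ?fN (d\<psi> p (e i p))) = 1"
    using tangential_Parseval[OF p b fN(1,3,1)] fN(5) by simp
  \<comment> \<open>The \<eta>-values are the frame coordinates of \<xi>, so linearity of D in its
    direction collects the sum into the derivative of N along \<xi>.\<close>
  also have "(\<Sum>i<2 * m. ?eta i * ?g (D p (e i p) N) ?fN) = - 1"
  proof -
    obtain v where v: "v \<in> tangent_space \<A> p" "\<xi> (\<psi> p) = d\<psi> p v" using xi_image by blast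
    have "?g (\<xi> (\<psi> p)) (N p) = 0" by (simp add: metric_xi N_tangent[OF p] eta_N[OF p])
    then have "d\<psi> p (\<Sum>i<2 * m. ?g (\<xi> (\<psi> p)) (d\<psi> p (e i p)) *\<^sub>R e i p) = \<xi> (\<psi> p)"
      unfolding linear_sum[OF M.linear_differential] M.differential_scale
      by (rule tangential_expansion[OF p b xi_tangent, symmetric])
    then have "d\<psi> p v = d\<psi> p (\<Sum>i<2 * m. ?g (\<xi> (\<psi> p)) (d\<psi> p (e i p)) *\<^sub>R e i p)"
      by (simp only: v(2))
    then have "v = (\<Sum>i<2 * m. ?g (\<xi> (\<psi> p)) (d\<psi> p (e i p)) *\<^sub>R e i p)"
      by (rule differential_inj[OF v(1), rotated]) (intro tangent_sum tangent_scale eT, simp)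
    then have "D p v N = (\<Sum>i<2 * m. ?g (\<xi> (\<psi> p)) (d\<psi> p (e i p)) *\<^sub>R D p (e i p) N)"
      using M.D_sum_dir[OF open_\<Omega> p N_section, of "{..<2 * m}" "\<lambda>i. e i p" "\<lambda>i. ?g (\<xi> (\<psi> p)) (d\<psi> p (e i p))"] eT by simp
    then have "?g (D p v N) ?fN = ?g (\<Sum>i<2 * m. ?g (\<xi> (\<psi> p)) (d\<psi> p (e i p)) *\<^sub>R D p (e i p) N) ?fN" by simp
    also have "\<dots> = (\<Sum>i<2 * m. ?g (?g (\<xi> (\<psi> p)) (d\<psi> p (e i p)) *\<^sub>R D p (e i p) N) ?fN)"
      by (rule tensor_sum_left[OF _ fN(1)]) (auto intro: tangent_scale DN_tangent[OF p] eT)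
    also have "\<dots> = (\<Sum>i<2 * m. ?eta i * ?g (D p (e i p) N) ?fN)"
      by (rule sum.cong) (auto simp: tensor_scale_left DN_tangent[OF p eT] fN metric_xi deT)
    finally show ?thesis by (simp add: DN_xi[OF p v(1) v(2)[symmetric]] tensor_minus_left fN)
  qed
  finally show ?thesis by (simp add: algebra_simps)
qed

text \<open>The slot of \<xi> gives -(1 + a)^2 and carries its own weight 1 / (k1 + k2). Each other
  slot gives -(c + 3) / 4, together with a multiple of the squared component of \<phi> N along b i;
  these squares add up to 1.\<close>

lemma ricci_trace_normal:
  assumes p: "p \<in> \<Omega>" and b: "orthonormal_at p b" "d\<psi> p (b 0) = \<xi> (\<psi> p)"
  shows "g (\<psi> p) (ricci_trace \<A> \<B> \<psi> nabs m c b H p) (N p) =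
    f p * ((1 / k2 m c) * (3 * a - 3 * (c - 1) / 4 - (2 * real m - 1) * (c + 3) / 4) - (1 + a)\<^sup>2 / (k1 m c + k2 m c))"
proof -
  let ?g = "g (\<psi> p)" and ?fN = "\<phi> (\<psi> p) (N p)"
  let ?R = "\<lambda>i. curvature_at \<B> nabs (\<psi> p) (d\<psi> p (b i)) (H p) (d\<psi> p (b i))"
  have bT: "b i \<in> tangent_space \<A> p" if "i < 2 * m" for i using basis_tangent[OF b(1) that] .
  note dT = M.differential_tangent[OF bT] and fN = phi_N[OF p] and Np = N_tangent[OF p]
  have R: "?R i = star_curv (\<psi> p) (d\<psi> p (b i)) (f p *\<^sub>R N p) (d\<psi> p (b i))" if "i < 2 * m" for i
    using star_curvature_at[OF dT[OF that] H_tangent dT[OF that]] H[OF p] by simp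
  have RT: "?R i \<in> tangent_space \<B> (\<psi> p)" if "i < 2 * m" for i
    unfolding R[OF that] star_curv_def curv_def by (simp add: structure_simps dT[OF that] Np)
  have phiN: "?g (\<phi> (\<psi> p) u) (N p) = - ?g ?fN u" "?g ?fN u = ?g u ?fN" if "u \<in> tangent_space \<B> (\<psi> p)" for u
    using phi_skew[OF that Np] tensor_sym[OF that fN(1)] by simp_all
  have 0: "?g (?R 0) (N p) = f p * (- (1 + a)\<^sup>2)"
  proof -
    have m0: "0 < 2 * m" using m2 by simp
    show ?thesis
      unfolding R[OF m0] unfolding b(2) star_curv_def
      by (simp add: tensor_left curv_def structure_simps Np eta_N[OF p] N_unit[OF p] metric_xi fN)
        (simp add: field_simps power2_eq_square)
  qed
  have i: "?g (?R i) (N p) = f p * ((3 * a - 3 * (c - 1) / 4) * (?g ?fN (d\<psi> p (b i)) * ?g ?fN (d\<psi> p (b i))) - (c + 3) / 4)"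
    if "i \<in> {1..<2 * m}" for i
  proof -
    have i2: "i < 2 * m" using that by simp
    note d = dT[OF i2]
    have "0 < 2 * m" using m2 by simp
    then have e: "\<eta> (\<psi> p) (d\<psi> p (b i)) = 0"
      using basis_orthonormal[OF b(1), of 0 i] that b(2) by (simp add: metric_xi d)
    have bb: "?g (d\<psi> p (b i)) (d\<psi> p (b i)) = 1" using basis_orthonormal[OF b(1) i2 i2] by simp
    show ?thesis
      unfolding R[OF i2] star_curv_def
      by (simp add: tensor_left curv_def structure_simps d Np eta_N[OF p] N_unit[OF p] fN e bb
          N_orthogonal[OF p bT[OF i2]] N_orthogonal'[OF p bT[OF i2]] tensor_scale_right phiN[OF d] phi_self)
        (simp add: field_simps power2_eq_square)
  qed
  have "?g (\<Sum>i=1..<2 * m. ?R i) (N p) = (\<Sum>i=1..<2 * m. ?g (?R i) (N p))"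
    by (rule tensor_sum_left[OF _ Np]) (auto intro: RT)
  also have "\<dots> = (\<Sum>i=1..<2 * m. f p * ((3 * a - 3 * (c - 1) / 4) * (?g ?fN (d\<psi> p (b i)) * ?g ?fN (d\<psi> p (b i))) - (c + 3) / 4))"
    by (rule sum.cong[OF refl i])
  also have "\<dots> = f p * ((3 * a - 3 * (c - 1) / 4) * (\<Sum>i=1..<2 * m. ?g ?fN (d\<psi> p (b i)) * ?g ?fN (d\<psi> p (b i)))
      - (2 * real m - 1) * ((c + 3) / 4))"
    using m2 by (simp only: sum_distrib_left[symmetric] sum_subtractf sum_constant card_atLeastLessThan)
      (simp add: of_nat_diff)
  also have "(\<Sum>i=1..<2 * m. ?g ?fN (d\<psi> p (b i)) * ?g ?fN (d\<psi> p (b i))) = 1"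
  proof -
    \<comment> \<open>The sum starts at 1, but the missing slot of \<xi> contributes nothing, so
      Parseval over the whole basis applies.\<close>
    have "?g ?fN (d\<psi> p (b 0)) = 0" by (simp add: b(2) metric_xi fN)
    moreover have "{..<2 * m} = insert 0 {1..<2 * m}" using m2 by auto
    ultimately show ?thesis
      using tangential_Parseval[OF p b(1) fN(1,3,1)] fN(5) by simp
  qed
  finally have s: "?g (\<Sum>i=1..<2 * m. ?R i) (N p) = f p * (3 * a - 3 * (c - 1) / 4 - (2 * real m - 1) * ((c + 3) / 4))"
    by simp
  have sT: "(\<Sum>i=1..<2 * m. ?R i) \<in> tangent_space \<B> (\<psi> p)" by (rule tangent_sum) (auto intro: RT)
  have R0: "?R 0 \<in> tangent_space \<B> (\<psi> p)" by (rule RT) (use m2 in simp)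
  have "?g (ricci_trace \<A> \<B> \<psi> nabs m c b H p) (N p) =
      (1 / k2 m c) * ?g (\<Sum>i=1..<2 * m. ?R i) (N p) + (1 / (k1 m c + k2 m c)) * ?g (?R 0) (N p)"
    unfolding ricci_trace_def Let_def
    by (simp only: tensor_add_left[OF tangent_scale[OF sT] tangent_scale[OF R0] Np] tensor_scale_left[OF sT Np]
        tensor_scale_left[OF R0 Np])
  then show ?thesis unfolding s 0 by (simp add: algebra_simps add_divide_distrib diff_divide_distrib)
qed

end

end

text \<open>Here \<open>s = 2m / k2\<close>, \<open>K = (c + 3) / 4\<close> and \<open>Q = |A|\<^sup>2 - 2\<close>.\<close>

lemma no_admissible_curvature:
  fixes m :: nat and s K Q :: real
  assumes m: "m \<ge> 2" and s: "s \<noteq> 0" and K: "(real m + 1) * K = real m / s + 1"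
    and Q: "real m * Q = real m * (1 - s - s\<^sup>2) - (s\<^sup>2 - s)" and QK: "Q \<ge> K" "Q \<ge> - 2 * K"
  shows False
proof -
  define x where "x = real m"
  have x: "x \<ge> 2" using m by (simp add: x_def)
  note K = K[folded x_def] and Q = Q[folded x_def]
  \<comment> \<open>For s >= 1, K is positive and Q negative; for 0 < s < 1, K >= 1 and Q < 1. A
    negative s, possible as \<open>Ric\<close> may be indefinite, makes the first bound too weak and
    needs Q >= -2 K.\<close>
  consider "s \<ge> 1" | "0 < s" "s < 1" | "s < 0" using s by linarith
  then show False
  proof cases
    case 1
    have "x / s + 1 > 0" using 1 x by (simp add: add_pos_pos)
    then have "K > 0" using K x by (metis add_pos_pos less_trans zero_less_mult_pos zero_less_numeral zero_less_one order_less_le_trans)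
    moreover have "x * Q \<le> x * (1 - s - s\<^sup>2)" using Q 1 by (simp add: power2_eq_square mult_left_mono)
    then have "Q \<le> 1 - s - s\<^sup>2" using x by (simp add: mult_le_cancel_left)
    ultimately show False using QK(1) 1 zero_le_power2[of s] by linarith
  next
    case 2
    have "x / s \<ge> x" using 2 x by (simp add: field_simps)
    then have "(x + 1) * K \<ge> (x + 1) * 1" using K by simp
    then have "K \<ge> 1" using x by (simp add: mult_le_cancel_left)
    moreover have "x * Q < x * 1"
    proof -
      have "s < x * s" "0 \<le> x * s\<^sup>2" using 2 x by simp_all
      moreover have "x * Q = x - x * s - x * s\<^sup>2 - s\<^sup>2 + s" using Q by (simp add: algebra_simps)
      ultimately show ?thesis using zero_le_power2[of s] by linarith
    qed
    then have "Q < 1" using x by (simp add: mult_less_cancel_left)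
    ultimately show False using QK(1) by linarith
  next
    case 3
    define t where "t = - s"
    have t: "t > 0" using 3 by (simp add: t_def)
    have Kt: "(x + 1) * t * K = t - x"
    proof -
      have "(x + 1) * K = 1 - x / t" using K by (simp add: t_def)
      then have "t * ((x + 1) * K) = t * (1 - x / t)" by (rule arg_cong)
      also have "\<dots> = t - x" using t by (simp add: algebra_simps)
      finally show ?thesis by (simp add: ac_simps)
    qed
    have Qt: "x * Q = x * (1 + t - t\<^sup>2) - (t\<^sup>2 + t)" using Q by (simp add: t_def)
    \<comment> \<open>The positive factor clears the denominators of K and Q, leaving a polynomial
      inequality in x and t.\<close>
    have "x * ((x + 1) * t) * Q \<ge> x * ((x + 1) * t) * (- 2 * K)"
      using QK(2) x t by (intro mult_left_mono) auto
    then have "(x + 1) * t * (x * Q) \<ge> - 2 * x * ((x + 1) * t * K)" by (simp add: algebra_simps)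
    then have "(x + 1) * t * (x * (1 + t - t\<^sup>2) - (t\<^sup>2 + t)) \<ge> 2 * x * (x - t)"
      unfolding Kt Qt by (simp add: algebra_simps)
    \<comment> \<open>Grouped by powers of x so that every summand is visibly nonnegative; x - 3 / 2
      is positive because m >= 2.\<close>
    moreover have "(x + 1) * t * (x * (1 + t - t\<^sup>2) - (t\<^sup>2 + t)) - 2 * x * (x - t) =
       - (x\<^sup>2 * ((t - 1)\<^sup>2 * (t + 1)) + x * (2 * t ^ 3 - 3 * t + 3 / 2) + x * (x - 3 / 2) + (t\<^sup>2 + t ^ 3))"
      by (simp add: power2_eq_square power3_eq_cube algebra_simps)
    moreover have "x\<^sup>2 * ((t - 1)\<^sup>2 * (t + 1)) \<ge> 0" using t by simp
    moreover have "2 * t ^ 3 - 3 * t + 3 / 2 \<ge> 0"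
    proof -
      \<comment> \<open>The cubic has its positive minimum at 1 / sqrt 2. The rational point 5 / 7
        lies close to it, and the shift 10 / 7 is twice that so that the quadratic term cancels; the
        remainder has positive coefficients.\<close>
      have "2 * t ^ 3 - 3 * t + 3 / 2 = 2 * (t - 5 / 7)\<^sup>2 * (t + 10 / 7) + 3 / 49 * t + 29 / 686"
        by (simp add: power2_eq_square power3_eq_cube field_simps)
      also have "\<dots> \<ge> 0" using t by (intro add_nonneg_nonneg mult_nonneg_nonneg) auto
      finally show ?thesis .
    qed
    then have "x * (2 * t ^ 3 - 3 * t + 3 / 2) \<ge> 0" using x by simp
    moreover have "x * (x - 3 / 2) > 0" using x by simp
    moreover have "t\<^sup>2 + t ^ 3 > 0" using t by (simp add: add_pos_pos)
    ultimately show False by linarith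
  qed
qed

lemma (in mean_curved_hypersurface) ricci_trace_tangent:
  assumes b: "orthonormal_at p b"
  shows "ricci_trace \<A> \<B> \<psi> nabs m c b H p \<in> tangent_space \<B> (\<psi> p)"
proof -
  have R: "curvature_at \<B> nabs (\<psi> p) (d\<psi> p (b i)) (H p) (d\<psi> p (b i)) \<in> tangent_space \<B> (\<psi> p)" if "i < 2 * m" for i
  proof -
    note d = M.differential_tangent[OF basis_tangent[OF b that]]
    show ?thesis
      unfolding star_curvature_at[OF d H_tangent d] star_curv_def curv_def
      by (simp add: structure_simps d H_tangent)
  qed
  show ?thesis
    unfolding ricci_trace_def Let_def by (intro tangent_add tangent_scale tangent_sum R) (use m2 in auto)
qed

text \<open>The Ricci-biharmonic equation is evaluated only at the assumed point with H nonzero. The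
  open set around it serves to make |H| and N smooth and to differentiate |H| along
  brackets.\<close>

lemma (in mean_curved_hypersurface) minimal:
  assumes hopf: "pseudo_hopf \<A> \<B> \<psi> \<phi> \<xi> g D"
    and biharmonic: "ricci_biharmonic \<A> \<B> \<psi> \<xi> g nabla nabs Ds m c H"
    and gradient: "\<And>p. smooth_near \<A> p (\<lambda>q. sqrt (g (\<psi> q) (H q) (H q))) \<Longrightarrow>
        has_gradient \<A> (pullback_metric \<A> \<B> \<psi> g) (\<lambda>q. sqrt (g (\<psi> q) (H q) (H q))) p
          (\<alpha> p *\<^sub>R tangent_lift \<A> \<B> \<psi> p (\<xi> (\<psi> p)))"
  shows "H p = 0"
proof (rule ccontr)
  assume Hp: "H p \<noteq> 0"
  define G where "G q = g (\<psi> q) (H q) (H q)" for q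
  define \<Omega> where "\<Omega> = {q. H q \<noteq> 0}"
  define f where "f q = sqrt (G q)" for q
  define N where "N q = (1 / f q) *\<^sub>R H q" for q
  have Gs: "smooth_fun_on \<A> UNIV G"
    unfolding G_def by (rule M.tensor_smooth_section[OF open_UNIV H_section H_section])
  have Gpos: "G q > 0" if "q \<in> \<Omega>" for q
    using metric_pos[OF H_tangent] that by (simp add: G_def \<Omega>_def)
  have "G q = 0" if "q \<notin> \<Omega>" for q
    using that tensor_zero_left[OF H_tangent[of q]] by (simp add: G_def \<Omega>_def)
  then have "\<Omega> = G -` {0<..}" using Gpos by force
  then have \<Omega>: "open \<Omega>"
    using M.A.smooth_fun_on_continuous[OF Gs open_UNIV] by (simp add: open_vimage)
  have Gs\<Omega>: "smooth_fun_on \<A> \<Omega> G" using Gs by (rule smooth_fun_on_subset) simp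
  have powr: "smooth_fun_on \<A> \<Omega> (\<lambda>q. G q powr r)" for r
    by (rule M.A.smooth_fun_on_compose[OF smooth_on_powr Gs\<Omega>]) (use Gpos in auto)
  have fs: "smooth_fun_on \<A> \<Omega> f"
    by (rule M.A.smooth_fun_on_cong[OF \<Omega> _ powr[of "1 / 2"]]) (simp add: f_def powr_half_sqrt less_imp_le Gpos)
  have fs': "smooth_fun_on \<A> \<Omega> (\<lambda>q. 1 / f q)"
    by (rule M.A.smooth_fun_on_cong[OF \<Omega> _ powr[of "- (1 / 2)"]])
      (simp add: f_def powr_minus_divide powr_half_sqrt less_imp_le Gpos)
  have fpos: "f q > 0" if "q \<in> \<Omega>" for q using Gpos[OF that] by (simp add: f_def)
  have Ns: "sect \<Omega> N"
    unfolding N_def by (rule section_on_scale[OF fs' section_on_subset[OF H_section subset_UNIV]])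
  have "unit_normal_on \<A> \<B> \<psi> g \<Omega> N"
    unfolding unit_normal_on_def
  proof (intro conjI ballI Ns)
    fix q assume q: "q \<in> \<Omega>"
    have "f q * f q = G q" using Gpos[OF q] by (simp add: f_def)
    then show "g (\<psi> q) (N q) (N q) = 1"
      using fpos[OF q] Gpos[OF q] by (simp add: N_def tensor_scale_left tensor_scale_right H_tangent tangent_scale flip: G_def)
    show "g (\<psi> q) (N q) (d\<psi> q v) = 0" if "v \<in> tangent_space \<A> q" for v
      by (simp add: N_def tensor_scale_left H_tangent M.differential_tangent[OF that] H_normal[OF that])
  qed
  then interpret N: hopf_normal_field \<B> \<phi> \<xi> \<eta> g nab c Ric nabs m \<A> \<psi> nabla D Ds H \<Omega> N
    by unfold_locales (use \<Omega> hopf in auto)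
  have HN: "H q = f q *\<^sub>R N q" if "q \<in> \<Omega>" for q using fpos[OF that] by (simp add: N_def)
  have biharmonic': "\<exists>S e b. open S \<and> q \<in> S \<and> orthonormal_on S e \<and> orthonormal_at q b \<and> d\<psi> q (b 0) = \<xi> (\<psi> q) \<and>
      - rough_laplacian (2 * m) Ds nabla e H q - ricci_trace \<A> \<B> \<psi> nabs m c b H q = 0" for q
    by (rule biharmonic[unfolded ricci_biharmonic_def, THEN spec])
  have grad: "v f = \<alpha> q * \<eta> (\<psi> q) (d\<psi> q v)" if q: "q \<in> \<Omega>" and v: "v \<in> tangent_space \<A> q" for q v
  proof -
    obtain w where w: "w \<in> tangent_space \<A> q" "\<xi> (\<psi> q) = d\<psi> q w" using xi_image by blast
    have "smooth_near \<A> q f" by (rule smooth_nearI[OF \<Omega> q fs])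
    then have "has_gradient \<A> (pullback_metric \<A> \<B> \<psi> g) f q (\<alpha> q *\<^sub>R w)"
      using gradient[of q] tangent_lift_eq[OF w(1) w(2)[symmetric]] by (simp add: f_def[abs_def] G_def)
    then have "g (\<psi> q) (d\<psi> q (\<alpha> q *\<^sub>R w)) (d\<psi> q v) = v f"
      using v unfolding has_gradient_def pullback_metric_def by blast
    then show ?thesis
      using M.differential_tangent[OF v] by (simp add: M.differential_scale w(2)[symmetric] tensor_scale_left xi_tangent metric_xi)
  qed
  have df: "v f = 0" if q: "q \<in> \<Omega>" and v: "v \<in> tangent_space \<A> q" for q v
  proof -
    \<comment> \<open>The Ricci-biharmonic hypothesis provides at every point an orthonormal basis
      that starts with \<xi>.\<close>
    obtain b where b: "orthonormal_at q b" "d\<psi> q (b 0) = \<xi> (\<psi> q)" using biharmonic'[of q] by blast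
    show ?thesis by (rule N.gradient_zero[OF q b fs grad v])
  qed
  have p: "p \<in> \<Omega>" using Hp by (simp add: \<Omega>_def)
  obtain S e b where S: "open S" "p \<in> S" "orthonormal_on S e" and b: "orthonormal_at p b" "d\<psi> p (b 0) = \<xi> (\<psi> p)"
    and eq: "- rough_laplacian (2 * m) Ds nabla e H p - ricci_trace \<A> \<B> \<psi> nabs m c b H p = 0"
    using biharmonic'[of p] by blast
  have laplacian: "g (\<psi> p) (rough_laplacian (2 * m) Ds nabla e H p) (N p) =
      f p * (N.shape_norm (\<lambda>i. e i p) p + 3 * a + a\<^sup>2)"
    by (rule N.laplacian_normal[where f = f], rule fs, erule HN, erule (1) df) (rule S p)+
  have trace_normal: "g (\<psi> p) (ricci_trace \<A> \<B> \<psi> nabs m c b H p) (N p) =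
      f p * ((1 / k2 m c) * (3 * a - 3 * (c - 1) / 4 - (2 * real m - 1) * (c + 3) / 4) - (1 + a)\<^sup>2 / (k1 m c + k2 m c))"
    by (rule N.ricci_trace_normal[where f = f], rule fs, erule HN, erule (1) df) (rule b p)+
  define L where "L = N.shape_norm (\<lambda>i. e i p) p"
  have trace: "ricci_trace \<A> \<B> \<psi> nabs m c b H p = - rough_laplacian (2 * m) Ds nabla e H p"
    by (rule eq[unfolded right_minus_eq, symmetric])
  have "rough_laplacian (2 * m) Ds nabla e H p = - ricci_trace \<A> \<B> \<psi> nabs m c b H p"
    unfolding trace by (rule minus_minus[symmetric])
  moreover have "ricci_trace \<A> \<B> \<psi> nabs m c b H p \<in> tangent_space \<B> (\<psi> p)"
    by (rule ricci_trace_tangent[OF b(1)])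
  ultimately have "g (\<psi> p) (rough_laplacian (2 * m) Ds nabla e H p) (N p) = - g (\<psi> p) (ricci_trace \<A> \<B> \<psi> nabs m c b H p) (N p)"
    by (simp add: tensor_minus_left N.N_tangent[OF p])
  then have "f p * (L + 3 * a + a\<^sup>2) = - (f p * ((1 / k2 m c) * (3 * a - 3 * (c - 1) / 4 - (2 * real m - 1) * (c + 3) / 4)
      - (1 + a)\<^sup>2 / (k1 m c + k2 m c)))"
    unfolding L_def laplacian trace_normal .
  then have "f p * (L + 3 * a + a\<^sup>2) = f p * (- ((1 / k2 m c) * (3 * a - 3 * (c - 1) / 4 - (2 * real m - 1) * (c + 3) / 4)
      - (1 + a)\<^sup>2 / (k1 m c + k2 m c)))" by (simp only: mult_minus_right)
  then have eqL: "L + 3 * a + a\<^sup>2 = - ((1 / k2 m c) * (3 * a - 3 * (c - 1) / 4 - (2 * real m - 1) * (c + 3) / 4)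
      - (1 + a)\<^sup>2 / (k1 m c + k2 m c))" using fpos[OF p] by (simp only: mult_cancel_left) simp
  define x where "x = real m"
  define K where "K = (c + 3) / 4"
  define s where "s = 1 + a"
  have x: "x > 0" using m2 by (simp add: x_def)
  have k12: "k1 m c + k2 m c = 2 * x" by (simp add: k1_def k2_def x_def field_simps)
  \<comment> \<open>The coefficient of c in k2 is (m + 1) / 2, so k2 is affine in K. Combined with
    k2 = 2 m / s this yields the relation between K and s.\<close>
  have k2K: "k2 m c = 2 * (x + 1) * K - 2" by (simp add: k2_def x_def K_def field_simps)
  have sk: "s * k2 m c = 2 * x" using k2_a k12 by (simp add: s_def algebra_simps)
  have s0: "s \<noteq> 0" using sk x by auto
  have k2s: "k2 m c = 2 * x / s" using sk s0 by (simp add: field_simps)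
  show False
  proof (rule no_admissible_curvature[OF m2 s0])
    show "(real m + 1) * K = real m / s + 1"
    proof -
      have "2 * ((x + 1) * K) - 2 = 2 * (x / s)" using k2K k2s by (simp add: ac_simps)
      then show ?thesis unfolding x_def by linarith
    qed
    show "real m * (L - 2) = real m * (1 - s - s\<^sup>2) - (s\<^sup>2 - s)"
    proof -
      \<comment> \<open>The curvature constants of the trace collapse to k2 - 1, so after division
        by k2 only s, a and m remain.\<close>
      have *: "3 * a - 3 * (c - 1) / 4 - (2 * real m - 1) * (c + 3) / 4 = 3 * a - (k2 m c - 1)"
        by (simp add: k2_def field_simps)
      have "L + 3 * a + a\<^sup>2 = - ((1 / k2 m c) * (3 * a - (k2 m c - 1)) - s\<^sup>2 / (2 * x))"
        using eqL unfolding * k12 s_def .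
      also have "1 / k2 m c = s / (2 * x)" by (simp add: k2s)
      also have "s / (2 * x) * (3 * a - (k2 m c - 1)) = s * (3 * a + 1) / (2 * x) - 1"
        using x s0 by (simp add: k2s field_simps)
      finally have "L = 1 - 3 * a - a\<^sup>2 - s * (3 * a + 1) / (2 * x) + s\<^sup>2 / (2 * x)" by simp
      then have xL: "2 * (x * L) = 2 * (x * (1 - 3 * a - a\<^sup>2)) - s * (3 * a + 1) + s\<^sup>2"
        using x by (simp add: field_simps)
      have as: "a = s - 1" by (simp add: s_def)
      have "2 * (x * (L - 2)) = 2 * (x * L) - 4 * x" by (simp add: algebra_simps)
      also have "\<dots> = 2 * (x * (1 - s - s\<^sup>2) - (s\<^sup>2 - s))"
        unfolding xL as by (simp add: power2_eq_square algebra_simps)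
      finally show ?thesis by (simp add: x_def)
    qed
    show "L - 2 \<ge> K" "L - 2 \<ge> - 2 * K"
      unfolding L_def K_def by (rule N.shape_norm_bounds[OF p frame_at[OF S(3,2)] b])+
  qed
qed

text \<open>The gradient condition is imposed at points near which |H| is smooth, because |H| need
  not be differentiable at a zero of H. The bound m >= 2 makes D nonzero.\<close>

theorem corollary4p5:
  fixes \<A> :: "('a::{t2_space, second_countable_topology}, 'd::euclidean_space) atlas"
    and \<B> :: "('b::{t2_space, second_countable_topology}, 'e::euclidean_space) atlas"
    and \<phi> :: "'b \<Rightarrow> 'b tvec \<Rightarrow> 'b tvec" and \<xi> :: "'b \<Rightarrow> 'b tvec" and \<eta> :: "'b \<Rightarrow> 'b tvec \<Rightarrow> real"
    and gbar Ric :: "'b \<Rightarrow> 'b tvec \<Rightarrow> 'b tvec \<Rightarrow> real"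
    and nablabar nablastar :: "('b, 'b) conn"
    and \<psi> :: "'a \<Rightarrow> 'b" and nabla :: "('a, 'a) conn" and Dbar Dstar :: "('a, 'b) conn"
    and H :: "'a \<Rightarrow> 'b tvec" and \<alpha> :: "'a \<Rightarrow> real" and m :: nat and c :: real
  assumes "m \<ge> 2" and "DIM('e) = 2 * m + 1" and "DIM('d) = 2 * m"
    and "sasakian_space_form \<B> \<phi> \<xi> \<eta> gbar nablabar c"
    and "ricci_tensor \<B> gbar nablabar Ric" and "pseudo_riemannian_metric \<B> Ric"
    and "levi_civita \<B> Ric nablastar"
    and "smooth_atlas \<A>" and "immersion \<A> \<B> \<psi>"
    and "levi_civita \<A> (pullback_metric \<A> \<B> \<psi> gbar) nabla"
    and "pullback_connection \<A> \<B> \<psi> nablabar Dbar"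
    and "pullback_connection \<A> \<B> \<psi> nablastar Dstar"
    and xi_tangent: "\<And>p. \<xi> (\<psi> p) \<in> differential \<A> \<B> \<psi> p ` tangent_space \<A> p"
    and "mean_curvature_field \<A> \<B> \<psi> gbar nabla Dbar H"
    and "ricci_biharmonic \<A> \<B> \<psi> \<xi> gbar nabla nablastar Dstar m c H"
    and "pseudo_hopf \<A> \<B> \<psi> \<phi> \<xi> gbar Dbar"
    and grad_H: "\<And>p. smooth_near \<A> p (\<lambda>q. sqrt (gbar (\<psi> q) (H q) (H q))) \<Longrightarrow>
        has_gradient \<A> (pullback_metric \<A> \<B> \<psi> gbar) (\<lambda>q. sqrt (gbar (\<psi> q) (H q) (H q))) p
          (\<alpha> p *\<^sub>R tangent_lift \<A> \<B> \<psi> p (\<xi> (\<psi> p)))"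
  shows "\<forall>p. H p = 0"
proof
  fix p
  interpret X: mean_curved_hypersurface \<B> \<phi> \<xi> \<eta> gbar nablabar c Ric nablastar m \<A> \<psi> nabla Dbar Dstar H
  proof (unfold_locales, goal_cases)
    \<comment> \<open>The goal m >= 1 of \<open>ricci_form\<close> is the one that is not literally
      an assumption.\<close>
    case 4 then show ?case using assms(1) by simp
  qed (fact assms)+
  show "H p = 0" by (rule X.minimal[OF assms(16,15) grad_H])
qed

end
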